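(* Let $T>0$ and $c>0$. (i) (Isentropic Euler.) Let $n\ge 1$, $\gamma>1$, $\kappa>0$, and $G\in L^\infty([0,T];L^2(\mathbb{T}^n;\mathbb{R}^n))$. Let $H:[0,T]\times\mathbb{T}^n\to\mathbb{R}$ be Lipschitz continuous with $H\geq c$ everywhere, let $U\in C^1([0,T]\times\mathbb{T}^n;\mathbb{R}^n)$, and suppose that $(H,U)$ is a solution of $$\partial_t h+\operatorname{div}(hu)=0,\qquad \partial_t(hu)+\operatorname{div}(hu\otimes u)+\nabla(\kappa h^\gamma)=hG .$$ Then every admissible measure-valued solution $(\nu,m,\nu^\infty)$ of this system on $[0,T]$ with initial data $(h_0,u_0)=(H(0,\cdot),U(0,\cdot))$ coincides with $(H,U)$, i.e. $\nu_{t,x}=\delta_{(H(t,x),\sqrt{H(t,x)}\,U(t,x))}$ for a.e. $(t,x)\in[0,T]\times\mathbb{T}^n$, and $m=0$. (ii) (Savage-Hutter.) Let $n\in\{1,2\}$, $a>0$, $d>0$, and $f\in L^\infty([0,T];L^2(\mathbb{T}^n;\mathbb{R}^n))$. Let $H:[0,T]\times\mathbb{T}^n\to\mathbb{R}$ be Lipschitz continuous with $H\geq c$ everywhere, let $U\in C^1([0,T]\times\mathbb{T}^n;\mathbb{R}^n)$, and suppose that $(H,U)$ is a solution of $$\partial_t h+\operatorname{div}(hu)=0,\qquad \partial_t(hu)+\operatorname{div}(hu\otimes u)+\nabla(a h^2)=h\left(-dB(u)+f\right).$$ Then every admissible measure-valued solution of this system on $[0,T]$ with initial data $(h_0,u_0)=(H(0,\cdot),U(0,\cdot))$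 coincides with $(H,U)$, i.e. $\nu_{t,x}=\delta_{(H(t,x),\sqrt{H(t,x)}\,U(t,x))}$ for a.e. $(t,x)\in[0,T]\times\mathbb{T}^n$, and $m=0$.
   Context: Notation. $\mathbb{T}^n=\mathbb{R}^n/\mathbb{Z}^n$; $\mathbb{R}^+=[0,\infty)$; $\nabla,\operatorname{div}$ act on the space variable only; $(u\otimes v)_{ij}=u_iv_j$; the divergence of a matrix field is taken row-wise. $\mathcal{M}^+(X)$ is the set of locally finite nonnegative measures on $X$, $\mathcal{P}(X)$ the set of probability measures on $X$, and $L^\infty_w(\Omega,m;\mathcal{P}(X))$ the set of maps $x\mapsto\nu_x\in\mathcal{P}(X)$ that are weakly* measurable with respect to $m$ (Lebesgue measure if $m$ is omitted). We write $\langle F,\nu_{t,x}\rangle=\int F\,d\nu_{t,x}$, with integration variables $(\lambda_1,\lambda')\in\mathbb{R}^+\times\mathbb{R}^n$ for $\nu_{t,x}$ (representing $h$ and $\sqrt h\,u$) and $(\beta_1,\beta')\in\mathbb{S}^+$ for $\nu^\infty_{t,x}$, where, with exponent $\gamma$ ($\gamma=2$ for Savage-Hutter), $$\mathbb{S}^+=\{(\beta_1,\beta')\in\mathbb{R}\times\mathbb{R}^n:\ |\beta_1|^{2\gamma}+|\beta'|^{4}=1,\ \beta_1\ge 0\}.$$ Generalised Young measure on $[0,T]\times\mathbb{T}^n$: a triple $(\nu,m,\nu^\infty)$ with $\nu\in L^\infty_w([0,T]\times\mathbb{T}^n;\mathcal{P}(\mathbb{R}^+\times\mathbb{R}^n))$,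 $m\in\mathcal{M}^+([0,T]\times\mathbb{T}^n)$ and $\nu^\infty\in L^\infty_w([0,T]\times\mathbb{T}^n,m;\mathcal{P}(\mathbb{S}^+))$. Set $\overline h=\langle\lambda_1,\nu\rangle$, $\overline{hu}=\langle\sqrt{\lambda_1}\lambda',\nu\rangle$, $\overline{h^\gamma}=\langle\lambda_1^\gamma,\nu\rangle\,dt\,dx+\langle\beta_1^\gamma,\nu^\infty\rangle m$, $\overline{hu\otimes u}=\langle\lambda'\otimes\lambda',\nu\rangle\,dt\,dx+\langle\beta'\otimes\beta',\nu^\infty\rangle m$, $\overline{h|u|^2}=\langle|\lambda'|^2,\nu\rangle\,dt\,dx+\langle|\beta'|^2,\nu^\infty\rangle m$. Integrals of the last three quantities over $dx\,dt$ are integrals against these measures. For admissible solutions $m=m_t(dx)\otimes dt$ with $m_t\in\mathcal{M}^+(\mathbb{T}^n)$ for a.e. $t$; the integral over $\mathbb{T}^n$ of such a quantity at time $t$ means, e.g., $\int_{\mathbb{T}^n}\overline{h^\gamma}(t,x)\,dx=\int_{\mathbb{T}^n}\langle\lambda_1^\gamma,\nu_{t,x}\rangle dx+\int_{\mathbb{T}^n}\langle\beta_1^\gamma,\nu^\infty_{t,x}\rangle dm_t(x)$. Measure-valued solution of the Euler system with initial data $(h_0,u_0)$, $h_0\in L^1$, $h_0u_0\in L^1$: a generalised Young measure such that for a.e. $\tau\in[0,T]$ and all $\psi\in C^1([0,T]\times\mathbb{T}^n;\mathbb{R})$, $\phi\in C^1([0,T]\times\mathbb{T}^n;\mathbb{R}^n)$,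 $$\int_0^\tau\!\!\int_{\mathbb{T}^n}\partial_t\psi\,\overline h+\nabla\psi\cdot\overline{hu}\,dx\,dt+\int_{\mathbb{T}^n}\psi(0,x)h_0-\psi(\tau,x)\overline h(\tau,x)\,dx=0,$$ $$\int_0^\tau\!\!\int_{\mathbb{T}^n}\partial_t\phi\cdot\overline{hu}+\nabla\phi:\overline{hu\otimes u}+\kappa\operatorname{div}\phi\;\overline{h^\gamma}+\phi\cdot \overline h\,G\,dx\,dt+\int_{\mathbb{T}^n}\phi(0,x)\cdot h_0u_0-\phi(\tau,x)\cdot\overline{hu}(\tau,x)\,dx=0,$$ where existence of all integrals is part of the definition. It is admissible if, in the sense of distributions in $t$ (i.e. for a.e. $t$), $$E_{mvs}(t)\le E_0+\int_0^t\int_{\mathbb{T}^n}\overline{hu}\cdot G\,dx\,ds,$$ where $E_{mvs}(t)=\int_{\mathbb{T}^n}\frac12\overline{h|u|^2}(t,x)+\frac{\kappa}{\gamma-1}\overline{h^\gamma}(t,x)\,dx$ and $E_0=\int_{\mathbb{T}^n}\frac12h_0|u_0|^2+\frac{\kappa}{\gamma-1}h_0^\gamma\,dx$. Savage-Hutter. $B$ is the (multi-valued) subdifferential of $u\mapsto|u|$ on $\mathbb{R}^n$: $B(u)=u/|u|$ if $u\ne0$ and $B(0)=\overline{B_1(0)}$, the closed unit ball. The momentum equation is understood as an inclusion: for a solution $(H,U)$ there is a measurable $b$ with $b(t,x)\in B(U(t,x))$ a.e. such that the equation holds with $b$ in place of $B(U)$. Put $\tilde f(t,x,v)=-dB(v)+f(t,x)$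 (set-valued, $-\tilde f(t,x,\cdot)$ is maximal monotone), and let $J_{t,x}=(\mathrm{Id}-\tilde f(t,x,\cdot))^{-1}:\mathbb{R}^n\to\mathbb{R}^n$, which is a single-valued Lipschitz map; the selection $\tilde f\circ J_{t,x}$ is by definition $\tilde f\circ J_{t,x}(w)=J_{t,x}(w)-w$. A measure-valued solution of the Savage-Hutter system with initial data $(h_0,u_0)$ ($h_0,h_0u_0\in L^1$) is a triple $(\mu,m,\nu^\infty)$, $\mu\in L^\infty_w([0,T]\times\mathbb{T}^n;\mathcal{P}(\mathbb{R}^+\times\mathbb{R}^n))$, $m\in\mathcal{M}^+([0,T]\times\mathbb{T}^n)$, $\nu^\infty\in L^\infty_w([0,T]\times\mathbb{T}^n,m;\mathcal{P}(\mathbb{S}^+))$ (with $\gamma=2$ in $\mathbb{S}^+$), such that, with $\nu_{t,x}$ the push-forward of $\mu_{t,x}$ under $(\lambda_1,w)\mapsto(\lambda_1,J_{t,x}(w))$, with the overlined quantities defined from $(\nu,m,\nu^\infty)$ by $\overline h=\langle\lambda_1,\nu\rangle$, $\overline{hu}=\langle\sqrt{\lambda_1}\lambda',\nu\rangle$, $\overline{h^2}=\langle\lambda_1^2,\nu\rangle\,dt\,dx+\langle\beta_1^2,\nu^\infty\rangle m$, $\overline{hu\otimes u}=\langle\lambda'\otimes\lambda',\nu\rangle\,dt\,dx+\langle\beta'\otimes\beta',\nu^\infty\rangle m$, $\overline{h|u|^2}=\langle|\lambda'|^2,\nu\rangle\,dt\,dx+\langle|\beta'|^2,\nu^\infty\rangle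 m$, and with $$\overline{h(-dB(u)+f)}=\int_{\mathbb{R}^+\times\mathbb{R}^n}\lambda_1\,(\tilde f\circ J_{t,x})(w)\,d\mu_{t,x}(\lambda_1,w),$$ one has, for a.e. $\tau\in[0,T]$ and all $\psi\in C^1([0,T]\times\mathbb{T}^n;\mathbb{R})$, $\phi\in C^1([0,T]\times\mathbb{T}^n;\mathbb{R}^n)$, $$\int_0^\tau\!\!\int_{\mathbb{T}^n}\partial_t\psi\,\overline h+\nabla\psi\cdot\overline{hu}\,dx\,dt+\int_{\mathbb{T}^n}\psi(0,x)h_0-\psi(\tau,x)\overline h(\tau,x)\,dx=0$$ and $$\int_0^\tau\!\!\int_{\mathbb{T}^n}\partial_t\phi\cdot\overline{hu}+\nabla\phi:\overline{hu\otimes u}+a\operatorname{div}\phi\;\overline{h^2}+\phi\cdot\overline{h(-dB(u)+f)}\,dx\,dt+\int_{\mathbb{T}^n}\phi(0,x)\cdot h_0u_0-\phi(\tau,x)\cdot\overline{hu}(\tau,x)\,dx=0 ,$$ all integrals being required to exist. The measure $\nu$ in the conclusion is this push-forward. The solution is admissible if, in the sense of distributions in $t$, $$E_{mvs}(t)\le E_0-\int_0^t\int_{\mathbb{T}^n}\langle\sqrt{\lambda_1}\,(d|\lambda'|-f\cdot\lambda'),\nu_{s,x}\rangle\,dx\,ds,$$ where $E_{mvs}(t)=\int_{\mathbb{T}^n}\frac12\overline{h|u|^2}(t,x)+a\overline{h^2}(t,x)\,dx$ and $E_0=\int_{\mathbb{T}^n}\frac12h_0|u_0|^2+ah_0^2\,dx$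 (the integrand $\sqrt{\lambda_1}(d|\lambda'|-f\cdot\lambda')$ represents $h(dB(u)-f)\cdot u$). *)

theory Defs
  imports "HOL-Probability.Probability"
begin

section \<open>The space-time domain\<close>

text \<open>
  Functions on the torus are \<open>\<int>\<^sup>n\<close>-periodic functions on \<^typ>\<open>real^'n\<close>. Torus integrals and
  Borel measures on the torus live on the half-open cell, which is a Borel-isomorphic and
  measure-preserving copy of \<open>\<real>\<^sup>n/\<int>\<^sup>n\<close>. Objects that are only measurable (the data \<open>G\<close>, \<open>f\<close> and
  the Young measures) are evaluated on the cell only.
\<close>

definition cell :: "(real^'n) set" where
  "cell = {x. \<forall>i. 0 \<le> x $ i \<and> x $ i < 1}"

definition cyl :: "real \<Rightarrow> (real \<times> (real^'n)) set" where
  "cyl \<tau> = {0..\<tau>} \<times> cell"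

definition periodic_x :: "real \<Rightarrow> (real \<times> (real^'n) \<Rightarrow> 'b) \<Rightarrow> bool" where
  "periodic_x T F \<longleftrightarrow> (\<forall>t\<in>{0..T}. \<forall>x j. F (t, x + axis j 1) = F (t, x))"

text \<open>\<open>C\<^sup>1\<close> up to the end points \<open>t = 0\<close> and \<open>t = T\<close>.\<close>

definition C1_torus :: "real \<Rightarrow> (real \<times> (real^'n) \<Rightarrow> 'b::real_normed_vector) \<Rightarrow> bool" where
  "C1_torus T F \<longleftrightarrow> periodic_x T F \<and>
     (\<exists>D :: real \<times> (real^'n) \<Rightarrow> (real \<times> (real^'n)) \<Rightarrow>\<^sub>L 'b.
        continuous_on ({0..T} \<times> UNIV) D \<and>
        (\<forall>z\<in>{0..T} \<times> UNIV. (F has_derivative blinfun_apply (D z)) (at z within {0..T} \<times> UNIV)))"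

definition lipschitz_torus :: "real \<Rightarrow> (real \<times> (real^'n) \<Rightarrow> real) \<Rightarrow> bool" where
  "lipschitz_torus T F \<longleftrightarrow> periodic_x T F \<and> (\<exists>L. L-lipschitz_on ({0..T} \<times> UNIV) F)"

text \<open>\<open>L\<^sup>\<infinity>([0,T]; L\<^sup>2(\<T>\<^sup>n; \<real>\<^sup>n))\<close>\<close>

definition Linf_L2 :: "real \<Rightarrow> (real \<times> (real^'n) \<Rightarrow> real^'n) \<Rightarrow> bool" where
  "Linf_L2 T G \<longleftrightarrow> G \<in> borel_measurable (lebesgue_on (cyl T)) \<and>
     (\<exists>C::real. AE t in lebesgue_on {0..T}.
        (\<integral>\<^sup>+x. ennreal ((norm (G (t, x)))\<^sup>2) \<partial>lebesgue_on cell) \<le> ennreal C)"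

section \<open>Differential operators\<close>

text \<open>The time derivative is one-sided at \<open>t = 0\<close> and \<open>t = T\<close>.\<close>

definition dt :: "real \<Rightarrow> (real \<times> (real^'n) \<Rightarrow> 'b::real_normed_vector) \<Rightarrow> real \<times> (real^'n) \<Rightarrow> 'b" where
  "dt T F z = vector_derivative (\<lambda>s. F (s, snd z)) (at (fst z) within {0..T})"

definition dx :: "'n::finite \<Rightarrow> (real \<times> (real^'n) \<Rightarrow> real) \<Rightarrow> real \<times> (real^'n) \<Rightarrow> real" where
  "dx j F z = vector_derivative (\<lambda>r. F (fst z, snd z + r *\<^sub>R axis j 1)) (at 0)"

definition grad_x :: "(real \<times> (real^'n) \<Rightarrow> real) \<Rightarrow> real \<times> (real^'n) \<Rightarrow> real^'n" where
  "grad_x F z = (\<chi> j. dx j F z)"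

definition jac_x :: "(real \<times> (real^'n) \<Rightarrow> real^'n) \<Rightarrow> real \<times> (real^'n) \<Rightarrow> real^'n^'n" where
  "jac_x V z = (\<chi> i j. dx j (\<lambda>w. V w $ i) z)"

definition div_x :: "(real \<times> (real^'n) \<Rightarrow> real^'n) \<Rightarrow> real \<times> (real^'n) \<Rightarrow> real" where
  "div_x V z = (\<Sum>j\<in>UNIV. dx j (\<lambda>w. V w $ j) z)"

definition Div_x :: "(real \<times> (real^'n) \<Rightarrow> real^'n^'n) \<Rightarrow> real \<times> (real^'n) \<Rightarrow> real^'n" where
  "Div_x A z = (\<chi> i. div_x (\<lambda>w. A w $ i) z)"

definition outer :: "real^'n \<Rightarrow> real^'n \<Rightarrow> real^'n^'n" where
  "outer u v = (\<chi> i j. u $ i * v $ j)"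

section \<open>Lipschitz solutions of the systems\<close>

text \<open>
  \<open>\<partial>\<^sub>t h + div (h u) = 0\<close>, \<open>\<partial>\<^sub>t (h u) + div (h u \<otimes> u) + \<nabla>(\<kappa> h\<^sup>\<gamma>) = K\<close> almost everywhere. By
  Rademacher's theorem the differentiability clause holds for every Lipschitz \<open>H\<close>; it records
  that the derivatives in the equations are genuine.
  Savage-Hutter is the case \<open>\<kappa> = a\<close>, \<open>\<gamma> = 2\<close>, in which
  also the energy coefficient \<open>\<kappa> / (\<gamma> - 1)\<close> below equals \<open>a\<close>.
\<close>

definition strong_balance ::
  "real \<Rightarrow> real \<Rightarrow> real \<Rightarrow> (real \<times> (real^'n) \<Rightarrow> real^'n) \<Rightarrow>
   (real \<times> (real^'n) \<Rightarrow> real) \<Rightarrow> (real \<times> (real^'n) \<Rightarrow> real^'n) \<Rightarrow> bool" where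
  "strong_balance T \<kappa> \<gamma> K H U \<longleftrightarrow> (AE z in lebesgue_on (cyl T).
     H differentiable (at z within {0..T} \<times> UNIV) \<and>
     dt T H z + div_x (\<lambda>w. H w *\<^sub>R U w) z = 0 \<and>
     dt T (\<lambda>w. H w *\<^sub>R U w) z + Div_x (\<lambda>w. H w *\<^sub>R outer (U w) (U w)) z
       + grad_x (\<lambda>w. \<kappa> * H w powr \<gamma>) z = K z)"

definition euler_solution where
  "euler_solution T \<kappa> \<gamma> G H U \<longleftrightarrow> strong_balance T \<kappa> \<gamma> (\<lambda>z. H z *\<^sub>R G z) H U"

text \<open>The subdifferential of the Euclidean norm.\<close>

definition B_abs :: "real^'n \<Rightarrow> (real^'n) set" where
  "B_abs u = (if u = 0 then cball 0 1 else {u /\<^sub>R norm u})"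

definition savage_hutter_solution where
  "savage_hutter_solution T a d f H U \<longleftrightarrow>
     (\<exists>b \<in> borel_measurable (lebesgue_on (cyl T)).
        (AE z in lebesgue_on (cyl T). b z \<in> B_abs (U z)) \<and>
        strong_balance T a 2 (\<lambda>z. H z *\<^sub>R (- d *\<^sub>R b z + f z)) H U)"

section \<open>Generalised Young measures\<close>

definition Mplus :: "'a::topological_space set \<Rightarrow> 'a measure set" where
  \<comment> \<open>Used for \<open>[0,T] \<times> \<T>\<^sup>n\<close> and \<open>\<T>\<^sup>n\<close>, which are compact: locally finite means finite.\<close>
  "Mplus S = {m. finite_measure m \<and> sets m = sets (restrict_space borel S)}"

definition C0 :: "'a::topological_space set \<Rightarrow> ('a \<Rightarrow> real) set" where
  "C0 X = {g. continuous_on X g \<and>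
     (\<forall>e>0. \<exists>K. compact K \<and> K \<subseteq> X \<and> (\<forall>y\<in>X - K. \<bar>g y\<bar> < e))}"

definition Linf_w :: "'z measure \<Rightarrow> 'a::topological_space set \<Rightarrow> ('z \<Rightarrow> 'a measure) set" where
  "Linf_w M X = {\<nu>. (\<forall>z\<in>space M. \<nu> z \<in> space (prob_algebra (restrict_space borel X))) \<and>
     (\<forall>g\<in>C0 X. (\<lambda>z. integral\<^sup>L (\<nu> z) g) \<in> borel_measurable M)}"

definition phase :: "(real \<times> (real^'n)) set" where
  "phase = {0..} \<times> UNIV"

definition sphere_plus :: "real \<Rightarrow> (real \<times> (real^'n)) set" where
  "sphere_plus \<gamma> = {(b1, b'). \<bar>b1\<bar> powr (2 * \<gamma>) + norm b' ^ 4 = 1 \<and> b1 \<ge> 0}"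

definition gen_young_measure ::
  "real \<Rightarrow> real \<Rightarrow> (real \<times> (real^'n) \<Rightarrow> (real \<times> (real^'n)) measure) \<Rightarrow>
   (real \<times> (real^'n)) measure \<Rightarrow> (real \<times> (real^'n) \<Rightarrow> (real \<times> (real^'n)) measure) \<Rightarrow> bool" where
  "gen_young_measure T \<gamma> \<nu> m \<nu>inf \<longleftrightarrow>
     \<nu> \<in> Linf_w (lebesgue_on (cyl T)) phase \<and>
     m \<in> Mplus (cyl T) \<and>
     \<nu>inf \<in> Linf_w (completion m) (sphere_plus \<gamma>)"

text \<open>Existence of the integral over \<open>M\<close> of the function \<open>z \<mapsto> \<langle>F z, \<nu> z\<rangle>\<close>.\<close>

definition has_moment ::
  "'z measure \<Rightarrow> ('z \<Rightarrow> 'a measure) \<Rightarrow> ('z \<Rightarrow> 'a \<Rightarrow> 'b::{banach,second_countable_topology}) \<Rightarrow> bool" where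
  "has_moment M \<nu> F \<longleftrightarrow>
     (AE z in M. integrable (\<nu> z) (F z)) \<and> integrable M (\<lambda>z. integral\<^sup>L (\<nu> z) (F z))"

text \<open>
  Integration of a test field \<open>\<Phi>\<close> over \<open>S\<close> against the measure \<open>\<langle>F, \<nu>\<rangle> dt dx + \<langle>F, \<nu>\<^sup>\<infinity>\<rangle> m\<close>, and
  the existence of these integrals for all bounded continuous \<open>\<Phi>\<close>.
\<close>

definition bar_exists ::
  "'z::euclidean_space set \<Rightarrow> ('z \<Rightarrow> 'a measure) \<Rightarrow> 'z measure \<Rightarrow> ('z \<Rightarrow> 'a measure) \<Rightarrow>
   ('a \<Rightarrow> 'b::euclidean_space) \<Rightarrow> bool" where
  "bar_exists S \<nu> m \<nu>inf F \<longleftrightarrow>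
     has_moment (lebesgue_on S) \<nu> (\<lambda>_. F) \<and>
     has_moment (restrict_space (completion m) S) \<nu>inf (\<lambda>_. F)"

definition bar_integral ::
  "'z::euclidean_space set \<Rightarrow> ('z \<Rightarrow> 'a measure) \<Rightarrow> 'z measure \<Rightarrow> ('z \<Rightarrow> 'a measure) \<Rightarrow>
   ('a \<Rightarrow> 'b::euclidean_space) \<Rightarrow> ('z \<Rightarrow> 'b) \<Rightarrow> real" where
  "bar_integral S \<nu> m \<nu>inf F \<Phi> =
     (\<integral>z. \<Phi> z \<bullet> integral\<^sup>L (\<nu> z) F \<partial>lebesgue_on S) +
     (\<integral>z. \<Phi> z \<bullet> integral\<^sup>L (\<nu>inf z) F \<partial>restrict_space (completion m) S)"

definition height :: "real \<times> (real^'n) \<Rightarrow> real" where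
  "height = (\<lambda>(l1, l'). l1)"

definition momentum :: "real \<times> (real^'n) \<Rightarrow> real^'n" where
  "momentum = (\<lambda>(l1, l'). sqrt l1 *\<^sub>R l')"

definition h_power :: "real \<Rightarrow> real \<times> (real^'n) \<Rightarrow> real" where
  "h_power \<gamma> = (\<lambda>(l1, l'). l1 powr \<gamma>)"

definition convection :: "real \<times> (real^'n) \<Rightarrow> real^'n^'n" where
  "convection = (\<lambda>(l1, l'). outer l' l')"

definition h_bar where
  "h_bar \<nu> z = integral\<^sup>L (\<nu> z) height"

definition hu_bar where
  "hu_bar \<nu> z = integral\<^sup>L (\<nu> z) momentum"

section \<open>Measure-valued solutions\<close>

text \<open>
  The two integral identities, with averaged source term \<open>K\<close>, together with the existence of all
  integrals that occur in them.
\<close>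

definition mv_mass_balance where
  "mv_mass_balance T h0 \<nu> \<longleftrightarrow> (AE \<tau> in lebesgue_on {0..T}.
     has_moment (lebesgue_on (cyl \<tau>)) \<nu> (\<lambda>_. height) \<and>
     has_moment (lebesgue_on (cyl \<tau>)) \<nu> (\<lambda>_. momentum) \<and>
     has_moment (lebesgue_on cell) (\<lambda>x. \<nu> (\<tau>, x)) (\<lambda>_. height) \<and>
     (\<forall>\<psi> :: real \<times> (real^'n) \<Rightarrow> real. C1_torus T \<psi> \<longrightarrow>
        (\<integral>z. dt T \<psi> z * h_bar \<nu> z + grad_x \<psi> z \<bullet> hu_bar \<nu> z \<partial>lebesgue_on (cyl \<tau>)) +
        (\<integral>x. \<psi> (0, x) * h0 x - \<psi> (\<tau>, x) * h_bar \<nu> (\<tau>, x) \<partial>lebesgue_on cell) = 0))"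

definition mv_momentum_balance where
  "mv_momentum_balance T \<kappa> \<gamma> h0 u0 \<nu> m \<nu>inf K \<longleftrightarrow> (AE \<tau> in lebesgue_on {0..T}.
     has_moment (lebesgue_on (cyl \<tau>)) \<nu> (\<lambda>_. momentum) \<and>
     bar_exists (cyl \<tau>) \<nu> m \<nu>inf convection \<and>
     bar_exists (cyl \<tau>) \<nu> m \<nu>inf (h_power \<gamma>) \<and>
     integrable (lebesgue_on (cyl \<tau>)) K \<and>
     has_moment (lebesgue_on cell) (\<lambda>x. \<nu> (\<tau>, x)) (\<lambda>_. momentum) \<and>
     (\<forall>\<phi> :: real \<times> (real^'n) \<Rightarrow> real^'n. C1_torus T \<phi> \<longrightarrow>
        (\<integral>z. dt T \<phi> z \<bullet> hu_bar \<nu> z \<partial>lebesgue_on (cyl \<tau>)) +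
        bar_integral (cyl \<tau>) \<nu> m \<nu>inf convection (jac_x \<phi>) +
        \<kappa> * bar_integral (cyl \<tau>) \<nu> m \<nu>inf (h_power \<gamma>) (div_x \<phi>) +
        (\<integral>z. \<phi> z \<bullet> K z \<partial>lebesgue_on (cyl \<tau>)) +
        (\<integral>x. \<phi> (0, x) \<bullet> (h0 x *\<^sub>R u0 x) - \<phi> (\<tau>, x) \<bullet> hu_bar \<nu> (\<tau>, x) \<partial>lebesgue_on cell) = 0))"

definition initial_data :: "(real^'n \<Rightarrow> real) \<Rightarrow> (real^'n \<Rightarrow> real^'n) \<Rightarrow> bool" where
  "initial_data h0 u0 \<longleftrightarrow>
     integrable (lebesgue_on cell) h0 \<and> integrable (lebesgue_on cell) (\<lambda>x. h0 x *\<^sub>R u0 x)"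

text \<open>\<open>m = m\<^sub>t(dx) \<otimes> dt\<close>\<close>

definition disintegration ::
  "real \<Rightarrow> (real \<times> (real^'n)) measure \<Rightarrow> (real \<Rightarrow> (real^'n) measure) \<Rightarrow> bool" where
  "disintegration T m mt \<longleftrightarrow>
     (AE t in lebesgue_on {0..T}. mt t \<in> Mplus cell) \<and>
     (\<forall>A\<in>sets (restrict_space borel cell).
        (\<lambda>t. emeasure (mt t) A) \<in> borel_measurable (lebesgue_on {0..T}) \<and>
        (\<forall>S\<in>sets (restrict_space borel {0..T}).
           emeasure m (S \<times> A) = (\<integral>\<^sup>+t. emeasure (mt t) A \<partial>lebesgue_on S)))"

text \<open>Energies take values in \<open>[0,\<infinity>]\<close>, so that no integrability has to be presupposed.\<close>

definition energy_density :: "real \<Rightarrow> real \<Rightarrow> real \<times> (real^'n) \<Rightarrow> ennreal" where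
  "energy_density \<kappa> \<gamma> = (\<lambda>(l1, l'). ennreal (1/2 * (norm l')\<^sup>2 + \<kappa> / (\<gamma> - 1) * l1 powr \<gamma>))"

definition energy_mvs where
  "energy_mvs \<kappa> \<gamma> \<nu> mt \<nu>inf t =
     (\<integral>\<^sup>+x. (\<integral>\<^sup>+l. energy_density \<kappa> \<gamma> l \<partial>\<nu> (t, x)) \<partial>lebesgue_on cell) +
     (\<integral>\<^sup>+x. (\<integral>\<^sup>+l. energy_density \<kappa> \<gamma> l \<partial>\<nu>inf (t, x)) \<partial>completion (mt t))"

definition energy_0 :: "real \<Rightarrow> real \<Rightarrow> (real^'n \<Rightarrow> real) \<Rightarrow> (real^'n \<Rightarrow> real^'n) \<Rightarrow> ennreal" where
  "energy_0 \<kappa> \<gamma> h0 u0 =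
     (\<integral>\<^sup>+x. ennreal (1/2 * h0 x * (norm (u0 x))\<^sup>2 + \<kappa> / (\<gamma> - 1) * h0 x powr \<gamma>) \<partial>lebesgue_on cell)"

subsection \<open>Isentropic Euler system\<close>

definition euler_mv_solution where
  "euler_mv_solution T \<kappa> \<gamma> G h0 u0 \<nu> m \<nu>inf \<longleftrightarrow>
     initial_data h0 u0 \<and>
     gen_young_measure T \<gamma> \<nu> m \<nu>inf \<and>
     mv_mass_balance T h0 \<nu> \<and>
     mv_momentum_balance T \<kappa> \<gamma> h0 u0 \<nu> m \<nu>inf (\<lambda>z. h_bar \<nu> z *\<^sub>R G z)"

definition euler_admissible where
  "euler_admissible T \<kappa> \<gamma> G h0 u0 \<nu> m \<nu>inf \<longleftrightarrow>
     (\<exists>mt. disintegration T m mt \<and>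
        (AE t in lebesgue_on {0..T}.
           integrable (lebesgue_on (cyl t)) (\<lambda>z. hu_bar \<nu> z \<bullet> G z) \<and>
           enn2ereal (energy_mvs \<kappa> \<gamma> \<nu> mt \<nu>inf t) \<le>
             enn2ereal (energy_0 \<kappa> \<gamma> h0 u0) +
             ereal (\<integral>z. hu_bar \<nu> z \<bullet> G z \<partial>lebesgue_on (cyl t))))"

subsection \<open>Savage-Hutter system\<close>

definition f_tilde ::
  "real \<Rightarrow> (real \<times> (real^'n) \<Rightarrow> real^'n) \<Rightarrow> real \<times> (real^'n) \<Rightarrow> real^'n \<Rightarrow> (real^'n) set" where
  "f_tilde d f z v = {- d *\<^sub>R b + f z | b. b \<in> B_abs v}"

text \<open>\<open>J\<^sub>z = (Id - f_tilde z)\<^sup>-\<^sup>1\<close>, the inverse of a multi-valued map: \<open>v = J\<^sub>z w\<close> iff \<open>w \<in> v - f_tilde z v\<close>.\<close>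

definition J_res ::
  "real \<Rightarrow> (real \<times> (real^'n) \<Rightarrow> real^'n) \<Rightarrow> real \<times> (real^'n) \<Rightarrow> real^'n \<Rightarrow> real^'n" where
  "J_res d f z w = (THE v. \<exists>g\<in>f_tilde d f z v. w = v - g)"

definition push_J ::
  "real \<Rightarrow> (real \<times> (real^'n) \<Rightarrow> real^'n) \<Rightarrow>
   (real \<times> (real^'n) \<Rightarrow> (real \<times> (real^'n)) measure) \<Rightarrow>
   real \<times> (real^'n) \<Rightarrow> (real \<times> (real^'n)) measure" where
  "push_J d f \<mu> z = distr (\<mu> z) (restrict_space borel phase) (\<lambda>(l1, w). (l1, J_res d f z w))"

text \<open>\<open>\<lambda>\<^sub>1 (f_tilde \<circ> J)(w)\<close> with the selection \<open>(f_tilde \<circ> J)(w) = J w - w\<close>\<close>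

definition friction ::
  "real \<Rightarrow> (real \<times> (real^'n) \<Rightarrow> real^'n) \<Rightarrow> real \<times> (real^'n) \<Rightarrow> real \<times> (real^'n) \<Rightarrow> real^'n" where
  "friction d f z = (\<lambda>(l1, w). l1 *\<^sub>R (J_res d f z w - w))"

definition savage_hutter_mv_solution where
  "savage_hutter_mv_solution T a d f h0 u0 \<mu> m \<nu>inf \<longleftrightarrow>
     initial_data h0 u0 \<and>
     gen_young_measure T 2 \<mu> m \<nu>inf \<and>
     mv_mass_balance T h0 (push_J d f \<mu>) \<and>
     (AE z in lebesgue_on (cyl T). integrable (\<mu> z) (friction d f z)) \<and>
     mv_momentum_balance T a 2 h0 u0 (push_J d f \<mu>) m \<nu>inf
       (\<lambda>z. integral\<^sup>L (\<mu> z) (friction d f z))"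

definition dissipation ::
  "real \<Rightarrow> (real \<times> (real^'n) \<Rightarrow> real^'n) \<Rightarrow> real \<times> (real^'n) \<Rightarrow> real \<times> (real^'n) \<Rightarrow> real" where
  "dissipation d f z = (\<lambda>(l1, l'). sqrt l1 * (d * norm l' - f z \<bullet> l'))"

definition savage_hutter_admissible where
  "savage_hutter_admissible T a d f h0 u0 \<mu> m \<nu>inf \<longleftrightarrow>
     (\<exists>mt. disintegration T m mt \<and>
        (AE t in lebesgue_on {0..T}.
           has_moment (lebesgue_on (cyl t)) (push_J d f \<mu>) (dissipation d f) \<and>
           enn2ereal (energy_mvs a 2 (push_J d f \<mu>) mt \<nu>inf t) \<le>
             enn2ereal (energy_0 a 2 h0 u0) -
             ereal (\<integral>z. integral\<^sup>L (push_J d f \<mu> z) (dissipation d f z) \<partial>lebesgue_on (cyl t))))"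

section \<open>Coincidence of a measure-valued with a classical solution\<close>

definition coincides where
  "coincides T \<nu> m H U \<longleftrightarrow>
     (AE z in lebesgue_on (cyl T).
        \<nu> z = return (restrict_space borel phase) (H z, sqrt (H z) *\<^sub>R U z)) \<and>
     m = null_measure (restrict_space borel (cyl T))"

end

theory Submission
  imports Defs
begin

text \<open>
  The proof is a relative energy argument. For a phase point \<open>(\<lambda>1, \<lambda>')\<close> and the state \<open>(H, U)\<close> consider
  \<open>1/2 * (norm (\<lambda>' - sqrt \<lambda>1 *\<^sub>R U))\<^sup>2 + \<kappa> / (\<gamma> - 1) * (\<lambda>1 powr \<gamma> - \<gamma> * H powr (\<gamma> - 1) * \<lambda>1 + (\<gamma> - 1) * H powr \<gamma>)\<close>. By
  strict convexity of \<open>\<lambda>1 powr \<gamma>\<close> this is nonnegative and vanishes only at \<open>(H, sqrt H *\<^sub>R U)\<close>, so coincidence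
  means that its average with respect to \<open>\<nu>\<close>, together with the energy of the concentration measure, is 0.

  Expanded, the averaged relative energy consists of the energy, of the momentum paired with \<open>U\<close>, of the height paired with
  \<open>1/2 * (norm U)\<^sup>2 - \<kappa> * \<gamma> / (\<gamma> - 1) * H powr (\<gamma> - 1)\<close> and of the pressure \<open>\<kappa> * H powr \<gamma>\<close>. The energy inequality, the
  momentum balance, the mass balance, and the divergence theorem for the classical solution express
  these at time \<open>\<tau>\<close> by initial values, which cancel, and by integrals over \<open>{0..\<tau>} \<times> cell\<close>. In these the equations for
  \<open>(H, U)\<close> cancel everything of first order (\<open>pointwise_identity\<close>). The remainder is quadratic and hence bounded
  by the relative energy, because \<open>U\<close> has bounded derivatives (\<open>rel_flux_le_rel_energy\<close>). Gronwall's lemma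
  (\<open>gronwall_L1\<close>) shows that the relative energy vanishes.

  The test function in the mass balance is only Lipschitz, since \<open>H\<close> is. It is approximated by mollification;
  the derivatives converge at every point of differentiability (\<open>mollify_grad_tendsto\<close>), which suffices since the
  mass balance involves no concentration measure (\<open>mass_balance_lipschitz\<close>). For the concentration measure,
  the energy is bounded below by a positive constant on the sphere of directions, on which all moments
  are bounded, so that only the total mass of its time slices has to be followed (\<open>sphere_energy_bound\<close>, \<open>concentration_bound\<close>). Divergence terms of Lipschitz
  functions are integrated by difference quotients and translation invariance (\<open>integral_dx_eq_0\<close>, \<open>integral_dt\<close>).

  Both systems are instances of one locale, \<open>weak_strong\<close>, which compares the sources by an inequality. For
  Savage-Hutter this inequality is the monotonicity of the subdifferential (\<open>friction_monotone\<close>), applied to the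
  selection that is provided by the resolvent; the resolvent itself is soft thresholding (\<open>resolvent_B_abs\<close>).
\<close>

section \<open>Lebesgue measure on products and an integrated Gronwall lemma\<close>

text \<open>
  Restrictions of Lebesgue measure are complete, so a change on a null set preserves measurability.
  Derivatives of Lipschitz functions, which exist only almost everywhere,
  are treated in this way as limits of measurable functions.
\<close>

lemma measurable_lebesgue_on_AE_cong:
  fixes f g :: "'a::euclidean_space \<Rightarrow> 'b::topological_space"
  assumes S: "S \<in> sets lebesgue" and f: "f \<in> borel_measurable (lebesgue_on S)"
    and ae: "AE x in lebesgue_on S. f x = g x"
  shows "g \<in> borel_measurable (lebesgue_on S)"
proof -
  interpret complete_measure "lebesgue_on S"
  proof
    fix A B assume "B \<subseteq> A" "A \<in> null_sets (lebesgue_on S)"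
    then have "A \<subseteq> S" "A \<in> null_sets lebesgue" using null_sets_restrict_space[OF S, of A] by auto
    with \<open>B \<subseteq> A\<close> have "B \<subseteq> S" "B \<in> null_sets lebesgue"
      by (auto intro: null_sets_completion_subset)
    then have "B \<in> null_sets (lebesgue_on S)" using null_sets_restrict_space[OF S, of B] by auto
    then show "B \<in> sets (lebesgue_on S)" by auto
  qed
  show ?thesis
  proof (rule measurableI)
    fix A :: "'b set" assume A: "A \<in> sets borel"
    show "g -` A \<inter> space (lebesgue_on S) \<in> sets (lebesgue_on S)"
    proof (rule in_sets_AE)
      show "f -` A \<inter> space (lebesgue_on S) \<in> sets (lebesgue_on S)"
        using f A by (rule measurable_sets)
      show "AE x in lebesgue_on S. (x \<in> f -` A \<inter> space (lebesgue_on S)) = (x \<in> g -` A \<inter> space (lebesgue_on S))"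
        using ae by eventually_elim auto
    qed auto
  qed auto
qed

lemma AE_lebesgue_on_iff:
  assumes "S \<in> sets lebesgue"
  shows "(AE x in lebesgue_on S. P x) \<longleftrightarrow> (AE x in lborel. x \<in> S \<longrightarrow> P x)"
  using assms by (simp add: AE_restrict_space_iff AE_completion_iff)

lemma AE_lebesgue_on_subset:
  assumes "AE x in lebesgue_on S. P x" "A \<subseteq> S" "A \<in> sets lebesgue" "S \<in> sets lebesgue"
  shows "AE x in lebesgue_on A. P x"
  using assms(1) unfolding AE_lebesgue_on_iff[OF assms(3)] AE_lebesgue_on_iff[OF assms(4)]
  by eventually_elim (use assms(2) in auto)

lemma AE_lebesgue_on_Times:
  fixes S :: "'a::euclidean_space set" and A :: "'b::euclidean_space set"
  assumes S: "S \<in> sets borel" and A: "A \<in> sets borel"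
    and ae: "AE z in lebesgue_on (S \<times> A). P z"
  shows "AE t in lebesgue_on S. AE x in lebesgue_on A. P (t, x)"
proof -
  have SA: "S \<times> A \<in> sets lebesgue" "S \<in> sets lebesgue" "A \<in> sets lebesgue"
    using S A by (auto simp: borel_prod[symmetric])
  have "AE z in lborel \<Otimes>\<^sub>M lborel. z \<in> S \<times> A \<longrightarrow> P z"
    using ae SA unfolding lborel_prod by (simp add: AE_lebesgue_on_iff)
  then have "AE t in lborel. AE x in lborel. (t, x) \<in> S \<times> A \<longrightarrow> P (t, x)"
    by (rule lborel_pair.AE_pair)
  then show ?thesis
    unfolding AE_lebesgue_on_iff[OF SA(2)] AE_lebesgue_on_iff[OF SA(3)]
    by eventually_elim auto
qed

lemma integrable_lebesgue_on_ex_borel: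
  fixes f :: "'a::euclidean_space \<Rightarrow> real"
  assumes S: "S \<in> sets borel" and f: "integrable (lebesgue_on S) f"
  obtains g where "g \<in> borel_measurable borel" "integrable lborel g"
    "AE x in lborel. indicator S x * f x = g x" "(\<integral>x. f x \<partial>lebesgue_on S) = (\<integral>x. g x \<partial>lborel)"
proof -
  have S': "S \<in> sets lebesgue" using S by auto
  have i: "integrable lebesgue (\<lambda>x. indicator S x * f x)"
    using f S' by (simp add: integrable_restrict_space)
  obtain g where g: "g \<in> borel_measurable lborel" "AE x in lborel. indicator S x * f x = g x"
    using completion_ex_borel_measurable_real[OF borel_measurable_integrable[OF i]] by blast
  have "AE x in lebesgue. indicator S x * f x = g x" using g(2) by (rule AE_completion)
  then have "integrable lebesgue g" "(\<integral>x. indicator S x * f x \<partial>lebesgue) = (\<integral>x. g x \<partial>lebesgue)"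
    using i g(1) integrable_cong_AE[of "\<lambda>x. indicator S x * f x" lebesgue g]
      integral_cong_AE[of "\<lambda>x. indicator S x * f x" lebesgue g]
    by (auto simp: measurable_completion)
  then have "integrable lborel g" "(\<integral>x. f x \<partial>lebesgue_on S) = (\<integral>x. g x \<partial>lborel)"
    using g(1) S' by (auto simp: integrable_completion integral_completion integral_restrict_space)
  with g that show ?thesis by auto
qed

text \<open>
  Lebesgue measure on a product is the completion of the product measure. The integrand is
  therefore replaced by a Borel function that agrees with it almost everywhere; almost every section of
  the exceptional set is again a null set.
\<close>

lemma Fubini_lebesgue_on:
  fixes f :: "'a::euclidean_space \<times> 'b::euclidean_space \<Rightarrow> real"
  assumes S: "S \<in> sets borel" and A: "A \<in> sets borel"
    and f: "integrable (lebesgue_on (S \<times> A)) f"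
  shows "AE t in lebesgue_on S. integrable (lebesgue_on A) (\<lambda>x. f (t, x))"
    and "integrable (lebesgue_on S) (\<lambda>t. \<integral>x. f (t, x) \<partial>lebesgue_on A)"
    and "(\<integral>t. \<integral>x. f (t, x) \<partial>lebesgue_on A \<partial>lebesgue_on S) = (\<integral>z. f z \<partial>lebesgue_on (S \<times> A))"
proof -
  have SA: "S \<times> A \<in> sets borel" using S A by (auto simp: borel_prod[symmetric])
  have L: "S \<in> sets lebesgue" "A \<in> sets lebesgue" using S A by auto
  obtain g where g: "g \<in> borel_measurable borel" "integrable lborel g"
    "AE x in lborel. indicator (S \<times> A) x * f x = g x" "(\<integral>x. f x \<partial>lebesgue_on (S \<times> A)) = (\<integral>x. g x \<partial>lborel)"
    using integrable_lebesgue_on_ex_borel[OF SA f] by blast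
  have gi: "integrable (lborel \<Otimes>\<^sub>M lborel) g" using g(2) by (simp add: lborel_prod)
  have [measurable]: "g \<in> borel_measurable (borel \<Otimes>\<^sub>M borel)" using g(1) by (simp add: borel_prod)
  have "AE z in lborel \<Otimes>\<^sub>M lborel. indicator (S \<times> A) z * f z = g z"
    using g(3) unfolding lborel_prod .
  then have ae: "AE t in lborel. AE x in lborel. indicator (S \<times> A) (t, x) * f (t, x) = g (t, x)"
    by (rule lborel_pair.AE_pair)
  have sec: "AE t in lborel. integrable lborel (\<lambda>x. g (t, x))"
    by (rule lborel_pair.AE_integrable_fst'[OF gi])
  have key: "AE t in lborel. (t \<in> S \<longrightarrow> integrable (lebesgue_on A) (\<lambda>x. f (t, x)))
     \<and> indicator S t * (\<integral>x. f (t, x) \<partial>lebesgue_on A) = (\<integral>x. g (t, x) \<partial>lborel)"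
    using ae sec
  proof eventually_elim
    case (elim t)
    have gm: "(\<lambda>x. g (t, x)) \<in> borel_measurable lborel" using elim(2) by auto
    have gl: "integrable lebesgue (\<lambda>x. g (t, x))" using elim(2) gm by (simp add: integrable_completion)
    show ?case
    proof (cases "t \<in> S")
      case True
      then have e: "AE x in lebesgue. indicator A x * f (t, x) = g (t, x)"
        using elim(1) by (intro AE_completion) (simp add: indicator_times)
      have m: "(\<lambda>x. indicator A x * f (t, x)) \<in> borel_measurable lebesgue"
      proof -
        have "(\<lambda>x. indicator A x * f (t, x)) \<in> borel_measurable (lebesgue_on UNIV)"
          using e gl measurable_lebesgue_on_AE_cong[of UNIV "\<lambda>x. g (t, x)" "\<lambda>x. indicator A x * f (t, x)"]
          unfolding lebesgue_on_UNIV_eq by (simp add: borel_measurable_integrable eq_commute)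
        then show ?thesis by (simp add: lebesgue_on_UNIV_eq)
      qed
      have "integrable lebesgue (\<lambda>x. indicator A x * f (t, x))"
        using e gl m by (subst integrable_cong_AE) auto
      moreover have "(\<integral>x. indicator A x * f (t, x) \<partial>lebesgue) = (\<integral>x. g (t, x) \<partial>lebesgue)"
        using e m gl by (intro integral_cong_AE) auto
      ultimately show ?thesis using True L gm
        by (simp add: integrable_restrict_space integral_restrict_space integral_completion)
    next
      case False
      then have "AE x in lborel. g (t, x) = 0" using elim(1) by (auto simp: indicator_times)
      then have "(\<integral>x. g (t, x) \<partial>lborel) = 0" by (rule integral_eq_zero_AE)
      then show ?thesis using False by simp
    qed
  qed
  show "AE t in lebesgue_on S. integrable (lebesgue_on A) (\<lambda>x. f (t, x))"
    unfolding AE_lebesgue_on_iff[OF L(1)] using key by eventually_elim auto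
  have G: "integrable lborel (\<lambda>t. \<integral>x. g (t, x) \<partial>lborel)"
    by (rule lborel_pair.integrable_fst'[OF gi])
  then have Gl: "integrable lebesgue (\<lambda>t. \<integral>x. g (t, x) \<partial>lborel)"
    by (simp add: integrable_completion)
  have e: "AE t in lebesgue. (\<integral>x. g (t, x) \<partial>lborel) = indicator S t * (\<integral>x. f (t, x) \<partial>lebesgue_on A)"
    using AE_completion[OF key] by eventually_elim auto
  have m: "(\<lambda>t. indicator S t * (\<integral>x. f (t, x) \<partial>lebesgue_on A)) \<in> borel_measurable lebesgue"
    using measurable_lebesgue_on_AE_cong[of UNIV "\<lambda>t. \<integral>x. g (t, x) \<partial>lborel"] e Gl
    unfolding lebesgue_on_UNIV_eq by (simp add: borel_measurable_integrable)
  have "integrable lebesgue (\<lambda>t. indicator S t * (\<integral>x. f (t, x) \<partial>lebesgue_on A))"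
    using integrable_cong_AE_imp[OF Gl m] e by auto
  then show "integrable (lebesgue_on S) (\<lambda>t. \<integral>x. f (t, x) \<partial>lebesgue_on A)"
    using L by (simp add: integrable_restrict_space)
  have "(\<integral>t. \<integral>x. f (t, x) \<partial>lebesgue_on A \<partial>lebesgue_on S) = (\<integral>t. indicator S t * (\<integral>x. f (t, x) \<partial>lebesgue_on A) \<partial>lebesgue)"
    using L by (simp add: integral_restrict_space)
  also have "\<dots> = (\<integral>t. \<integral>x. g (t, x) \<partial>lborel \<partial>lebesgue)"
    using e m Gl by (intro integral_cong_AE) auto
  also have "\<dots> = (\<integral>t. \<integral>x. g (t, x) \<partial>lborel \<partial>lborel)"
    using G by (simp add: integral_completion)
  also have "\<dots> = (\<integral>z. g z \<partial>lborel)"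
    using lborel_pair.integral_fst'[OF gi] by (simp add: lborel_prod)
  finally show "(\<integral>t. \<integral>x. f (t, x) \<partial>lebesgue_on A \<partial>lebesgue_on S) = (\<integral>z. f z \<partial>lebesgue_on (S \<times> A))"
    using g(4) by simp
qed

lemma integrable_bounded_inner:
  fixes f b :: "'a \<Rightarrow> 'b::euclidean_space"
  assumes "integrable M f" "b \<in> borel_measurable M" "\<And>x. x \<in> space M \<Longrightarrow> norm (b x) \<le> B"
  shows "integrable M (\<lambda>x. b x \<bullet> f x)"
proof (rule Bochner_Integration.integrable_bound)
  show "integrable M (\<lambda>x. B *\<^sub>R f x)" using assms by auto
  show "(\<lambda>x. b x \<bullet> f x) \<in> borel_measurable M" using assms by auto
  show "AE x in M. norm (b x \<bullet> f x) \<le> norm (B *\<^sub>R f x)"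
  proof (rule AE_I2)
    fix x assume "x \<in> space M"
    then have "norm (b x) \<le> \<bar>B\<bar>" using assms(3)[of x] by linarith
    then show "norm (b x \<bullet> f x) \<le> norm (B *\<^sub>R f x)"
      using Cauchy_Schwarz_ineq2[of "b x" "f x"] mult_right_mono[of "norm (b x)" "\<bar>B\<bar>" "norm (f x)"] by simp
  qed
qed

text \<open>
  A non-integrable function has integral 0, so it satisfies the bound as well; the averages with
  respect to the concentration measure are estimated in this way.
\<close>

lemma abs_integral_le_bound:
  fixes f :: "'a \<Rightarrow> real"
  assumes "finite_measure M" "0 \<le> B" "\<And>x. x \<in> space M \<Longrightarrow> \<bar>f x\<bar> \<le> B"
  shows "\<bar>\<integral>x. f x \<partial>M\<bar> \<le> B * measure M (space M)"
proof (cases "integrable M f")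
  case True
  interpret finite_measure M by fact
  have "\<bar>\<integral>x. f x \<partial>M\<bar> \<le> (\<integral>x. \<bar>f x\<bar> \<partial>M)" by (rule integral_abs_bound)
  also have "\<dots> \<le> (\<integral>x. B \<partial>M)" using True assms by (intro integral_mono) auto
  finally show ?thesis by (simp add: mult.commute)
qed (use assms in \<open>simp add: not_integrable_integral_eq\<close>)

text \<open>
  The inequality holds only almost everywhere, so the argument is run for the continuous primitive
  \<open>\<Phi>\<close> of \<open>R\<close>. Integrating the inequality gives \<open>\<Phi> t \<le> C * I t\<close> for the primitive \<open>I\<close> of \<open>\<Phi>\<close>, and
  then \<open>exp (- C t) * I t\<close> is nonincreasing and starts at 0.
\<close>

lemma gronwall_L1:
  fixes R :: "real \<Rightarrow> real"
  assumes R: "integrable (lebesgue_on {0..b}) R" and C: "0 \<le> C"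
    and pos: "AE t in lebesgue_on {0..b}. 0 \<le> R t"
    and le: "AE t in lebesgue_on {0..b}. R t \<le> C * (\<integral>s. R s \<partial>lebesgue_on {0..t})"
  shows "AE t in lebesgue_on {0..b}. R t = 0"
proof (cases "0 \<le> b")
  case False then have "{0..b} = {}" by auto
  then show ?thesis by (auto intro: AE_I2)
next
  case b: True
  define \<Phi> where "\<Phi> t = (\<integral>s. R s \<partial>lebesgue_on {0..t})" for t
  have cont: "continuous_on {0..b} \<Phi>"
    unfolding \<Phi>_def by (rule indefinite_integral_continuous_real[OF R])
  have io: "\<Phi> integrable_on {0..t}" if "t \<le> b" for t
    using that by (intro integrable_continuous_real continuous_on_subset[OF cont]) auto
  have il: "integrable (lebesgue_on {0..t}) \<Phi>" if "t \<le> b" for t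
    using that by (intro continuous_imp_integrable_real continuous_on_subset[OF cont]) auto
  define I where "I t = integral {0..t} \<Phi>" for t
  have \<Phi>I: "\<Phi> t \<le> C * I t" if t: "0 \<le> t" "t \<le> b" for t
  proof -
    have sub: "AE s in lebesgue_on {0..t}. R s \<le> C * \<Phi> s"
      using t by (intro AE_lebesgue_on_subset[OF le[folded \<Phi>_def]]) auto
    have "integrable (lebesgue_on {0..t}) R"
      using integrable_subinterval[OF R] t by auto
    then have "\<Phi> t \<le> (\<integral>s. C * \<Phi> s \<partial>lebesgue_on {0..t})"
      unfolding \<Phi>_def[of t] using sub il[OF t(2)] by (intro integral_mono_AE) auto
    also have "\<dots> = C * I t" unfolding I_def
      using il[OF t(2)] by (simp add: lebesgue_integral_eq_integral)
    finally show ?thesis .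
  qed
  have Ider: "(I has_real_derivative \<Phi> t) (at t)" if "0 < t" "t < b" for t
  proof -
    have "(I has_real_derivative \<Phi> t) (at t within {0..b})"
      unfolding I_def using integral_has_real_derivative[OF cont, of t] that by auto
    then show ?thesis using that at_within_Icc_at[of 0 t b] by auto
  qed
  have Icont: "continuous_on {0..b} I"
    unfolding I_def by (rule indefinite_integral_continuous_1) (use io in auto)
  define g where "g t = exp (- C * t) * I t" for t
  have "g t \<le> g 0" if t: "0 \<le> t" "t \<le> b" for t
  proof (cases "t = 0")
    case False
    show ?thesis
    proof (rule DERIV_nonpos_imp_decreasing_open[where f = g])
      show "0 \<le> t" by (fact t)
      fix x assume x: "0 < x" "x < t"
      have "(g has_real_derivative exp (- C * x) * (\<Phi> x - C * I x)) (at x)"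
        unfolding g_def using x t
        by (auto intro!: derivative_eq_intros Ider simp: algebra_simps)
      moreover have "exp (- C * x) * (\<Phi> x - C * I x) \<le> 0"
        using \<Phi>I[of x] x t by (intro mult_nonneg_nonpos) auto
      ultimately show "\<exists>y. (g has_real_derivative y) (at x) \<and> y \<le> 0" by blast
    next
      show "continuous_on {0..t} g" unfolding g_def
        using t by (intro continuous_intros continuous_on_subset[OF Icont]) auto
    qed
  qed simp
  moreover have "g 0 = 0" by (simp add: g_def I_def)
  ultimately have "I b \<le> 0" using b by (auto simp: g_def mult_le_0_iff)
  then have "\<Phi> b \<le> 0" using \<Phi>I[of b] b C mult_nonneg_nonpos[of C "I b"] by linarith
  moreover have "0 \<le> \<Phi> b" unfolding \<Phi>_def using pos by (intro integral_nonneg_AE) auto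
  ultimately have "(\<integral>s. R s \<partial>lebesgue_on {0..b}) = 0" unfolding \<Phi>_def by linarith
  then show ?thesis using integral_nonneg_eq_0_iff_AE[OF R pos] by simp
qed

section \<open>Periodic functions and integral identities on the space-time cylinder\<close>

abbreviation (input) slab :: "real \<Rightarrow> (real \<times> (real^'n)) set" where
  "slab T \<equiv> {0..T} \<times> UNIV"

lemma cell_borel [measurable, simp]: "(cell :: (real^'n) set) \<in> sets borel"
proof -
  have "(cell :: (real^'n) set) = (\<Inter>i. {x. 0 \<le> x $ i} \<inter> {x. x $ i < 1})"
    by (auto simp: cell_def)
  also have "\<dots> \<in> sets borel"
    by (intro sets.finite_INT sets.Int borel_closed borel_open closed_Collect_le open_Collect_less
          continuous_intros) auto
  finally show ?thesis .
qed

lemma cyl_borel [measurable, simp]: "(cyl \<tau> :: (real \<times> (real^'n)) set) \<in> sets borel"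
  unfolding cyl_def by (auto simp: borel_prod[symmetric])

lemma cell_subset: "(cell :: (real^'n) set) \<subseteq> cbox 0 1"
  by (auto simp: cell_def mem_box_cart less_imp_le)

lemma cyl_subset: "cyl \<tau> \<subseteq> cbox (0, 0) (\<tau>, 1 :: real^'n)"
  using cell_subset by (auto simp: cyl_def cbox_Pair_eq)

lemma cyl_subset_slab: "\<tau> \<le> T \<Longrightarrow> cyl \<tau> \<subseteq> slab T"
  by (auto simp: cyl_def)

lemma cyl_mono: "\<tau> \<le> \<tau>' \<Longrightarrow> cyl \<tau> \<subseteq> cyl \<tau>'"
  by (auto simp: cyl_def)

lemma finite_lebesgue_on_subset:
  fixes S :: "'a::euclidean_space set"
  assumes "S \<in> sets borel" "S \<subseteq> cbox a b"
  shows "finite_measure (lebesgue_on S)"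
proof
  have "emeasure (lebesgue_on S) (space (lebesgue_on S)) = emeasure lborel S"
    using assms by (simp add: emeasure_restrict_space)
  also have "\<dots> \<le> emeasure lborel (cbox a b)" using assms by (intro emeasure_mono) auto
  also have "\<dots> < \<infinity>" by (rule emeasure_lborel_cbox_finite)
  finally show "emeasure (lebesgue_on S) (space (lebesgue_on S)) \<noteq> \<infinity>" by simp
qed

lemma finite_lebesgue_on_cell: "finite_measure (lebesgue_on (cell :: (real^'n) set))"
  by (rule finite_lebesgue_on_subset[OF cell_borel cell_subset])

lemma finite_lebesgue_on_cyl: "finite_measure (lebesgue_on (cyl \<tau> :: (real \<times> (real^'n)) set))"
  by (rule finite_lebesgue_on_subset[OF cyl_borel cyl_subset])

lemma periodic_shift:
  assumes "periodic_x T F" "t \<in> {0..T}"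
  shows "F (t, x + of_int k *\<^sub>R axis j 1) = F (t, x)"
proof (induction k rule: int_induct[where k = 0])
  case (step1 i)
  then show ?case using assms unfolding periodic_x_def by (metis add.assoc of_int_add of_int_1 scaleR_add_left scaleR_one)
next
  case (step2 i)
  have "F (t, x + of_int (i - 1) *\<^sub>R axis j 1) = F (t, (x + of_int (i - 1) *\<^sub>R axis j 1) + axis j 1)"
    using assms unfolding periodic_x_def by simp
  also have "(x + of_int (i - 1) *\<^sub>R axis j 1) + axis j 1 = x + of_int i *\<^sub>R axis j 1"
    by (simp add: algebra_simps)
  finally show ?case using step2 by simp
qed simp

lemma periodic_shift_sum:
  fixes F :: "real \<times> (real^'n) \<Rightarrow> 'b"
  assumes "periodic_x T F" "t \<in> {0..T}" "finite J"
  shows "F (t, x + (\<Sum>j\<in>J. of_int (k j) *\<^sub>R axis j 1)) = F (t, x)"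
  using assms(3)
proof (induction J)
  case (insert i J)
  have "F (t, x + (\<Sum>j\<in>insert i J. of_int (k j) *\<^sub>R axis j 1))
      = F (t, (x + (\<Sum>j\<in>J. of_int (k j) *\<^sub>R axis j 1)) + of_int (k i) *\<^sub>R axis i 1)"
    using insert by (simp add: add_ac)
  then show ?case using insert periodic_shift[OF assms(1,2)] by simp
qed simp

text \<open>
  Subtracting the integer parts of the coordinates moves a point into the cell. Consequently
  bounds on the compact closure of the cell are global bounds for periodic functions.
\<close>

lemma periodic_cell:
  fixes F :: "real \<times> (real^'n) \<Rightarrow> 'b"
  assumes "periodic_x T F" "t \<in> {0..T}"
  obtains y where "y \<in> cell" "F (t, x) = F (t, y)"
proof
  let ?y = "x + (\<Sum>j\<in>UNIV. of_int (- \<lfloor>x $ j\<rfloor>) *\<^sub>R axis j 1)"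
  have "?y $ i = frac (x $ i)" for i
    by (simp add: frac_def axis_def sum_negf if_distrib[where f = "\<lambda>a. _ * a"] cong: if_cong)
  then show "?y \<in> cell" by (simp add: cell_def frac_lt_1)
  show "F (t, x) = F (t, ?y)"
    by (rule periodic_shift_sum[where J = UNIV and x = x and k = "\<lambda>j. - \<lfloor>x $ j\<rfloor>", OF assms finite, symmetric])
qed

lemma continuous_slab_bounded_cyl:
  fixes F :: "real \<times> (real^'n) \<Rightarrow> 'b::real_normed_vector"
  assumes "continuous_on (slab T) F"
  obtains B where "0 < B" "\<And>z. z \<in> cyl T \<Longrightarrow> norm (F z) \<le> B"
proof -
  have "compact ({0..T} \<times> (cbox 0 1 :: (real^'n) set))" by (intro compact_Times compact_cbox) auto
  then have "compact (F ` ({0..T} \<times> (cbox 0 1 :: (real^'n) set)))"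
    by (rule compact_continuous_image[rotated]) (auto intro: continuous_on_subset[OF assms])
  then have "bounded (F ` ({0..T} \<times> (cbox 0 1 :: (real^'n) set)))" by (rule compact_imp_bounded)
  then obtain B where B: "0 < B" "\<And>y. y \<in> F ` ({0..T} \<times> (cbox 0 1 :: (real^'n) set)) \<Longrightarrow> norm y \<le> B"
    unfolding bounded_pos by blast
  have "norm (F z) \<le> B" if "z \<in> cyl T" for z
    using that cell_subset by (intro B(2) imageI) (auto simp: cyl_def)
  with B that show ?thesis by blast
qed

lemma periodic_bounded:
  fixes F :: "real \<times> (real^'n) \<Rightarrow> 'b::real_normed_vector"
  assumes "periodic_x T F" "continuous_on (slab T) F"
  obtains B where "0 < B" "\<And>z. z \<in> slab T \<Longrightarrow> norm (F z) \<le> B"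
proof -
  obtain B where B: "0 < B" "\<And>z. z \<in> cyl T \<Longrightarrow> norm (F z) \<le> B"
    using continuous_slab_bounded_cyl[OF assms(2)] by blast
  have "norm (F z) \<le> B" if z: "z \<in> slab T" for z
  proof -
    obtain t x where tx: "z = (t, x)" "t \<in> {0..T}" using z by auto
    obtain y where "y \<in> cell" "F (t, x) = F (t, y)" using periodic_cell[OF assms(1) tx(2)] by blast
    then show ?thesis using B(2)[of "(t, y)"] tx by (simp add: cyl_def)
  qed
  with B that show ?thesis by blast
qed

lemma continuous_slab_measurable:
  fixes F :: "real \<times> (real^'n) \<Rightarrow> 'b::euclidean_space"
  assumes "continuous_on (slab T) F" "\<tau> \<le> T"
  shows "F \<in> borel_measurable (lebesgue_on (cyl \<tau>))"
  using assms cyl_subset_slab[OF assms(2)]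
  by (intro continuous_imp_measurable_on_sets_lebesgue continuous_on_subset[OF assms(1)]) auto

lemma continuous_slab_section:
  fixes F :: "real \<times> (real^'n) \<Rightarrow> 'b::euclidean_space"
  assumes "continuous_on (slab T) F" "t \<in> {0..T}"
  shows "continuous_on S (\<lambda>x. F (t, x))"
  using assms(2) by (intro continuous_on_compose2[OF assms(1)] continuous_intros) auto

lemma continuous_cell_measurable:
  fixes f :: "real^'n \<Rightarrow> 'b::euclidean_space"
  assumes "continuous_on UNIV f"
  shows "f \<in> borel_measurable (lebesgue_on cell)"
  by (intro continuous_imp_measurable_on_sets_lebesgue continuous_on_subset[OF assms]) auto

lemma bounded_integrable_finite:
  fixes f :: "'a \<Rightarrow> 'b::{banach, second_countable_topology}"
  assumes "finite_measure M" "f \<in> borel_measurable M" "\<And>x. x \<in> space M \<Longrightarrow> norm (f x) \<le> B"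
  shows "integrable M f"
  using assms by (intro finite_measure.integrable_const_bound[where B = B]) auto

lemma continuous_slab_integrable_cyl:
  fixes F :: "real \<times> (real^'n) \<Rightarrow> 'b::euclidean_space"
  assumes "continuous_on (slab T) F" "\<tau> \<le> T"
  shows "integrable (lebesgue_on (cyl \<tau>)) F"
proof -
  obtain B where "\<And>z. z \<in> cyl T \<Longrightarrow> norm (F z) \<le> B"
    using continuous_slab_bounded_cyl[OF assms(1)] by blast
  then show ?thesis
    using cyl_mono[OF assms(2)] continuous_slab_measurable[OF assms]
    by (intro bounded_integrable_finite[OF finite_lebesgue_on_cyl, where B = B]) auto
qed

lemma continuous_slab_integrable_cell:
  fixes F :: "real \<times> (real^'n) \<Rightarrow> 'b::euclidean_space"
  assumes "continuous_on (slab T) F" "t \<in> {0..T}"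
  shows "integrable (lebesgue_on cell) (\<lambda>x. F (t, x))"
proof -
  obtain B where "\<And>z. z \<in> cyl T \<Longrightarrow> norm (F z) \<le> B"
    using continuous_slab_bounded_cyl[OF assms(1)] by blast
  then show ?thesis
    using assms(2) continuous_cell_measurable[OF continuous_slab_section[OF assms]]
    by (intro bounded_integrable_finite[OF finite_lebesgue_on_cell, where B = B]) (auto simp: cyl_def)
qed

lemma integrable_inner_continuous_cyl:
  fixes a v :: "real \<times> (real^'n) \<Rightarrow> 'b::euclidean_space"
  assumes v: "integrable (lebesgue_on (cyl \<tau>)) v" and a: "continuous_on (slab T) a" and \<tau>: "\<tau> \<le> T"
  shows "integrable (lebesgue_on (cyl \<tau>)) (\<lambda>z. a z \<bullet> v z)"
proof -
  obtain A where "\<And>z. z \<in> cyl T \<Longrightarrow> norm (a z) \<le> A" using continuous_slab_bounded_cyl[OF a] by blast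
  then show ?thesis
    using cyl_mono[OF \<tau>] by (intro integrable_bounded_inner[OF v continuous_slab_measurable[OF a \<tau>], of A]) auto
qed

lemma integrable_inner_continuous_cell:
  fixes v :: "real^'n \<Rightarrow> 'b::euclidean_space"
  assumes v: "integrable (lebesgue_on cell) v" and a: "continuous_on (slab T) a" and t: "t \<in> {0..T}"
  shows "integrable (lebesgue_on cell) (\<lambda>x. a (t, x) \<bullet> v x)"
proof -
  obtain A where "\<And>z. z \<in> cyl T \<Longrightarrow> norm (a z) \<le> A" using continuous_slab_bounded_cyl[OF a] by blast
  then show ?thesis using t
    by (intro integrable_bounded_inner[OF v continuous_cell_measurable[OF continuous_slab_section[OF a t]], of A])
       (auto simp: cyl_def)
qed

text \<open>
  The operators \<open>dt\<close> and \<open>dx\<close> are defined by derivatives along lines. Here they are identified with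
  values of a total derivative relative to the slab, to which the usual calculus rules apply, also
  at the end points of the time interval.
\<close>

lemma dt_eq:
  assumes T: "0 < T" and z: "z \<in> slab T" and F: "(F has_derivative D) (at z within slab T)"
  shows "dt T F z = D (1, 0)"
    and "((\<lambda>s. F (s, snd z)) has_vector_derivative D (1, 0)) (at (fst z) within {0..T})"
proof -
  have "((\<lambda>s. (s, snd z)) has_derivative (\<lambda>h. (h, 0))) (at (fst z) within {0..T})"
    by (auto intro!: derivative_eq_intros)
  then have "((\<lambda>s. F (s, snd z)) has_derivative (\<lambda>h. D (h, 0))) (at (fst z) within {0..T})"
    by (rule has_derivative_in_compose[where f = "\<lambda>s. (s, snd z)" and g = F, unfolded o_def])
       (use F in \<open>auto intro: has_derivative_subset\<close>)
  moreover have "(\<lambda>h. D (h, 0)) = (\<lambda>h. h *\<^sub>R D (1, 0))"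
    unfolding linear_scale[OF has_derivative_linear[OF F], symmetric] by simp
  ultimately show v: "((\<lambda>s. F (s, snd z)) has_vector_derivative D (1, 0)) (at (fst z) within {0..T})"
    by (simp add: has_vector_derivative_def)
  show "dt T F z = D (1, 0)"
    unfolding dt_def using vector_derivative_within_cbox[of 0 T "fst z" "\<lambda>s. F (s, snd z)" "D (1, 0)"] v T z by auto
qed

lemma dx_eq:
  assumes z: "z \<in> slab T" and F: "(F has_derivative D) (at z within slab T)"
  shows "dx j F z = D (0, axis j 1)"
    and "((\<lambda>r. F (fst z, snd z + r *\<^sub>R axis j 1)) has_vector_derivative D (0, axis j 1)) (at 0)"
proof -
  have "((\<lambda>r. (fst z, snd z + r *\<^sub>R axis j 1)) has_derivative (\<lambda>h. (0, h *\<^sub>R axis j 1))) (at 0)"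
    by (auto intro!: derivative_eq_intros)
  then have "((\<lambda>r. F (fst z, snd z + r *\<^sub>R axis j 1)) has_derivative (\<lambda>h. D (0, h *\<^sub>R axis j 1))) (at 0)"
    by (rule has_derivative_in_compose[where g = F, unfolded o_def])
       (use F z in \<open>auto intro: has_derivative_subset\<close>)
  moreover have "(\<lambda>h. D (0, h *\<^sub>R axis j 1)) = (\<lambda>h. h *\<^sub>R D (0, axis j 1))"
    unfolding linear_scale[OF has_derivative_linear[OF F], symmetric] by simp
  ultimately show v: "((\<lambda>r. F (fst z, snd z + r *\<^sub>R axis j 1)) has_vector_derivative D (0, axis j 1)) (at 0)"
    by (simp add: has_vector_derivative_def)
  show "dx j F z = D (0, axis j 1)" unfolding dx_def using v by (rule vector_derivative_at)
qed

lemma grad_x_inner: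
  assumes z: "z \<in> slab T" and F: "(F has_derivative D) (at z within slab T)"
  shows "grad_x F z \<bullet> v = D (0, v)"
proof -
  interpret D: bounded_linear D using F by (rule has_derivative_bounded_linear)
  interpret E: bounded_linear "\<lambda>w. D (0, w)"
    by (rule bounded_linear_compose[OF D.bounded_linear_axioms]) (auto intro: bounded_linear_intros)
  have "D (0, v) = D (0, \<Sum>j\<in>UNIV. v $ j *\<^sub>R axis j 1)"
    using basis_expansion[of v] by (simp add: scalar_mult_eq_scaleR)
  also have "\<dots> = (\<Sum>j\<in>UNIV. v $ j * D (0, axis j 1))"
    by (simp add: E.sum E.scaleR)
  finally have "D (0, v) = (\<Sum>j\<in>UNIV. v $ j * D (0, axis j 1))" .
  then show ?thesis by (simp add: grad_x_def inner_vec_def dx_eq(1)[OF z F] mult.commute)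
qed

lemma derivative_within_slab_unique:
  fixes F :: "real \<times> (real^'n) \<Rightarrow> 'b::real_normed_vector"
  assumes T: "0 < T" and z: "z \<in> slab T"
    and F: "(F has_derivative D) (at z within slab T)" "(F has_derivative D') (at z within slab T)"
  shows "D = D'"
proof (rule frechet_derivative_unique_within[OF F])
  fix i :: "real \<times> (real^'n)" and e :: real assume i: "i \<in> Basis" and e: "0 < e"
  obtain t x where tx: "z = (t, x)" "0 \<le> t" "t \<le> T" using z by auto
  consider "i = (1, 0)" | "fst i = 0" using i by (auto simp: Basis_prod_def)
  then show "\<exists>d. 0 < \<bar>d\<bar> \<and> \<bar>d\<bar> < e \<and> z + d *\<^sub>R i \<in> slab T"
  proof cases
    case 1
    show ?thesis
    proof (cases "t < T")
      case True
      then show ?thesis using 1 tx e by (intro exI[of _ "min (e/2) (T - t)"]) (auto simp: min_def)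
    next
      case False
      then show ?thesis using 1 tx e T by (intro exI[of _ "- min (e/2) t"]) (auto simp: min_def)
    qed
  next
    case 2
    then show ?thesis using tx e by (intro exI[of _ "e/2"]) (cases i; auto)
  qed
qed

lemma C1_torusE:
  assumes "C1_torus T F"
  obtains D where "continuous_on (slab T) D"
    "\<And>z. z \<in> slab T \<Longrightarrow> (F has_derivative blinfun_apply (D z)) (at z within slab T)"
  using assms unfolding C1_torus_def by blast

lemma C1_torus_continuous:
  assumes "C1_torus T F"
  shows "continuous_on (slab T) F"
  using assms unfolding continuous_on_eq_continuous_within
  by (elim C1_torusE) (blast intro: has_derivative_continuous)

lemma C1_torus_dt_continuous:
  assumes "C1_torus T F" "0 < T"
  shows "continuous_on (slab T) (dt T F)"
proof -
  obtain D where D: "continuous_on (slab T) D"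
    "\<And>z. z \<in> slab T \<Longrightarrow> (F has_derivative blinfun_apply (D z)) (at z within slab T)"
    using C1_torusE[OF assms(1)] by blast
  have "continuous_on (slab T) (\<lambda>z. D z (1, 0))" by (intro continuous_intros D)
  then show ?thesis
    by (rule continuous_on_eq) (use dt_eq(1)[OF assms(2) _ D(2)] in auto)
qed

lemma C1_torus_dx_continuous:
  fixes F :: "real \<times> (real^'n) \<Rightarrow> real"
  assumes "C1_torus T F"
  shows "continuous_on (slab T) (dx j F)"
proof -
  obtain D where D: "continuous_on (slab T) D"
    "\<And>z. z \<in> slab T \<Longrightarrow> (F has_derivative blinfun_apply (D z)) (at z within slab T)"
    using C1_torusE[OF assms(1)] by blast
  have "continuous_on (slab T) (\<lambda>z. D z (0, axis j 1))" by (intro continuous_intros D)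
  then show ?thesis
    by (rule continuous_on_eq) (use dx_eq(1)[OF _ D(2)] in auto)
qed

lemma C1_torus_component:
  fixes U :: "real \<times> (real^'n) \<Rightarrow> real^'n"
  assumes "C1_torus T U"
  shows "C1_torus T (\<lambda>z. U z $ i)"
proof -
  obtain D where D: "continuous_on (slab T) D"
    "\<And>z. z \<in> slab T \<Longrightarrow> (U has_derivative blinfun_apply (D z)) (at z within slab T)"
    using C1_torusE[OF assms(1)] by blast
  define E where "E z = blinfun_inner_right (axis i 1) o\<^sub>L D z" for z
  have "continuous_on (slab T) E" unfolding E_def by (intro continuous_intros D)
  moreover have "((\<lambda>z. U z $ i) has_derivative blinfun_apply (E z)) (at z within slab T)"
    if "z \<in> slab T" for z
  proof -
    have "((\<lambda>w. axis i 1 \<bullet> U w) has_derivative (\<lambda>v. axis i 1 \<bullet> D z v)) (at z within slab T)"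
      by (intro derivative_intros D that)
    moreover have "blinfun_apply (E z) = (\<lambda>v. axis i 1 \<bullet> D z v)" by (auto simp: E_def)
    ultimately show ?thesis by (simp add: inner_axis')
  qed
  moreover have "periodic_x T (\<lambda>z. U z $ i)" using assms by (simp add: C1_torus_def periodic_x_def)
  ultimately show ?thesis unfolding C1_torus_def by blast
qed

text \<open>
  The total derivative is unique on the slab, hence periodic like the function itself; it is
  therefore bounded, and the slab is convex.
\<close>

lemma C1_torus_lipschitz:
  fixes F :: "real \<times> (real^'n) \<Rightarrow> 'b::real_normed_vector"
  assumes F: "C1_torus T F" and T: "0 < T"
  obtains L where "L-lipschitz_on (slab T) F"
proof -
  obtain D where D: "continuous_on (slab T) D"
    "\<And>z. z \<in> slab T \<Longrightarrow> (F has_derivative blinfun_apply (D z)) (at z within slab T)"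
    using C1_torusE[OF F] by blast
  have per: "periodic_x T F" using F by (simp add: C1_torus_def)
  have "periodic_x T D" unfolding periodic_x_def
  proof (intro ballI allI)
    fix t x and j :: 'n assume t: "t \<in> {0..T}"
    have z: "(t, x) \<in> slab T" "(t, x + axis j 1) \<in> slab T" using t by auto
    have "((\<lambda>w. w + (0, axis j 1)) has_derivative (\<lambda>v. v)) (at (t, x) within slab T)"
      by (auto intro!: derivative_eq_intros)
    then have "((\<lambda>w. F (w + (0, axis j 1))) has_derivative (\<lambda>v. D (t, x + axis j 1) v)) (at (t, x) within slab T)"
      by (rule has_derivative_in_compose[where g = F, unfolded o_def])
         (use D(2)[OF z(2)] in \<open>auto intro: has_derivative_subset\<close>)
    then have "(F has_derivative (\<lambda>v. D (t, x + axis j 1) v)) (at (t, x) within slab T)"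
      by (rule has_derivative_transform[OF z(1), rotated])
         (use per in \<open>auto simp: periodic_x_def\<close>)
    then show "D (t, x + axis j 1) = D (t, x)"
      using derivative_within_slab_unique[OF T z(1) _ D(2)[OF z(1)]] by (auto intro: blinfun_eqI)
  qed
  then obtain B where B: "0 < B" "\<And>z. z \<in> slab T \<Longrightarrow> norm (D z) \<le> B"
    using periodic_bounded[OF _ D(1)] by blast
  have "B-lipschitz_on (slab T) F"
  proof (rule bounded_derivative_imp_lipschitz)
    show "convex (slab T :: (real \<times> (real^'n)) set)" by (intro convex_Times) auto
    show "onorm (blinfun_apply (D z)) \<le> B" if "z \<in> slab T" for z
      using B(2)[OF that] by (simp add: norm_blinfun.rep_eq)
  qed (use B D in auto)
  with that show ?thesis .
qed

lemma integral_lborel_translate: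
  fixes f :: "'a::euclidean_space \<Rightarrow> real"
  assumes [measurable]: "f \<in> borel_measurable borel"
  shows "(\<integral>x. f (x + c) \<partial>lborel) = (\<integral>x. f x \<partial>lborel)"
    and "integrable lborel (\<lambda>x. f (x + c)) \<longleftrightarrow> integrable lborel f"
proof -
  have d: "distr lborel borel (\<lambda>x. x + c) = (lborel :: 'a measure)"
    using lborel_distr_plus[of c] by (metis (no_types, lifting) add.commute ext)
  have "(\<integral>x. f x \<partial>lborel) = (\<integral>x. f x \<partial>distr lborel borel (\<lambda>x. x + c))" by (simp add: d)
  also have "\<dots> = (\<integral>x. f (x + c) \<partial>lborel)" by (intro integral_distr) auto
  finally show "(\<integral>x. f (x + c) \<partial>lborel) = (\<integral>x. f x \<partial>lborel)" ..
  have "integrable lborel f \<longleftrightarrow> integrable (distr lborel borel (\<lambda>x. x + c)) f" by (simp add: d)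
  also have "\<dots> \<longleftrightarrow> integrable lborel (\<lambda>x. f (x + c))" by (intro integrable_distr_eq) auto
  finally show "integrable lborel (\<lambda>x. f (x + c)) \<longleftrightarrow> integrable lborel f" ..
qed

lemma integral_lebesgue_on_eq_lborel:
  fixes f :: "'a::euclidean_space \<Rightarrow> real"
  assumes "S \<in> sets borel" "f \<in> borel_measurable borel"
  shows "(\<integral>x. f x \<partial>lebesgue_on S) = (\<integral>x. indicator S x * f x \<partial>lborel)"
  using assms by (simp add: integral_restrict_space integral_completion)

text \<open>
  The shifted cell differs from the cell only in a layer \<open>1 \<le> x $ j < 1 + r\<close>, which a lattice
  translation moves onto the missing layer \<open>0 \<le> x $ j < r\<close>.
\<close>

lemma integral_cell_shift:
  fixes g :: "real^'n \<Rightarrow> real"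
  assumes per: "\<And>x. g (x + axis j 1) = g x" and g: "continuous_on UNIV g" and r: "0 \<le> r" "r \<le> 1"
  shows "(\<integral>x. g (x + r *\<^sub>R axis j 1) \<partial>lebesgue_on cell) = (\<integral>x. g x \<partial>lebesgue_on cell)"
proof -
  let ?e = "axis j 1 :: real^'n"
  have [measurable]: "g \<in> borel_measurable borel" using g by (rule borel_measurable_continuous_onI)
  have nth: "(x + s *\<^sub>R ?e) $ i = x $ i + (if i = j then s else 0)" for x s i
    by (simp add: axis_def)
  define P where "P = {x :: real^'n. x $ j < 1}"
  have [measurable]: "P \<in> sets borel"
    unfolding P_def by (intro borel_open open_Collect_less continuous_intros)
  define S where "S = {x. x - r *\<^sub>R ?e \<in> cell}"
  have [measurable]: "S \<in> sets borel"
  proof -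
    have "S = (\<lambda>x. x - r *\<^sub>R ?e) -` cell \<inter> space borel" by (auto simp: S_def)
    also have "\<dots> \<in> sets borel" by (rule measurable_sets[of _ borel borel]) auto
    finally show ?thesis .
  qed
  have Sx: "x \<in> S \<longleftrightarrow> (\<forall>i. (if i = j then r else 0) \<le> x $ i \<and> x $ i < 1 + (if i = j then r else 0))" for x
  proof -
    have "(x - r *\<^sub>R ?e) $ i = x $ i - (if i = j then r else 0)" for i
      by (simp add: axis_def)
    then have "x \<in> S \<longleftrightarrow> (\<forall>i. 0 \<le> x $ i - (if i = j then r else 0) \<and> x $ i - (if i = j then r else 0) < 1)"
      unfolding S_def cell_def mem_Collect_eq by presburger
    then show ?thesis by (simp add: algebra_simps)
  qed
  have int: "integrable lborel (\<lambda>x. indicator A x * g x)" if [measurable]: "A \<in> sets borel" and A: "A \<subseteq> cbox (-2) 2" for A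
  proof -
    have "integrable lborel (\<lambda>x. indicator (cbox (-2) 2 :: (real^'n) set) x *\<^sub>R g x)"
      by (intro borel_integrable_compact continuous_on_subset[OF g]) auto
    then show ?thesis
      by (rule Bochner_Integration.integrable_bound) (use A in \<open>auto simp: indicator_def\<close>)
  qed
  have Sb: "S \<subseteq> cbox (-2) 2"
  proof
    fix x assume x: "x \<in> S"
    have "-2 \<le> x $ i \<and> x $ i \<le> 2" for i
      using x[unfolded Sx, rule_format, of i] r by (auto split: if_splits)
    then show "x \<in> cbox (-2) 2" by (simp add: mem_box_cart)
  qed
  have Cb: "(cell :: (real^'n) set) \<subseteq> cbox (-2) 2"
  proof
    fix x :: "real^'n" assume x: "x \<in> cell"
    have "-2 \<le> x $ i \<and> x $ i \<le> 2" for i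
      using x[unfolded cell_def mem_Collect_eq, rule_format, of i] by auto
    then show "x \<in> cbox (-2) 2" by (simp add: mem_box_cart)
  qed
  have "(\<integral>x. g (x + r *\<^sub>R ?e) \<partial>lebesgue_on cell)
      = (\<integral>x. indicator S (x + r *\<^sub>R ?e) * g (x + r *\<^sub>R ?e) \<partial>lborel)"
    by (subst integral_lebesgue_on_eq_lborel) (auto simp: S_def indicator_def)
  also have "\<dots> = (\<integral>x. indicator S x * g x \<partial>lborel)"
    by (rule integral_lborel_translate(1)[where f = "\<lambda>x. indicator S x * g x"]) measurable
  also have "\<dots> = (\<integral>x. indicator (S \<inter> P) x * g x + indicator (S - P) x * g x \<partial>lborel)"
    by (intro Bochner_Integration.integral_cong) (auto simp: indicator_def)
  also have "\<dots> = (\<integral>x. indicator (S \<inter> P) x * g x \<partial>lborel) + (\<integral>x. indicator (S - P) x * g x \<partial>lborel)"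
    using Sb by (intro Bochner_Integration.integral_add int) auto
  also have "(\<integral>x. indicator (S - P) x * g x \<partial>lborel)
      = (\<integral>x. indicator (S - P) (x + ?e) * g (x + ?e) \<partial>lborel)"
    by (rule integral_lborel_translate(1)[where f = "\<lambda>x. indicator (S - P) x * g x", symmetric]) measurable
  also have "\<dots> = (\<integral>x. indicator (cell - S) x * g x \<partial>lborel)"
  proof (intro Bochner_Integration.integral_cong refl)
    fix x
    have "x + ?e \<in> S - P \<longleftrightarrow> x \<in> cell - S"
    proof
      assume a: "x + ?e \<in> S - P"
      have "0 \<le> x $ i \<and> x $ i < 1 \<and> (i = j \<longrightarrow> x $ i < r)" for i
        using a nth[of x 1 i] r by (auto simp: Sx P_def split: if_splits dest!: spec[of _ i])
      then show "x \<in> cell - S" by (auto simp: Sx cell_def not_le)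
    next
      assume a: "x \<in> cell - S"
      then have c: "0 \<le> x $ i \<and> x $ i < 1" for i by (auto simp: cell_def)
      have "x $ j < r"
      proof (rule ccontr)
        assume "\<not> x $ j < r"
        moreover have "x $ j < 1 + r" using c[of j] r by linarith
        ultimately have "x \<in> S" using c by (auto simp: Sx not_less)
        with a show False by auto
      qed
      have "(if i = j then r else 0) \<le> (x + ?e) $ i \<and> (x + ?e) $ i < 1 + (if i = j then r else 0)" for i
        using c[of i] \<open>x $ j < r\<close> nth[of x 1 i] r by (cases "i = j") auto
      moreover have "\<not> (x + ?e) $ j < 1" using c[of j] nth[of x 1 j] by auto
      ultimately show "x + ?e \<in> S - P" by (simp add: Sx P_def)
    qed
    then show "indicator (S - P) (x + ?e) * g (x + ?e) = indicator (cell - S) x * g x"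
      by (simp add: indicator_def per)
  qed
  also have "S \<inter> P = cell \<inter> S"
  proof (intro set_eqI iffI)
    fix x assume a: "x \<in> S \<inter> P"
    have "0 \<le> x $ i \<and> x $ i < 1" for i
      using a r by (auto simp: Sx P_def split: if_splits dest!: spec[of _ i])
    then show "x \<in> cell \<inter> S" using a by (auto simp: cell_def)
  next
    fix x assume "x \<in> cell \<inter> S" then show "x \<in> S \<inter> P" by (auto simp: P_def cell_def)
  qed
  also have "(\<integral>x. indicator (cell \<inter> S) x * g x \<partial>lborel) + (\<integral>x. indicator (cell - S) x * g x \<partial>lborel)
      = (\<integral>x. indicator (cell \<inter> S) x * g x + indicator (cell - S) x * g x \<partial>lborel)"
    using Cb by (intro Bochner_Integration.integral_add[symmetric] int) auto
  also have "\<dots> = (\<integral>x. indicator cell x * g x \<partial>lborel)"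
    by (intro Bochner_Integration.integral_cong) (auto simp: indicator_def)
  also have "\<dots> = (\<integral>x. g x \<partial>lebesgue_on cell)"
    by (subst integral_lebesgue_on_eq_lborel) auto
  finally show ?thesis .
qed

lemma difference_quotient_LIMSEQ:
  fixes f :: "real \<Rightarrow> real"
  assumes f: "(f has_vector_derivative d) (at a within S)"
    and S: "\<forall>\<^sub>F k in sequentially. a + 1 / real (Suc k) \<in> S"
  shows "(\<lambda>k. real (Suc k) * (f (a + 1 / real (Suc k)) - f a)) \<longlonglongrightarrow> d"
proof -
  have "((\<lambda>y. (f y - f a) / (y - a)) \<longlongrightarrow> d) (at a within S)"
    using f by (simp add: has_real_derivative_iff_has_vector_derivative[symmetric] has_field_derivative_iff)
  moreover have "filterlim (\<lambda>k. a + 1 / real (Suc k)) (at a within S) sequentially"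
    unfolding filterlim_at
  proof
    show "\<forall>\<^sub>F k in sequentially. a + 1 / real (Suc k) \<in> S \<and> a + 1 / real (Suc k) \<noteq> a"
      using S by eventually_elim simp
    show "(\<lambda>k. a + 1 / real (Suc k)) \<longlonglongrightarrow> a"
      using LIMSEQ_inverse_real_of_nat_add[of a] by (simp add: inverse_eq_divide)
  qed
  ultimately have "(\<lambda>k. (f (a + 1 / real (Suc k)) - f a) / (a + 1 / real (Suc k) - a)) \<longlonglongrightarrow> d"
    by (rule filterlim_compose)
  then show ?thesis by (simp add: mult.commute)
qed

lemma AE_limit_measurable_lebesgue_on:
  fixes f :: "nat \<Rightarrow> 'a::euclidean_space \<Rightarrow> real"
  assumes S: "S \<in> sets borel" and f: "\<And>k. f k \<in> borel_measurable (lebesgue_on S)"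
    and lim: "AE x in lebesgue_on S. (\<lambda>k. f k x) \<longlonglongrightarrow> g x"
  shows "g \<in> borel_measurable (lebesgue_on S)"
proof (rule measurable_lebesgue_on_AE_cong)
  show "(\<lambda>x. lim (\<lambda>k. f k x)) \<in> borel_measurable (lebesgue_on S)"
    using f by (rule borel_measurable_lim_metric)
  show "AE x in lebesgue_on S. lim (\<lambda>k. f k x) = g x"
    using lim by eventually_elim (rule limI)
qed (use S in auto)

lemma bounded_limit_integral:
  fixes f :: "nat \<Rightarrow> 'a::euclidean_space \<Rightarrow> real"
  assumes S: "S \<in> sets borel" and fin: "finite_measure (lebesgue_on S)"
    and f: "\<And>k. f k \<in> borel_measurable (lebesgue_on S)"
    and lim: "AE x in lebesgue_on S. (\<lambda>k. f k x) \<longlonglongrightarrow> g x"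
    and B: "\<And>k x. x \<in> S \<Longrightarrow> \<bar>f k x\<bar> \<le> B"
  shows "integrable (lebesgue_on S) g"
    and "(\<lambda>k. \<integral>x. f k x \<partial>lebesgue_on S) \<longlonglongrightarrow> (\<integral>x. g x \<partial>lebesgue_on S)"
proof -
  have g: "g \<in> borel_measurable (lebesgue_on S)" by (rule AE_limit_measurable_lebesgue_on[OF S f lim])
  have i: "integrable (lebesgue_on S) (\<lambda>x. B)" using fin by (rule finite_measure.integrable_const)
  have b: "AE x in lebesgue_on S. norm (f k x) \<le> B" for k using B by (intro AE_I2) auto
  show "integrable (lebesgue_on S) g"
    by (rule integrable_dominated_convergence[OF g f i lim b])
  show "(\<lambda>k. \<integral>x. f k x \<partial>lebesgue_on S) \<longlonglongrightarrow> (\<integral>x. g x \<partial>lebesgue_on S)"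
    by (rule integral_dominated_convergence[OF g f i lim b])
qed

lemma continuous_slab_shift:
  fixes g :: "real \<times> (real^'n) \<Rightarrow> real"
  assumes "continuous_on (slab T) g"
  shows "continuous_on (slab T) (\<lambda>z. g (fst z, snd z + v))"
  by (intro continuous_on_compose2[OF assms] continuous_intros) auto

lemma AE_lebesgue_on_mem:
  assumes "AE x in lebesgue_on S. P x"
  shows "AE x in lebesgue_on S. x \<in> S \<and> P x"
  using assms AE_space[of "lebesgue_on S"] by eventually_elim simp

text \<open>
  Forward difference quotients of \<open>g\<close> have integral 0 by shift invariance. They are bounded by the
  Lipschitz constant and converge almost everywhere, so the limit has integral 0 too.
\<close>

lemma integral_dx_eq_0:
  fixes g :: "real \<times> (real^'n) \<Rightarrow> real"
  assumes L: "L-lipschitz_on (slab T) g" and per: "periodic_x T g" and \<tau>: "\<tau> \<le> T"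
    and ae: "AE z in lebesgue_on (cyl T). g differentiable (at z within slab T)"
  shows "integrable (lebesgue_on (cyl \<tau>)) (dx j g)" and "(\<integral>z. dx j g z \<partial>lebesgue_on (cyl \<tau>)) = 0"
proof -
  define s where "s k z = real (Suc k) * (g (fst z, snd z + (1 / real (Suc k)) *\<^sub>R axis j 1) - g z)" for k z
  have g: "continuous_on (slab T) g" using L by (rule lipschitz_on_continuous_on)
  have sc: "continuous_on (slab T) (s k)" for k
    unfolding s_def by (intro continuous_intros continuous_slab_shift g)
  have sm: "s k \<in> borel_measurable (lebesgue_on (cyl \<tau>))" for k
    using sc \<tau> by (rule continuous_slab_measurable)
  have sb: "\<bar>s k z\<bar> \<le> L" if "z \<in> cyl \<tau>" for k z
  proof -
    have z: "z \<in> slab T" "(fst z, snd z + (1 / real (Suc k)) *\<^sub>R axis j 1) \<in> slab T"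
      using that \<tau> by (auto simp: cyl_def)
    have "\<bar>g (fst z, snd z + (1 / real (Suc k)) *\<^sub>R axis j 1) - g z\<bar> \<le> L * (1 / real (Suc k))"
      using lipschitz_onD[OF L z(2,1)] by (cases z) (simp add: dist_Pair_Pair dist_norm norm_eq_1[THEN iffD2] inner_axis_axis)
    then show ?thesis unfolding s_def abs_mult by (simp add: field_simps)
  qed
  have "AE z in lebesgue_on (cyl \<tau>). (\<lambda>k. s k z) \<longlonglongrightarrow> dx j g z"
  proof -
    have "AE z in lebesgue_on (cyl \<tau>). g differentiable (at z within slab T)"
      using ae cyl_mono[OF \<tau>] by (rule AE_lebesgue_on_subset) auto
    then have "AE z in lebesgue_on (cyl \<tau>). z \<in> cyl \<tau> \<and> g differentiable (at z within slab T)"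
      by (rule AE_lebesgue_on_mem)
    then show ?thesis
    proof eventually_elim
      case (elim z)
      then have z: "z \<in> slab T" using \<tau> by (auto simp: cyl_def)
      obtain D where D: "(g has_derivative D) (at z within slab T)"
        using elim unfolding differentiable_def by blast
      show ?case
        using difference_quotient_LIMSEQ[OF dx_eq(2)[OF z D, of j]] dx_eq(1)[OF z D, of j]
        by (simp add: s_def)
    qed
  qed
  note lim = bounded_limit_integral[OF cyl_borel finite_lebesgue_on_cyl sm this sb]
  show "integrable (lebesgue_on (cyl \<tau>)) (dx j g)" by (rule lim(1))
  have "(\<integral>z. s k z \<partial>lebesgue_on (cyl \<tau>)) = 0" for k
  proof -
    have i: "integrable (lebesgue_on ({0..\<tau>} \<times> cell)) (s k)"
      using continuous_slab_integrable_cyl[OF sc \<tau>] by (simp add: cyl_def)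
    have "(\<integral>x. s k (t, x) \<partial>lebesgue_on cell) = 0" if t: "t \<in> {0..\<tau>}" for t
    proof -
      have t': "t \<in> {0..T}" using t \<tau> by auto
      have i2: "integrable (lebesgue_on cell) (\<lambda>x. g (t, x + (1 / real (Suc k)) *\<^sub>R axis j 1))"
        using continuous_slab_integrable_cell[OF continuous_slab_shift[OF g] t'] by simp
      have "(\<integral>x. s k (t, x) \<partial>lebesgue_on cell) = real (Suc k) *
        ((\<integral>x. g (t, x + (1 / real (Suc k)) *\<^sub>R axis j 1) \<partial>lebesgue_on cell) - (\<integral>x. g (t, x) \<partial>lebesgue_on cell))"
        unfolding s_def fst_conv snd_conv
        using i2 continuous_slab_integrable_cell[OF g t'] by simp
      also have "\<dots> = 0"
        using integral_cell_shift[of "\<lambda>x. g (t, x)" j "1 / real (Suc k)"] per t' continuous_slab_section[OF g t']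
        by (simp add: periodic_x_def)
      finally show ?thesis .
    qed
    then have "(\<integral>t. \<integral>x. s k (t, x) \<partial>lebesgue_on cell \<partial>lebesgue_on {0..\<tau>}) = (\<integral>t. 0 \<partial>lebesgue_on {0..\<tau>})"
      by (intro Bochner_Integration.integral_cong) auto
    then show ?thesis using Fubini_lebesgue_on(3)[OF _ _ i] by (simp add: cyl_def)
  qed
  then show "(\<integral>z. dx j g z \<partial>lebesgue_on (cyl \<tau>)) = 0"
    using lim(2) LIMSEQ_unique[OF _ tendsto_const] by simp
qed

text \<open>
  The difference quotients in time are again bounded by the Lipschitz constant. With
  \<open>\<gamma> t\<close> the integral of \<open>g (t, \<cdot>)\<close> and \<open>\<Gamma>\<close> a primitive of \<open>\<gamma>\<close>, their integrals are differences of
  difference quotients of \<open>\<Gamma>\<close> at \<open>\<tau>\<close> and at 0.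
\<close>

lemma integral_dt:
  fixes g :: "real \<times> (real^'n) \<Rightarrow> real"
  assumes L: "L-lipschitz_on (slab T) g" and \<tau>: "0 \<le> \<tau>" "\<tau> < T"
    and ae: "AE z in lebesgue_on (cyl T). g differentiable (at z within slab T)"
  shows "integrable (lebesgue_on (cyl \<tau>)) (dt T g)"
    and "(\<integral>z. dt T g z \<partial>lebesgue_on (cyl \<tau>)) =
      (\<integral>x. g (\<tau>, x) \<partial>lebesgue_on cell) - (\<integral>x. g (0, x) \<partial>lebesgue_on cell)"
proof -
  have T: "0 < T" using \<tau> by simp
  \<comment> \<open>the step is cut off so that no point leaves the slab; from some \<open>k\<close> on it is \<open>1 / real (Suc k)\<close>\<close>
  define r where "r k = min (1 / real (Suc k)) (T - \<tau>)" for k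
  have r: "0 < r k" "r k \<le> T - \<tau>" for k using \<tau> by (auto simp: r_def)
  have r_eq: "\<forall>\<^sub>F k in sequentially. r k = 1 / real (Suc k)"
  proof -
    have "\<forall>\<^sub>F k in sequentially. 1 / real (Suc k) < T - \<tau>"
      using LIMSEQ_inverse_real_of_nat \<tau> by (intro order_tendstoD(2)[of _ 0]) (auto simp: inverse_eq_divide)
    then show ?thesis by eventually_elim (simp add: r_def)
  qed
  define s where "s k z = (g (fst z + r k, snd z) - g z) / r k" for k z
  have g: "continuous_on (slab T) g" using L by (rule lipschitz_on_continuous_on)
  have sc: "continuous_on (slab \<tau>) (\<lambda>z. g (fst z + r k, snd z))" for k
    using r[of k] by (intro continuous_on_compose2[OF g] continuous_intros) auto
  have g\<tau>: "continuous_on (slab \<tau>) g" using \<tau> by (intro continuous_on_subset[OF g]) auto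
  have sc': "continuous_on (slab \<tau>) (s k)" for k
    unfolding s_def by (intro continuous_intros sc g\<tau>) (use r[of k] in auto)
  have sm: "s k \<in> borel_measurable (lebesgue_on (cyl \<tau>))" for k
    using sc' order_refl by (rule continuous_slab_measurable)
  have sb: "\<bar>s k z\<bar> \<le> L" if "z \<in> cyl \<tau>" for k z
  proof -
    have z: "z \<in> slab T" "(fst z + r k, snd z) \<in> slab T" using that \<tau> r[of k] by (auto simp: cyl_def)
    have "\<bar>g (fst z + r k, snd z) - g z\<bar> \<le> L * r k"
      using lipschitz_onD[OF L z(2,1)] r[of k] by (cases z) (simp add: dist_Pair_Pair dist_norm)
    then show ?thesis unfolding s_def using r[of k] by (simp add: field_simps)
  qed
  have "AE z in lebesgue_on (cyl \<tau>). (\<lambda>k. s k z) \<longlonglongrightarrow> dt T g z"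
  proof -
    have "AE z in lebesgue_on (cyl \<tau>). g differentiable (at z within slab T)"
      using ae cyl_mono[of \<tau> T] \<tau> by (intro AE_lebesgue_on_subset[OF ae]) auto
    then have "AE z in lebesgue_on (cyl \<tau>). z \<in> cyl \<tau> \<and> g differentiable (at z within slab T)"
      by (rule AE_lebesgue_on_mem)
    then show ?thesis
    proof eventually_elim
      case (elim z)
      then have z: "z \<in> slab T" using \<tau> by (auto simp: cyl_def)
      obtain D where D: "(g has_derivative D) (at z within slab T)"
        using elim unfolding differentiable_def by blast
      have "\<forall>\<^sub>F k in sequentially. fst z + 1 / real (Suc k) \<in> {0..T}"
        using r_eq
      proof eventually_elim
        case (elim k) then show ?case using r[of k] z \<open>z \<in> cyl \<tau> \<and> _\<close> by (auto simp: cyl_def)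
      qed
      from difference_quotient_LIMSEQ[OF dt_eq(2)[OF T z D] this]
      have "(\<lambda>k. real (Suc k) * (g (fst z + 1 / real (Suc k), snd z) - g z)) \<longlonglongrightarrow> dt T g z"
        using dt_eq(1)[OF T z D] by simp
      then show ?case
        by (rule Lim_transform_eventually) (use r_eq in \<open>eventually_elim, simp add: s_def mult.commute\<close>)
    qed
  qed
  note lim = bounded_limit_integral[OF cyl_borel finite_lebesgue_on_cyl sm this sb]
  show "integrable (lebesgue_on (cyl \<tau>)) (dt T g)" by (rule lim(1))
  define \<gamma> where "\<gamma> t = (\<integral>x. g (t, x) \<partial>lebesgue_on cell)" for t
  define \<Gamma> where "\<Gamma> t = integral {0..t} \<gamma>" for t
  have \<gamma>c: "continuous_on {0..T} \<gamma>"
  proof (rule lipschitz_on_continuous_on[of "L * measure (lebesgue_on cell) (cell :: (real^'n) set)"], rule lipschitz_onI)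
    fix t t' assume t: "t \<in> {0..T}" "t' \<in> {0..T}"
    have "\<gamma> t - \<gamma> t' = (\<integral>x. g (t, x) - g (t', x) \<partial>lebesgue_on cell)"
      unfolding \<gamma>_def using t continuous_slab_integrable_cell[OF g]
      by (intro Bochner_Integration.integral_diff[symmetric]) auto
    also have "\<bar>\<dots>\<bar> \<le> (L * dist t t') * measure (lebesgue_on cell) (space (lebesgue_on (cell :: (real^'n) set)))"
    proof (rule abs_integral_le_bound[OF finite_lebesgue_on_cell])
      show "\<bar>g (t, x) - g (t', x)\<bar> \<le> L * dist t t'" for x
        using lipschitz_onD[OF L, of "(t, x)" "(t', x)"] t by (simp add: dist_Pair_Pair dist_norm)
    qed (use lipschitz_on_nonneg[OF L] in auto)
    finally show "dist (\<gamma> t) (\<gamma> t') \<le> L * measure (lebesgue_on cell) (cell :: (real^'n) set) * dist t t'"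
      by (simp add: dist_norm mult_ac)
  qed (use lipschitz_on_nonneg[OF L] in auto)
  have \<Gamma>d: "(\<Gamma> has_vector_derivative \<gamma> t) (at t within {0..T})" if "t \<in> {0..T}" for t
    unfolding \<Gamma>_def using integral_has_vector_derivative[OF \<gamma>c that] .
  have eq: "(\<integral>z. s k z \<partial>lebesgue_on (cyl \<tau>)) = (\<Gamma> (\<tau> + r k) - \<Gamma> \<tau> - (\<Gamma> (0 + r k) - \<Gamma> 0)) / r k" for k
  proof -
    have i: "integrable (lebesgue_on ({0..\<tau>} \<times> cell)) (s k)"
      using continuous_slab_integrable_cyl[OF sc' order_refl] by (simp add: cyl_def)
    have gi: "integrable (lebesgue_on {0..\<tau>}) (\<lambda>t. \<gamma> t)" "integrable (lebesgue_on {0..\<tau>}) (\<lambda>t. \<gamma> (t + r k))"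
      using r[of k] \<tau>
      by (auto intro!: continuous_imp_integrable_real continuous_on_compose2[OF \<gamma>c] continuous_intros)
    have "(\<integral>z. s k z \<partial>lebesgue_on (cyl \<tau>)) = (\<integral>t. \<integral>x. s k (t, x) \<partial>lebesgue_on cell \<partial>lebesgue_on {0..\<tau>})"
      using Fubini_lebesgue_on(3)[OF _ _ i] by (simp add: cyl_def)
    also have "\<dots> = (\<integral>t. (\<gamma> (t + r k) - \<gamma> t) / r k \<partial>lebesgue_on {0..\<tau>})"
    proof (intro Bochner_Integration.integral_cong refl)
      fix t assume "t \<in> space (lebesgue_on {0..\<tau>})"
      then have t: "t \<in> {0..T}" "t + r k \<in> {0..T}" using r[of k] \<tau> by auto
      show "(\<integral>x. s k (t, x) \<partial>lebesgue_on cell) = (\<gamma> (t + r k) - \<gamma> t) / r k"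
        unfolding s_def \<gamma>_def fst_conv snd_conv
        using t[THEN continuous_slab_integrable_cell[OF g]] by simp
    qed
    also have "\<dots> = ((\<integral>t. \<gamma> (t + r k) \<partial>lebesgue_on {0..\<tau>}) - (\<integral>t. \<gamma> t \<partial>lebesgue_on {0..\<tau>})) / r k"
      using gi by simp
    also have "(\<integral>t. \<gamma> t \<partial>lebesgue_on {0..\<tau>}) = \<Gamma> \<tau>"
      unfolding \<Gamma>_def using gi by (intro lebesgue_integral_eq_integral) auto
    also have "(\<integral>t. \<gamma> (t + r k) \<partial>lebesgue_on {0..\<tau>}) = integral {0..\<tau>} (\<gamma> \<circ> (\<lambda>t. t + r k))"
      using gi by (subst lebesgue_integral_eq_integral) (auto simp: o_def)
    also have "\<dots> = integral {0 + r k..\<tau> + r k} \<gamma>"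
      using r[of k] by (intro integral_shift continuous_on_subset[OF \<gamma>c]) auto
    also have "\<dots> = \<Gamma> (\<tau> + r k) - \<Gamma> (r k)"
    proof -
      have "\<Gamma> (r k) + integral {r k..\<tau> + r k} \<gamma> = \<Gamma> (\<tau> + r k)"
        unfolding \<Gamma>_def using r[of k] \<tau>
        by (intro Henstock_Kurzweil_Integration.integral_combine integrable_continuous_real continuous_on_subset[OF \<gamma>c]) auto
      then show ?thesis by simp
    qed
    finally show ?thesis by (simp add: \<Gamma>_def)
  qed
  have ev: "\<forall>\<^sub>F k in sequentially. t + 1 / real (Suc k) \<in> {0..T}" if "0 \<le> t" "t \<le> \<tau>" for t
    using r_eq
  proof eventually_elim
    case (elim k) then show ?case using r[of k] that by auto
  qed
  have "(\<lambda>k. real (Suc k) * (\<Gamma> (\<tau> + 1 / real (Suc k)) - \<Gamma> \<tau>)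
      - real (Suc k) * (\<Gamma> (0 + 1 / real (Suc k)) - \<Gamma> 0)) \<longlonglongrightarrow> \<gamma> \<tau> - \<gamma> 0"
    using \<tau> by (intro tendsto_diff difference_quotient_LIMSEQ[OF \<Gamma>d] ev) auto
  then have "(\<lambda>k. \<integral>z. s k z \<partial>lebesgue_on (cyl \<tau>)) \<longlonglongrightarrow> \<gamma> \<tau> - \<gamma> 0"
  proof (rule Lim_transform_eventually)
    show "\<forall>\<^sub>F k in sequentially. real (Suc k) * (\<Gamma> (\<tau> + 1 / real (Suc k)) - \<Gamma> \<tau>)
      - real (Suc k) * (\<Gamma> (0 + 1 / real (Suc k)) - \<Gamma> 0) = (\<integral>z. s k z \<partial>lebesgue_on (cyl \<tau>))"
      using r_eq
    proof eventually_elim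
      case (elim k)
      have "(\<integral>z. s k z \<partial>lebesgue_on (cyl \<tau>)) = real (Suc k) * (\<Gamma> (\<tau> + r k) - \<Gamma> \<tau> - (\<Gamma> (0 + r k) - \<Gamma> 0))"
        unfolding eq by (simp add: elim)
      then show ?case unfolding elim by (simp only: right_diff_distrib)
    qed
  qed
  then show "(\<integral>z. dt T g z \<partial>lebesgue_on (cyl \<tau>)) =
      (\<integral>x. g (\<tau>, x) \<partial>lebesgue_on cell) - (\<integral>x. g (0, x) \<partial>lebesgue_on cell)"
    unfolding \<gamma>_def using lim(2) LIMSEQ_unique by blast
qed

section \<open>Mollification of Lipschitz functions\<close>

text \<open>
  Squaring the truncated paraboloid makes it continuously differentiable, and its size and the size
  of its gradient are elementary powers of \<open>\<epsilon>\<close>.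
\<close>

definition bump :: "real \<Rightarrow> 'a::euclidean_space \<Rightarrow> real" where
  "bump \<epsilon> y = (max 0 (\<epsilon>\<^sup>2 - y \<bullet> y))\<^sup>2"

text \<open>
  The negative of the gradient of \<open>bump \<epsilon>\<close>, that is, the gradient of \<open>bump \<epsilon> (w - z)\<close> with respect to
  the centre \<open>z\<close>.
\<close>

definition bump_deriv :: "real \<Rightarrow> 'a::euclidean_space \<Rightarrow> 'a" where
  "bump_deriv \<epsilon> y = (4 * max 0 (\<epsilon>\<^sup>2 - y \<bullet> y)) *\<^sub>R y"

definition mollify :: "real \<Rightarrow> ('a::euclidean_space \<Rightarrow> real) \<Rightarrow> 'a \<Rightarrow> real" where
  "mollify \<epsilon> F z = (\<integral>y. F (z + y) * bump \<epsilon> y \<partial>lborel) / (\<integral>y. bump \<epsilon> (y :: 'a) \<partial>lborel)"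

definition mollify_grad :: "real \<Rightarrow> ('a::euclidean_space \<Rightarrow> real) \<Rightarrow> 'a \<Rightarrow> 'a" where
  "mollify_grad \<epsilon> F z = (\<integral>y. F (z + y) *\<^sub>R bump_deriv \<epsilon> y \<partial>lborel) /\<^sub>R (\<integral>y. bump \<epsilon> (y :: 'a) \<partial>lborel)"

lemma DERIV_max0_squared: "((\<lambda>s::real. (max 0 s)\<^sup>2) has_real_derivative 2 * max 0 s) (at s)"
proof -
  consider "s < 0" | "s > 0" | "s = 0" by linarith
  then show ?thesis
  proof cases
    case 1
    have "((\<lambda>s::real. 0) has_real_derivative 2 * max 0 s) (at s)" using 1 by simp
    then show ?thesis
      by (rule has_field_derivative_transform_within_open[where S = "{..<0}"]) (use 1 in auto)
  next
    case 2
    have "((\<lambda>s::real. s\<^sup>2) has_real_derivative 2 * max 0 s) (at s)"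
      using 2 by (auto intro!: derivative_eq_intros)
    then show ?thesis
      by (rule has_field_derivative_transform_within_open[where S = "{0<..}"]) (use 2 in auto)
  next
    case 3
    have "((\<lambda>y::real. (max 0 y)\<^sup>2 / y) \<longlongrightarrow> 0) (at 0)"
    proof (rule tendsto_rabs_zero_cancel, rule real_tendsto_sandwich[OF _ _ tendsto_const])
      show "((\<lambda>y::real. \<bar>y\<bar>) \<longlongrightarrow> 0) (at 0)" by (rule tendsto_rabs_zero) (rule tendsto_ident_at)
      have "\<bar>(max 0 y)\<^sup>2 / y\<bar> \<le> \<bar>y\<bar>" for y :: real
        by (cases "y \<le> 0") (auto simp: power2_eq_square max_def)
      then show "\<forall>\<^sub>F y::real in at 0. \<bar>(max 0 y)\<^sup>2 / y\<bar> \<le> \<bar>y\<bar>" by simp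
    qed auto
    then show ?thesis using 3 by (simp add: has_field_derivative_iff)
  qed
qed

lemma bump_has_derivative:
  "((\<lambda>z. bump \<epsilon> (w - z)) has_derivative (\<lambda>v. bump_deriv \<epsilon> (w - z) \<bullet> v)) (at z within S)"
proof -
  have "((\<lambda>z. \<epsilon>\<^sup>2 - (w - z) \<bullet> (w - z)) has_derivative (\<lambda>v. 2 * ((w - z) \<bullet> v))) (at z within S)"
    by (auto intro!: derivative_eq_intros simp: inner_commute algebra_simps)
  from has_derivative_compose[OF this DERIV_max0_squared[unfolded has_field_derivative_def]]
  show ?thesis by (simp add: bump_def bump_deriv_def mult_ac)
qed

lemma bump_nonneg: "0 \<le> bump \<epsilon> y" by (simp add: bump_def)

lemma bump_eq_0: "\<epsilon> \<le> norm y \<Longrightarrow> 0 \<le> \<epsilon> \<Longrightarrow> bump \<epsilon> y = 0"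
  by (simp add: bump_def power2_norm_eq_inner[symmetric] power_mono)

lemma bump_deriv_eq_0: "\<epsilon> \<le> norm y \<Longrightarrow> 0 \<le> \<epsilon> \<Longrightarrow> bump_deriv \<epsilon> y = 0"
  by (simp add: bump_deriv_def power2_norm_eq_inner[symmetric] power_mono)

lemma continuous_on_bump [continuous_intros]:
  "continuous_on S f \<Longrightarrow> continuous_on S (\<lambda>x. bump \<epsilon> (f x))"
  unfolding bump_def by (intro continuous_intros)

lemma continuous_on_bump_deriv [continuous_intros]:
  "continuous_on S f \<Longrightarrow> continuous_on S (\<lambda>x. bump_deriv \<epsilon> (f x))"
  unfolding bump_deriv_def by (intro continuous_intros)

lemma integrable_compact_support:
  fixes f :: "'a::euclidean_space \<Rightarrow> 'b::{banach, second_countable_topology}"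
  assumes "continuous_on UNIV f" "compact S" "\<And>x. x \<notin> S \<Longrightarrow> f x = 0"
  shows "integrable lborel f"
proof -
  have "integrable lborel (\<lambda>x. indicator S x *\<^sub>R f x)"
    by (intro borel_integrable_compact continuous_on_subset[OF assms(1)] assms(2)) auto
  also have "(\<lambda>x. indicator S x *\<^sub>R f x) = f" using assms(3) by (auto simp: indicator_def)
  finally show ?thesis .
qed

lemma integrable_bump:
  fixes F :: "'a::euclidean_space \<Rightarrow> real"
  assumes "continuous_on UNIV F" "0 \<le> \<epsilon>"
  shows "integrable lborel (\<lambda>y. F y * bump \<epsilon> y)" "integrable lborel (\<lambda>y. F y *\<^sub>R bump_deriv \<epsilon> y)"
  using assms
  by (auto intro!: integrable_compact_support[where S = "cball 0 \<epsilon>"] continuous_intros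
      simp: bump_eq_0 bump_deriv_eq_0)

text \<open>
  On the ball of half the radius \<open>\<epsilon>\<^sup>2 - y \<bullet> y\<close> is at least \<open>3/4 * \<epsilon>\<^sup>2\<close>.
\<close>

lemma bump_integral_ge:
  assumes \<epsilon>: "0 < \<epsilon>"
  shows "9 / 16 * \<epsilon> ^ 4 * measure lborel (ball (0::'a::euclidean_space) (\<epsilon> / 2)) \<le> (\<integral>y. bump \<epsilon> (y :: 'a) \<partial>lborel)"
proof -
  have "(\<integral>y. 9 / 16 * \<epsilon> ^ 4 * indicator (ball (0::'a) (\<epsilon> / 2)) y \<partial>lborel) \<le> (\<integral>y. bump \<epsilon> (y :: 'a) \<partial>lborel)"
  proof (rule integral_mono)
    show "integrable lborel (\<lambda>y :: 'a. bump \<epsilon> y)" using integrable_bump(1)[of "\<lambda>_. 1" \<epsilon>] \<epsilon> by simp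
    show "integrable lborel (\<lambda>y::'a. 9 / 16 * \<epsilon> ^ 4 * indicator (ball 0 (\<epsilon> / 2)) y)"
      by (intro integrable_mult_right integrable_real_indicator emeasure_bounded_finite) auto
    fix y :: 'a
    show "9 / 16 * \<epsilon> ^ 4 * indicator (ball 0 (\<epsilon> / 2)) y \<le> bump \<epsilon> y"
    proof (cases "y \<in> ball 0 (\<epsilon> / 2)")
      case True
      then have "(norm y)\<^sup>2 \<le> (\<epsilon> / 2)\<^sup>2" by (intro power_mono) auto
      then have "y \<bullet> y \<le> \<epsilon>\<^sup>2 / 4" by (simp add: power2_norm_eq_inner power_divide)
      then have "3 / 4 * \<epsilon>\<^sup>2 \<le> max 0 (\<epsilon>\<^sup>2 - y \<bullet> y)" by linarith
      then have "(3 / 4 * \<epsilon>\<^sup>2)\<^sup>2 \<le> bump \<epsilon> y" unfolding bump_def by (intro power_mono) auto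
      then show ?thesis using True by (simp add: power_mult_distrib power_divide)
    qed (simp add: bump_nonneg)
  qed
  then show ?thesis by simp
qed

lemma bump_integral_pos: "0 < \<epsilon> \<Longrightarrow> 0 < (\<integral>y. bump \<epsilon> (y :: 'a::euclidean_space) \<partial>lborel)"
  by (rule less_le_trans[OF _ bump_integral_ge]) (auto simp: content_ball_pos)

lemma mollify_lipschitz:
  fixes F :: "'a::euclidean_space \<Rightarrow> real"
  assumes F: "L-lipschitz_on UNIV F" and \<epsilon>: "0 < \<epsilon>"
  shows "L-lipschitz_on UNIV (mollify \<epsilon> F)" and "\<bar>mollify \<epsilon> F z - F z\<bar> \<le> L * \<epsilon>"
proof -
  have c: "continuous_on UNIV (\<lambda>y. F (z + y))" for z
    by (intro continuous_on_compose2[OF lipschitz_on_continuous_on[OF F]] continuous_intros) auto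
  define N where "N = (\<integral>y. bump \<epsilon> (y :: 'a) \<partial>lborel)"
  have N: "0 < N" unfolding N_def using bump_integral_pos[OF \<epsilon>] .
  note i = integrable_bump(1)[OF _ less_imp_le[OF \<epsilon>]]
  have ib: "integrable lborel (\<lambda>y. bump \<epsilon> (y :: 'a))" using i[of "\<lambda>_. 1"] by simp
  have L: "0 \<le> L" using F by (rule lipschitz_on_nonneg)
  have main: "\<bar>(\<integral>y. (a (y :: 'a)) * bump \<epsilon> y \<partial>lborel) / N\<bar> \<le> M"
    if a: "continuous_on UNIV a" "\<And>y. norm y \<le> \<epsilon> \<Longrightarrow> \<bar>a y\<bar> \<le> M" for a M
  proof -
    have "\<bar>(\<integral>y. a y * bump \<epsilon> y \<partial>lborel)\<bar> \<le> (\<integral>y. \<bar>a y * bump \<epsilon> y\<bar> \<partial>lborel)" by (rule integral_abs_bound)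
    also have "\<dots> \<le> (\<integral>y. M * bump \<epsilon> (y :: 'a) \<partial>lborel)"
    proof (rule integral_mono)
      fix y :: 'a
      show "\<bar>a y * bump \<epsilon> y\<bar> \<le> M * bump \<epsilon> y"
        using a(2)[of y] \<epsilon> bump_eq_0[of \<epsilon> y]
        by (cases "norm y \<le> \<epsilon>") (auto simp: abs_mult bump_nonneg intro: mult_right_mono)
    qed (use i[OF a(1)] ib in auto)
    also have "\<dots> = M * N" by (simp add: N_def)
    finally show ?thesis using N by (simp add: field_simps)
  qed
  show "L-lipschitz_on UNIV (mollify \<epsilon> F)"
  proof (rule lipschitz_onI[OF _ L])
    fix z z' :: 'a
    have "mollify \<epsilon> F z - mollify \<epsilon> F z' = (\<integral>y. (F (z + y) - F (z' + y)) * bump \<epsilon> y \<partial>lborel) / N"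
      using i[OF c] by (simp add: mollify_def N_def[symmetric] left_diff_distrib diff_divide_distrib)
    also have "\<bar>\<dots>\<bar> \<le> L * dist z z'"
    proof (intro main continuous_intros c)
      fix y
      show "\<bar>F (z + y) - F (z' + y)\<bar> \<le> L * dist z z'"
        using lipschitz_onD[OF F, of "z + y" "z' + y"] by (simp add: dist_norm)
    qed
    finally show "dist (mollify \<epsilon> F z) (mollify \<epsilon> F z') \<le> L * dist z z'" by (simp add: dist_norm)
  qed
  have "mollify \<epsilon> F z - F z = (\<integral>y. (F (z + y) - F z) * bump \<epsilon> y \<partial>lborel) / N"
    using i[OF c] ib N by (simp add: mollify_def N_def[symmetric] left_diff_distrib diff_divide_distrib)
  also have "\<bar>\<dots>\<bar> \<le> L * \<epsilon>"
  proof (intro main continuous_intros c)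
    fix y :: 'a assume "norm y \<le> \<epsilon>"
    then show "\<bar>F (z + y) - F z\<bar> \<le> L * \<epsilon>"
      using lipschitz_onD[OF F, of "z + y" z] L mult_left_mono[of "norm y" \<epsilon> L] by (simp add: dist_norm)
  qed
  finally show "\<bar>mollify \<epsilon> F z - F z\<bar> \<le> L * \<epsilon>" .
qed

text \<open>
  After the substitution \<open>w = z + y\<close> the point \<open>z\<close> enters only through the kernel. For \<open>z\<close> in a unit
  ball all kernels are supported in one fixed box, where differentiation under the integral sign is
  possible.
\<close>

lemma mollify_has_derivative:
  fixes F :: "'a::euclidean_space \<Rightarrow> real"
  assumes F: "continuous_on UNIV F" and \<epsilon>: "0 < \<epsilon>"
  shows "(mollify \<epsilon> F has_derivative (\<lambda>v. mollify_grad \<epsilon> F z \<bullet> v)) (at z)"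
proof -
  define N where "N = (\<integral>y. bump \<epsilon> (y :: 'a) \<partial>lborel)"
  have N: "0 < N" unfolding N_def using bump_integral_pos[OF \<epsilon>] .
  note [continuous_intros] = continuous_on_compose2[OF F]
  have [measurable]: "F \<in> borel_measurable borel" using F by (rule borel_measurable_continuous_onI)
  have [measurable]: "(\<lambda>y::'a. bump \<epsilon> y) \<in> borel_measurable borel" "bump_deriv \<epsilon> \<in> borel_measurable (borel :: 'a measure)"
    by (auto intro!: borel_measurable_continuous_onI continuous_intros)
  obtain a :: 'a where a: "ball z (1 + \<epsilon>) \<subseteq> cbox (- a) a"
    using bounded_subset_cbox_symmetric[OF bounded_ball] by blast
  have out: "\<epsilon> \<le> norm (w - x)" if "x \<in> ball z 1" "w \<notin> cbox (- a) a" for x w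
  proof (rule ccontr)
    assume "\<not> \<epsilon> \<le> norm (w - x)"
    then have "dist z w < 1 + \<epsilon>"
      using that(1) dist_triangle[of z w x] by (auto simp: dist_norm norm_minus_commute)
    then show False using a that(2) by auto
  qed
  have set_int: "(\<integral>w. f w \<partial>lborel) = integral (cbox (- a) a) f"
    if f: "continuous_on UNIV f" "\<And>w. w \<notin> cbox (- a) a \<Longrightarrow> f w = 0" for f :: "'a \<Rightarrow> 'b::euclidean_space"
  proof -
    have e: "(\<lambda>x. indicator (cbox (- a) a) x *\<^sub>R f x) = f" using f(2) by (auto simp: indicator_def)
    have "set_integrable lborel (cbox (- a) a) f"
      unfolding set_integrable_def by (intro borel_integrable_compact continuous_on_subset[OF f(1)]) auto
    from set_borel_integral_eq_integral(2)[OF this] show ?thesis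
      by (simp add: set_lebesgue_integral_def e)
  qed
  have mo: "mollify \<epsilon> F x = integral (cbox (- a) a) (\<lambda>w. F w * bump \<epsilon> (w - x)) / N" if x: "x \<in> ball z 1" for x
  proof -
    have "(\<integral>y. F (x + y) * bump \<epsilon> y \<partial>lborel) = (\<integral>w. F w * bump \<epsilon> (w - x) \<partial>lborel)"
      using integral_lborel_translate(1)[of "\<lambda>w. F w * bump \<epsilon> (w - x)" x] by (simp add: add.commute)
    also have "\<dots> = integral (cbox (- a) a) (\<lambda>w. F w * bump \<epsilon> (w - x))"
      using \<epsilon> x out by (intro set_int) (auto intro!: continuous_intros simp: bump_eq_0)
    finally show ?thesis by (simp add: mollify_def N_def)
  qed
  define fx where "fx x w = blinfun_inner_right (F w *\<^sub>R bump_deriv \<epsilon> (w - x))" for x w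
  have vi: "(\<lambda>w. F w *\<^sub>R bump_deriv \<epsilon> (w - z)) integrable_on cbox (- a) a"
    by (intro integrable_continuous continuous_intros) auto
  have gr: "integral (cbox (- a) a) (\<lambda>w. F w *\<^sub>R bump_deriv \<epsilon> (w - z)) = N *\<^sub>R mollify_grad \<epsilon> F z"
  proof -
    have "(\<integral>y. F (z + y) *\<^sub>R bump_deriv \<epsilon> y \<partial>lborel) = (\<integral>w. F w *\<^sub>R bump_deriv \<epsilon> (w - z) \<partial>lborel)"
    proof -
      have d: "distr lborel borel (\<lambda>x. z + x) = (lborel :: 'a measure)" by (rule lborel_distr_plus)
      have "(\<integral>w. F w *\<^sub>R bump_deriv \<epsilon> (w - z) \<partial>lborel) = (\<integral>w. F w *\<^sub>R bump_deriv \<epsilon> (w - z) \<partial>distr lborel borel (\<lambda>x. z + x))"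
        by (simp add: d)
      also have "\<dots> = (\<integral>y. F (z + y) *\<^sub>R bump_deriv \<epsilon> y \<partial>lborel)"
        by (subst integral_distr) auto
      finally show ?thesis ..
    qed
    also have "\<dots> = integral (cbox (- a) a) (\<lambda>w. F w *\<^sub>R bump_deriv \<epsilon> (w - z))"
      using \<epsilon> out[of z] by (intro set_int) (auto intro!: continuous_intros simp: bump_deriv_eq_0)
    finally show ?thesis using N by (simp add: mollify_grad_def N_def)
  qed
  have "((\<lambda>x. integral (cbox (- a) a) (\<lambda>w. F w * bump \<epsilon> (w - x))) has_derivative
      integral (cbox (- a) a) (fx z)) (at z within ball z 1)"
  proof (rule leibniz_rule)
    fix x w assume "x \<in> ball z 1" "w \<in> cbox (- a) a"
    have "((\<lambda>x. F w * bump \<epsilon> (w - x)) has_derivative (\<lambda>v. F w * (bump_deriv \<epsilon> (w - x) \<bullet> v))) (at x within ball z 1)"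
      by (intro has_derivative_mult_right bump_has_derivative)
    moreover have "blinfun_apply (fx x w) = (\<lambda>v. F w * (bump_deriv \<epsilon> (w - x) \<bullet> v))"
      by (auto simp: fx_def)
    ultimately show "((\<lambda>x. F w * bump \<epsilon> (w - x)) has_derivative blinfun_apply (fx x w)) (at x within ball z 1)"
      by simp
  next
    show "(\<lambda>w. F w * bump \<epsilon> (w - x)) integrable_on cbox (- a) a" for x
      by (intro integrable_continuous continuous_intros) auto
    show "continuous_on (ball z 1 \<times> cbox (- a) a) (\<lambda>(x, w). fx x w)"
      unfolding fx_def split_beta
      by (intro bounded_linear.continuous_on[OF bounded_linear_blinfun_inner_right] continuous_intros) auto
  qed auto
  then have "((\<lambda>x. integral (cbox (- a) a) (\<lambda>w. F w * bump \<epsilon> (w - x)) / N) has_derivative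
      (\<lambda>v. integral (cbox (- a) a) (fx z) v / N)) (at z within ball z 1)"
    by (rule has_derivative_divide[where g = "\<lambda>_. N" and g' = "\<lambda>_. 0", OF _ has_derivative_const, THEN has_derivative_eq_rhs])
       (use N in \<open>auto simp: field_simps\<close>)
  moreover have "integral (cbox (- a) a) (fx z) v / N = mollify_grad \<epsilon> F z \<bullet> v" for v
  proof -
    have "integral (cbox (- a) a) (fx z) = blinfun_inner_right (N *\<^sub>R mollify_grad \<epsilon> F z)"
      using integral_linear[OF vi bounded_linear_blinfun_inner_right]
      by (simp add: fx_def[abs_def] o_def gr)
    then show ?thesis using N by simp
  qed
  ultimately have "((\<lambda>x. integral (cbox (- a) a) (\<lambda>w. F w * bump \<epsilon> (w - x)) / N) has_derivative
      (\<lambda>v. mollify_grad \<epsilon> F z \<bullet> v)) (at z)"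
    by (simp add: at_within_open[of z "ball z 1"])
  then show ?thesis
    by (rule has_derivative_transform_within_open[where s = "ball z 1"]) (auto simp: mo)
qed

text \<open>
  The kernel gradient is at most \<open>4 * \<epsilon> ^ 3\<close> on the ball of radius \<open>\<epsilon>\<close>, the mass of the kernel is at
  least \<open>9/16 * \<epsilon> ^ 4\<close> times the volume of the ball of radius \<open>\<epsilon> / 2\<close>, and the two volumes differ by the
  factor \<open>2 ^ DIM('a)\<close>.
\<close>

lemma mollify_grad_bound:
  fixes F :: "'a::euclidean_space \<Rightarrow> real"
  assumes F: "continuous_on UNIV F" and \<epsilon>: "0 < \<epsilon>"
    and M: "\<And>y. norm y \<le> \<epsilon> \<Longrightarrow> \<bar>F (z + y)\<bar> \<le> M"
  shows "norm (mollify_grad \<epsilon> F z) \<le> 64 / 9 * 2 ^ DIM('a) * (M / \<epsilon>)"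
proof -
  define N where "N = (\<integral>y. bump \<epsilon> (y :: 'a) \<partial>lborel)"
  define V where "V = measure lborel (ball (0::'a) (\<epsilon> / 2))"
  have V: "0 < V" unfolding V_def using \<epsilon> by (intro content_ball_pos) auto
  have NV: "9 / 16 * \<epsilon> ^ 4 * V \<le> N" unfolding N_def V_def using bump_integral_ge[OF \<epsilon>] .
  have N: "0 < N" unfolding N_def using bump_integral_pos[OF \<epsilon>] .
  have V2: "measure lborel (ball (0::'a) \<epsilon>) = 2 ^ DIM('a) * V"
    unfolding V_def using \<epsilon> by (simp add: content_ball power_divide)
  have M0: "0 \<le> M" using M[of 0] \<epsilon> by simp
  have c: "continuous_on UNIV (\<lambda>y. F (z + y))"
    by (intro continuous_on_compose2[OF F] continuous_intros) auto
  have "norm (\<integral>y. F (z + y) *\<^sub>R bump_deriv \<epsilon> y \<partial>lborel) \<le> (\<integral>y. norm (F (z + y) *\<^sub>R bump_deriv \<epsilon> y) \<partial>lborel)"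
    by (rule integral_norm_bound)
  also have "\<dots> \<le> (\<integral>y. M * (4 * \<epsilon> ^ 3) * indicator (ball (0::'a) \<epsilon>) y \<partial>lborel)"
  proof (rule integral_mono)
    show "integrable lborel (\<lambda>y. norm (F (z + y) *\<^sub>R bump_deriv \<epsilon> y))"
      using integrable_bump(2)[OF c, of \<epsilon>] \<epsilon> by (intro integrable_norm) auto
    show "integrable lborel (\<lambda>y::'a. M * (4 * \<epsilon> ^ 3) * indicator (ball 0 \<epsilon>) y)"
      by (intro integrable_mult_right integrable_real_indicator emeasure_bounded_finite) auto
    fix y :: 'a
    show "norm (F (z + y) *\<^sub>R bump_deriv \<epsilon> y) \<le> M * (4 * \<epsilon> ^ 3) * indicator (ball 0 \<epsilon>) y"
    proof (cases "norm y < \<epsilon>")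
      case True
      have "norm (bump_deriv \<epsilon> y) = 4 * max 0 (\<epsilon>\<^sup>2 - y \<bullet> y) * norm y" by (simp add: bump_deriv_def)
      also have "\<dots> \<le> 4 * \<epsilon>\<^sup>2 * \<epsilon>" using True by (intro mult_mono) auto
      also have "\<dots> = 4 * \<epsilon> ^ 3" by (simp add: power2_eq_square power3_eq_cube)
      finally have "norm (F (z + y) *\<^sub>R bump_deriv \<epsilon> y) \<le> M * (4 * \<epsilon> ^ 3)"
        unfolding norm_scaleR real_norm_def using True M0 by (intro mult_mono M) auto
      then show ?thesis using True by simp
    qed (use \<epsilon> in \<open>simp add: bump_deriv_eq_0\<close>)
  qed
  also have "\<dots> = M * (4 * \<epsilon> ^ 3) * (2 ^ DIM('a) * V)" by (simp add: V2)
  finally have "norm (\<integral>y. F (z + y) *\<^sub>R bump_deriv \<epsilon> y \<partial>lborel) / N \<le> M * (4 * \<epsilon> ^ 3) * (2 ^ DIM('a) * V) / N"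
    using N by (intro divide_right_mono) auto
  also have "\<dots> \<le> M * (4 * \<epsilon> ^ 3) * (2 ^ DIM('a) * V) / (9 / 16 * \<epsilon> ^ 4 * V)"
    using NV V \<epsilon> M0 by (intro divide_left_mono mult_pos_pos) (auto intro: N)
  also have "\<dots> = 64 / 9 * 2 ^ DIM('a) * (M / \<epsilon>)"
    using V \<epsilon> by (simp add: field_simps power3_eq_cube power4_eq_xxxx)
  finally show ?thesis
    unfolding mollify_grad_def N_def[symmetric] norm_scaleR
    using N by (simp only: abs_of_pos positive_imp_inverse_positive divide_inverse_commute)
qed

text \<open>
  Mollification changes an affine function only by an additive constant; uniqueness of the derivative
  does the rest.
\<close>

lemma mollify_grad_affine:
  assumes \<epsilon>: "0 < \<epsilon>"
  shows "mollify_grad \<epsilon> (\<lambda>w. \<alpha> + b \<bullet> w) (z :: 'a::euclidean_space) = b"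
proof -
  define N where "N = (\<integral>y. bump \<epsilon> (y :: 'a) \<partial>lborel)"
  have N: "0 < N" unfolding N_def using bump_integral_pos[OF \<epsilon>] .
  have c: "continuous_on UNIV (\<lambda>w. \<alpha> + b \<bullet> w)" by (intro continuous_intros)
  have cb: "continuous_on UNIV (\<lambda>w. b \<bullet> w)" by (intro continuous_intros)
  note i = integrable_bump(1)[OF _ less_imp_le[OF \<epsilon>]]
  have "mollify \<epsilon> (\<lambda>w. \<alpha> + b \<bullet> w) x = (\<alpha> + b \<bullet> x) + (\<integral>y. (b \<bullet> y) * bump \<epsilon> y \<partial>lborel) / N" for x
  proof -
    have "(\<integral>y. (\<alpha> + b \<bullet> (x + y)) * bump \<epsilon> y \<partial>lborel)
        = (\<integral>y. (\<alpha> + b \<bullet> x) * bump \<epsilon> y + (b \<bullet> y) * bump \<epsilon> y \<partial>lborel)"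
      by (simp add: inner_add_right algebra_simps)
    also have "\<dots> = (\<alpha> + b \<bullet> x) * N + (\<integral>y. (b \<bullet> y) * bump \<epsilon> y \<partial>lborel)"
      unfolding N_def using i[of "\<lambda>_. \<alpha> + b \<bullet> x"] i[OF cb]
      by (subst Bochner_Integration.integral_add) auto
    finally show ?thesis using N by (simp add: mollify_def N_def[symmetric] add_divide_distrib)
  qed
  then have "mollify \<epsilon> (\<lambda>w. \<alpha> + b \<bullet> w) = (\<lambda>x. (\<alpha> + b \<bullet> x) + (\<integral>y. (b \<bullet> y) * bump \<epsilon> y \<partial>lborel) / N)"
    by (rule ext)
  then have "(mollify \<epsilon> (\<lambda>w. \<alpha> + b \<bullet> w) has_derivative (\<lambda>v. b \<bullet> v)) (at z)"
    by (auto intro!: derivative_eq_intros)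
  then have "(\<lambda>v. b \<bullet> v) = (\<lambda>v. mollify_grad \<epsilon> (\<lambda>w. \<alpha> + b \<bullet> w) z \<bullet> v)"
    by (rule has_derivative_unique[OF _ mollify_has_derivative[OF c \<epsilon>]])
  then show ?thesis by (metis inner_commute vector_eq_ldot)
qed

text \<open>
  Subtract the first-order Taylor polynomial at \<open>z\<close>, whose mollified gradient is exactly \<open>b\<close>. The remainder is
  \<open>o(\<epsilon>)\<close> on the ball of radius \<open>\<epsilon>\<close>, which beats the factor \<open>1 / \<epsilon>\<close> in the gradient bound. The argument is local
  at \<open>z\<close>, so mollified gradients converge at every single point of differentiability.
\<close>

lemma mollify_grad_tendsto:
  fixes F :: "'a::euclidean_space \<Rightarrow> real"
  assumes F: "continuous_on UNIV F" and D: "(F has_derivative (\<lambda>v. b \<bullet> v)) (at z)"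
  shows "(\<lambda>k. mollify_grad (1 / real (Suc k)) F z) \<longlonglongrightarrow> b"
proof (rule LIMSEQ_I)
  fix e :: real assume e: "0 < e"
  define C where "C = 64 / 9 * (2::real) ^ DIM('a)"
  have C: "0 < C" by (simp add: C_def)
  define \<eta> where "\<eta> = e / (2 * C)"
  have \<eta>: "0 < \<eta>" using e C by (simp add: \<eta>_def)
  obtain \<delta> where \<delta>: "0 < \<delta>" "\<And>w. norm (w - z) < \<delta> \<Longrightarrow> norm (F w - F z - b \<bullet> (w - z)) \<le> \<eta> * norm (w - z)"
    using D \<eta> unfolding has_derivative_at_alt by blast
  obtain K where K: "1 / real (Suc K) < \<delta>" using \<delta>(1) nat_approx_posE by blast
  show "\<exists>K. \<forall>k\<ge>K. norm (mollify_grad (1 / real (Suc k)) F z - b) < e"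
  proof (intro exI allI impI)
    fix k assume k: "K \<le> k"
    define \<epsilon> where "\<epsilon> = 1 / real (Suc k)"
    have "1 / real (Suc k) \<le> 1 / real (Suc K)" using k by (intro divide_left_mono) auto
    then have \<epsilon>: "0 < \<epsilon>" "\<epsilon> < \<delta>" using K by (auto simp: \<epsilon>_def)
    define \<alpha> where "\<alpha> = F z - b \<bullet> z"
    define G where "G w = F w - (\<alpha> + b \<bullet> w)" for w
    have cl: "continuous_on UNIV (\<lambda>w. \<alpha> + b \<bullet> w)" by (intro continuous_intros)
    have cs: "continuous_on UNIV (\<lambda>y. f (z + y))" if "continuous_on UNIV f" for f :: "'a \<Rightarrow> real"
      by (intro continuous_on_compose2[OF that] continuous_intros) auto
    have G: "continuous_on UNIV G" unfolding G_def by (intro continuous_intros F)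
    note i = integrable_bump(2)[OF _ less_imp_le[OF \<epsilon>(1)]]
    have "mollify_grad \<epsilon> G z = mollify_grad \<epsilon> F z - mollify_grad \<epsilon> (\<lambda>w. \<alpha> + b \<bullet> w) z"
      unfolding mollify_grad_def G_def scaleR_left_diff_distrib
      by (subst Bochner_Integration.integral_diff[OF i[OF cs[OF F]] i[OF cs[OF cl]]]) (simp add: scaleR_diff_right)
    then have eq: "mollify_grad \<epsilon> F z - b = mollify_grad \<epsilon> G z" by (simp add: mollify_grad_affine[OF \<epsilon>(1)])
    have "norm (mollify_grad \<epsilon> G z) \<le> 64 / 9 * 2 ^ DIM('a) * ((\<eta> * \<epsilon>) / \<epsilon>)"
    proof (rule mollify_grad_bound[OF G \<epsilon>(1)])
      fix y :: 'a assume y: "norm y \<le> \<epsilon>"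
      have "\<bar>G (z + y)\<bar> \<le> \<eta> * norm y"
        using \<delta>(2)[of "z + y"] y \<epsilon> by (simp add: G_def \<alpha>_def inner_add_right algebra_simps)
      also have "\<dots> \<le> \<eta> * \<epsilon>" using y \<eta> by (intro mult_left_mono) auto
      finally show "\<bar>G (z + y)\<bar> \<le> \<eta> * \<epsilon>" .
    qed
    also have "\<dots> = C * \<eta>" using \<epsilon> by (simp add: C_def)
    also have "\<dots> = e / 2" using C by (simp add: \<eta>_def)
    finally show "norm (mollify_grad (1 / real (Suc k)) F z - b) < e"
      using e eq by (simp add: \<epsilon>_def)
  qed
qed

lemma mollify_grad_continuous:
  fixes F :: "'a::euclidean_space \<Rightarrow> real"
  assumes F: "L-lipschitz_on UNIV F" and \<epsilon>: "0 < \<epsilon>"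
  shows "continuous_on UNIV (mollify_grad \<epsilon> F)"
proof -
  define C where "C = 64 / 9 * (2::real) ^ DIM('a)"
  have Fc: "continuous_on UNIV F" using F by (rule lipschitz_on_continuous_on)
  have cs: "continuous_on UNIV (\<lambda>y. F (z + y))" for z
    by (intro continuous_on_compose2[OF Fc] continuous_intros) auto
  have L: "0 \<le> L" using F by (rule lipschitz_on_nonneg)
  have "(C * (L / \<epsilon>))-lipschitz_on UNIV (mollify_grad \<epsilon> F)"
  proof (rule lipschitz_onI)
    fix z z' :: 'a
    have c: "continuous_on UNIV (\<lambda>w. F w - F (w + (z' - z)))"
      by (intro continuous_intros continuous_on_compose2[OF Fc]) auto
    note i = integrable_bump(2)[OF cs less_imp_le[OF \<epsilon>]]
    have "mollify_grad \<epsilon> F z - mollify_grad \<epsilon> F z' = mollify_grad \<epsilon> (\<lambda>w. F w - F (w + (z' - z))) z"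
    proof -
      have "z + y + (z' - z) = z' + y" for y by simp
      then show ?thesis unfolding mollify_grad_def scaleR_left_diff_distrib
        by (simp only: Bochner_Integration.integral_diff[OF i i] scaleR_diff_right)
    qed
    also have "norm \<dots> \<le> 64 / 9 * 2 ^ DIM('a) * ((L * dist z z') / \<epsilon>)"
    proof (rule mollify_grad_bound[OF c \<epsilon>])
      fix y
      show "\<bar>F (z + y) - F (z + y + (z' - z))\<bar> \<le> L * dist z z'"
        using lipschitz_onD[OF F, of "z + y" "z + y + (z' - z)"] by (simp add: dist_norm norm_minus_commute)
    qed
    finally show "dist (mollify_grad \<epsilon> F z) (mollify_grad \<epsilon> F z') \<le> C * (L / \<epsilon>) * dist z z'"
      by (simp add: dist_norm C_def)
  qed (use L \<epsilon> in \<open>auto simp: C_def\<close>)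
  then show ?thesis by (rule lipschitz_on_continuous_on)
qed

lemma lipschitz_derivative_bound:
  fixes f :: "'a::real_normed_vector \<Rightarrow> real"
  assumes L: "L-lipschitz_on UNIV f" and D: "(f has_derivative D) (at z)"
  shows "\<bar>D v\<bar> \<le> L * norm v"
proof -
  have "((\<lambda>h. z + h *\<^sub>R v) has_derivative (\<lambda>h. h *\<^sub>R v)) (at 0)"
    by (auto intro!: derivative_eq_intros)
  then have "((\<lambda>h. f (z + h *\<^sub>R v)) has_derivative (\<lambda>h. D (h *\<^sub>R v))) (at 0)"
    by (rule has_derivative_compose) (use D in simp)
  moreover have "(\<lambda>h. D (h *\<^sub>R v)) = (\<lambda>h. h *\<^sub>R D v)"
    unfolding linear_scale[OF has_derivative_linear[OF D], symmetric] by simp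
  ultimately have "((\<lambda>h. f (z + h *\<^sub>R v)) has_vector_derivative D v) (at 0)"
    by (simp add: has_vector_derivative_def)
  from difference_quotient_LIMSEQ[OF this]
  have "(\<lambda>k. real (Suc k) * (f (z + (1 / real (Suc k)) *\<^sub>R v) - f z)) \<longlonglongrightarrow> D v" by simp
  then have "(\<lambda>k. \<bar>real (Suc k) * (f (z + (1 / real (Suc k)) *\<^sub>R v) - f z)\<bar>) \<longlonglongrightarrow> \<bar>D v\<bar>"
    by (rule tendsto_rabs)
  then show ?thesis
  proof (rule LIMSEQ_le_const2, intro exI allI impI)
    fix k
    have "\<bar>f (z + (1 / real (Suc k)) *\<^sub>R v) - f z\<bar> \<le> L * (1 / real (Suc k) * norm v)"
      using lipschitz_onD[OF L, of "z + (1 / real (Suc k)) *\<^sub>R v" z] by (simp add: dist_norm)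
    then show "\<bar>real (Suc k) * (f (z + (1 / real (Suc k)) *\<^sub>R v) - f z)\<bar> \<le> L * norm v"
      unfolding abs_mult by (simp add: field_simps)
  qed
qed

text \<open>
  The function is extended to all times by freezing it at \<open>t = 0\<close> and \<open>t = T\<close>, and then mollified. The
  extension may have a kink at these two times, hence the restriction to \<open>0 < fst z < T\<close> for the convergence of
  derivatives.
\<close>

lemma lipschitz_torus_approximation:
  fixes F :: "real \<times> (real^'n) \<Rightarrow> real"
  assumes T: "0 < T" and L: "L-lipschitz_on (slab T) F" and per: "periodic_x T F"
  shows "\<exists>\<Psi>. (\<forall>k::nat. C1_torus T (\<Psi> k)) \<and>
    (\<forall>k. \<forall>z\<in>slab T. \<bar>\<Psi> k z - F z\<bar> \<le> L * (1 / real (Suc k)) \<and>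
       \<bar>dt T (\<Psi> k) z\<bar> \<le> L \<and> (\<forall>j. \<bar>dx j (\<Psi> k) z\<bar> \<le> L)) \<and>
    (\<forall>z\<in>slab T. 0 < fst z \<longrightarrow> fst z < T \<longrightarrow> F differentiable (at z within slab T) \<longrightarrow>
       (\<lambda>k. dt T (\<Psi> k) z) \<longlonglongrightarrow> dt T F z \<and> (\<forall>j. (\<lambda>k. dx j (\<Psi> k) z) \<longlonglongrightarrow> dx j F z))"
proof -
  define cl where "cl z = (max 0 (min T (fst z)), snd z)" for z :: "real \<times> (real^'n)"
  have cl: "cl z \<in> slab T" for z using T by (auto simp: cl_def)
  have cl_id: "cl z = z" if "z \<in> slab T" for z using that by (cases z) (auto simp: cl_def)
  define E where "E z = F (cl z)" for z
  have cl_dist: "dist (cl z) (cl w) \<le> dist z w" for z w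
  proof -
    have "\<bar>max 0 (min T (fst z)) - max 0 (min T (fst w))\<bar> \<le> \<bar>fst z - fst w\<bar>" by linarith
    then have "(max 0 (min T (fst z)) - max 0 (min T (fst w)))\<^sup>2 \<le> (fst z - fst w)\<^sup>2"
      by (simp add: abs_le_square_iff)
    then show ?thesis by (cases z; cases w) (simp add: cl_def dist_Pair_Pair dist_real_def)
  qed
  have EL: "L-lipschitz_on UNIV E"
  proof (rule lipschitz_onI)
    fix z w
    have "dist (E z) (E w) \<le> L * dist (cl z) (cl w)" unfolding E_def by (rule lipschitz_onD[OF L cl cl])
    also have "\<dots> \<le> L * dist z w" using cl_dist lipschitz_on_nonneg[OF L] by (intro mult_left_mono)
    finally show "dist (E z) (E w) \<le> L * dist z w" .
  qed (rule lipschitz_on_nonneg[OF L])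
  have Ec: "continuous_on UNIV E" using EL by (rule lipschitz_on_continuous_on)
  define \<epsilon> where "\<epsilon> k = 1 / real (Suc k)" for k
  have \<epsilon>: "0 < \<epsilon> k" for k by (simp add: \<epsilon>_def)
  define \<Psi> where "\<Psi> k = mollify (\<epsilon> k) E" for k
  have d: "(\<Psi> k has_derivative (\<lambda>v. mollify_grad (\<epsilon> k) E z \<bullet> v)) (at z)" for k z
    unfolding \<Psi>_def by (rule mollify_has_derivative[OF Ec \<epsilon>])
  have dw: "(\<Psi> k has_derivative (\<lambda>v. mollify_grad (\<epsilon> k) E z \<bullet> v)) (at z within slab T)" for k z
    by (rule has_derivative_at_withinI[OF d])
  have Elip: "L-lipschitz_on UNIV (\<Psi> k)" for k
    unfolding \<Psi>_def by (rule mollify_lipschitz(1)[OF EL \<epsilon>])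
  have dt\<Psi>: "dt T (\<Psi> k) z = mollify_grad (\<epsilon> k) E z \<bullet> (1, 0)" if "z \<in> slab T" for k z
    using dt_eq(1)[OF T that dw] .
  have dx\<Psi>: "dx j (\<Psi> k) z = mollify_grad (\<epsilon> k) E z \<bullet> (0, axis j 1)" if "z \<in> slab T" for k z j
    using dx_eq(1)[OF that dw] .
  have der: "(\<lambda>k. mollify_grad (\<epsilon> k) E z \<bullet> v) \<longlonglongrightarrow> D v"
    if z: "z \<in> slab T" "0 < fst z" "fst z < T" and D: "(F has_derivative D) (at z within slab T)" for z D v
  proof -
    define W where "W = {0<..<T} \<times> (UNIV :: (real^'n) set)"
    have W: "open W" "z \<in> W" "W \<subseteq> slab T" using z by (cases z; auto simp: W_def intro!: open_Times)+
    have "(F has_derivative D) (at z within W)" using D W(3) by (rule has_derivative_subset)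
    then have "(F has_derivative D) (at z)" unfolding at_within_open[OF W(2) W(1)] .
    then have "(E has_derivative D) (at z)"
      by (rule has_derivative_transform_within_open[OF _ W(1,2)]) (simp add: E_def cl_id subsetD[OF W(3)])
    moreover obtain b where b: "D = (\<lambda>v. b \<bullet> v)"
    proof
      show "D = (\<lambda>v. (\<Sum>i\<in>Basis. D i *\<^sub>R i) \<bullet> v)"
      proof
        fix v
        interpret linear D using D by (rule has_derivative_linear)
        have "D v = D (\<Sum>i\<in>Basis. (v \<bullet> i) *\<^sub>R i)" by (simp only: euclidean_representation)
        also have "\<dots> = (\<Sum>i\<in>Basis. (v \<bullet> i) * D i)" by (simp only: sum scale real_scaleR_def)
        also have "\<dots> = (\<Sum>i\<in>Basis. D i *\<^sub>R i) \<bullet> v" by (simp add: inner_sum_left inner_commute[of v] mult.commute)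
        finally show "D v = (\<Sum>i\<in>Basis. D i *\<^sub>R i) \<bullet> v" .
      qed
    qed
    ultimately have "(\<lambda>k. mollify_grad (\<epsilon> k) E z) \<longlonglongrightarrow> b"
      unfolding \<epsilon>_def by (intro mollify_grad_tendsto[OF Ec]) simp
    then show ?thesis unfolding b by (intro tendsto_intros)
  qed
  show ?thesis
  proof (intro exI conjI allI ballI impI)
    show "C1_torus T (\<Psi> k)" for k
      unfolding C1_torus_def
    proof (intro conjI exI ballI)
      show "periodic_x T (\<Psi> k)" unfolding periodic_x_def
      proof (intro ballI allI)
        fix t x and j :: 'n
        have "E ((t, x + axis j 1) + y) = E ((t, x) + y)" for y
        proof -
          obtain s where s: "max 0 (min T (t + fst y)) = s" "s \<in> {0..T}" using T by auto
          have "F (s, (x + snd y) + axis j 1) = F (s, x + snd y)"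
            using per s(2) unfolding periodic_x_def by blast
          then show ?thesis by (cases y) (use s(1) in \<open>simp add: E_def cl_def add_ac\<close>)
        qed
        then show "\<Psi> k (t, x + axis j 1) = \<Psi> k (t, x)" by (simp add: \<Psi>_def mollify_def)
      qed
      show "continuous_on (slab T) (\<lambda>z. blinfun_inner_right (mollify_grad (\<epsilon> k) E z))"
        by (intro bounded_linear.continuous_on[OF bounded_linear_blinfun_inner_right]
            continuous_on_subset[OF mollify_grad_continuous[OF EL \<epsilon>]]) auto
      show "(\<Psi> k has_derivative blinfun_apply (blinfun_inner_right (mollify_grad (\<epsilon> k) E z))) (at z within slab T)" for z
        using dw[of k z] by simp
    qed
    show "\<bar>\<Psi> k z - F z\<bar> \<le> L * (1 / real (Suc k))" if "z \<in> slab T" for k z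
      using mollify_lipschitz(2)[OF EL \<epsilon>, of k z] that by (simp add: \<Psi>_def E_def cl_id \<epsilon>_def)
    show "\<bar>dt T (\<Psi> k) z\<bar> \<le> L" if "z \<in> slab T" for k z
      using lipschitz_derivative_bound[OF Elip d, of k z "(1, 0)"] by (simp add: dt\<Psi>[OF that])
    show "\<bar>dx j (\<Psi> k) z\<bar> \<le> L" if "z \<in> slab T" for k z j
      using lipschitz_derivative_bound[OF Elip d, of k z "(0, axis j 1)"]
      by (simp add: dx\<Psi>[OF that] norm_eq_1[THEN iffD2] inner_axis_axis)
    show "(\<lambda>k. dt T (\<Psi> k) z) \<longlonglongrightarrow> dt T F z"
      if z: "z \<in> slab T" "0 < fst z" "fst z < T" "F differentiable (at z within slab T)" for z
    proof -
      obtain D where D: "(F has_derivative D) (at z within slab T)" using z(4) unfolding differentiable_def by blast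
      show ?thesis using der[OF z(1-3) D, of "(1, 0)"] by (simp only: dt\<Psi>[OF z(1)] dt_eq(1)[OF T z(1) D])
    qed
    show "(\<lambda>k. dx j (\<Psi> k) z) \<longlonglongrightarrow> dx j F z"
      if z: "z \<in> slab T" "0 < fst z" "fst z < T" "F differentiable (at z within slab T)" for z j
    proof -
      obtain D where D: "(F has_derivative D) (at z within slab T)" using z(4) unfolding differentiable_def by blast
      show ?thesis using der[OF z(1-3) D, of "(0, axis j 1)"] by (simp only: dx\<Psi>[OF z(1)] dx_eq(1)[OF z(1) D])
    qed
  qed
qed

section \<open>Pointwise identities for the relative energy\<close>

text \<open>
  The distance between the graph of \<open>\<lambda>l. l powr \<gamma>\<close> and its tangent at \<open>H\<close> (a Bregman distance).
\<close>

definition rel_power :: "real \<Rightarrow> real \<Rightarrow> real \<Rightarrow> real" where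
  "rel_power \<gamma> H l = l powr \<gamma> - \<gamma> * H powr (\<gamma> - 1) * l + (\<gamma> - 1) * H powr \<gamma>"

text \<open>
  Strict convexity, in the form of the mean value theorem between \<open>l\<close> and \<open>H\<close>: the derivative in \<open>l\<close> has the
  sign of \<open>l - H\<close>.
\<close>

lemma rel_power_pos:
  assumes \<gamma>: "1 < \<gamma>" and H: "0 < H" and l: "0 \<le> l" "l \<noteq> H"
  shows "0 < rel_power \<gamma> H l"
proof (cases "l = 0")
  case True then show ?thesis using \<gamma> H by (simp add: rel_power_def)
next
  case False
  then have l0: "0 < l" using l by simp
  have HH: "H powr \<gamma> = H powr (\<gamma> - 1) * H" using H powr_mult_base[of H "\<gamma> - 1"] by (simp add: mult.commute)
  have der: "((\<lambda>x. rel_power \<gamma> H x) has_real_derivative \<gamma> * (x powr (\<gamma> - 1) - H powr (\<gamma> - 1))) (at x)" if "0 < x" for x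
    unfolding rel_power_def using that by (auto intro!: derivative_eq_intros simp: algebra_simps)
  have 0: "rel_power \<gamma> H H = 0" by (simp add: rel_power_def HH algebra_simps)
  show ?thesis
  proof (cases "H < l")
    case True
    have "\<exists>x. H < x \<and> x < l \<and> rel_power \<gamma> H l - rel_power \<gamma> H H = (l - H) * (\<gamma> * (x powr (\<gamma> - 1) - H powr (\<gamma> - 1)))"
      by (rule MVT2[OF True]) (rule der, use H in linarith)
    then obtain x where x: "H < x" "x < l" "rel_power \<gamma> H l - rel_power \<gamma> H H = (l - H) * (\<gamma> * (x powr (\<gamma> - 1) - H powr (\<gamma> - 1)))"
      by blast
    have "H powr (\<gamma> - 1) < x powr (\<gamma> - 1)" using x H \<gamma> by (intro powr_less_mono2) auto
    then show ?thesis using x True \<gamma> by (simp add: 0)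
  next
    case False
    then have lH: "l < H" using l by simp
    have "\<exists>x. l < x \<and> x < H \<and> rel_power \<gamma> H H - rel_power \<gamma> H l = (H - l) * (\<gamma> * (x powr (\<gamma> - 1) - H powr (\<gamma> - 1)))"
      by (rule MVT2[OF lH]) (rule der, use l0 in linarith)
    then obtain x where x: "l < x" "x < H" "rel_power \<gamma> H H - rel_power \<gamma> H l = (H - l) * (\<gamma> * (x powr (\<gamma> - 1) - H powr (\<gamma> - 1)))"
      by blast
    have "x powr (\<gamma> - 1) < H powr (\<gamma> - 1)" using x l0 \<gamma> by (intro powr_less_mono2) auto
    then have "(H - l) * (\<gamma> * (x powr (\<gamma> - 1) - H powr (\<gamma> - 1))) < 0"
      using lH \<gamma> by (intro mult_pos_neg) (auto simp: mult_less_0_iff)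
    then show ?thesis using x by (simp add: 0)
  qed
qed

lemma rel_power_self: "0 < H \<Longrightarrow> rel_power \<gamma> H H = 0"
  using powr_mult_base[of H "\<gamma> - 1"] by (simp add: rel_power_def algebra_simps)

lemma rel_power_nonneg: "1 < \<gamma> \<Longrightarrow> 0 < H \<Longrightarrow> 0 \<le> l \<Longrightarrow> 0 \<le> rel_power \<gamma> H l"
  using rel_power_pos[of \<gamma> H l] rel_power_self[of H \<gamma>] by (cases "l = H") auto

text \<open>
  With \<open>p = b1 powr \<gamma>\<close> and \<open>q = (norm b')\<^sup>2\<close> the sphere is the quarter circle \<open>p\<^sup>2 + q\<^sup>2 = 1\<close>, on which
  \<open>p\<close> and \<open>q\<close> are at most 1 and \<open>p + q\<close> is at least 1.
\<close>

lemma sphere_plus_bounds: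
  assumes "(b1, b') \<in> sphere_plus \<gamma>"
  shows "0 \<le> b1" "b1 powr \<gamma> \<le> 1" "(norm b')\<^sup>2 \<le> 1" "1 \<le> (norm b')\<^sup>2 + b1 powr \<gamma>"
proof -
  define p where "p = b1 powr \<gamma>"
  define q where "q = (norm b')\<^sup>2"
  show b1: "0 \<le> b1" using assms by (simp add: sphere_plus_def)
  have "\<bar>b1\<bar> powr (2 * \<gamma>) = p\<^sup>2" using b1 by (simp add: p_def power2_eq_square powr_add[symmetric])
  moreover have "norm b' ^ 4 = q\<^sup>2" by (simp add: q_def power_mult[symmetric])
  ultimately have s: "p\<^sup>2 + q\<^sup>2 = 1" using assms by (simp add: sphere_plus_def)
  have pq: "0 \<le> p" "0 \<le> q" by (auto simp: p_def q_def)
  have "p\<^sup>2 \<le> 1" "q\<^sup>2 \<le> 1" using s zero_le_power2[of p] zero_le_power2[of q] by linarith+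
  then show "b1 powr \<gamma> \<le> 1" "(norm b')\<^sup>2 \<le> 1"
    using power2_le_imp_le[of p 1] power2_le_imp_le[of q 1] by (auto simp: p_def[symmetric] q_def[symmetric])
  have "1\<^sup>2 \<le> (q + p)\<^sup>2" using s mult_nonneg_nonneg[OF pq] unfolding power2_sum by (simp add: mult_ac)
  then have "1 \<le> q + p" using pq by (intro power2_le_imp_le[of 1]) auto
  then show "1 \<le> (norm b')\<^sup>2 + b1 powr \<gamma>" by (simp add: p_def q_def)
qed

lemma inner_outer: "J \<bullet> outer u v = u \<bullet> (J *v v)"
  by (simp add: inner_vec_def outer_def matrix_vector_mult_def sum_distrib_left mult_ac)

lemma norm_outer: "norm (outer u v) = norm u * norm v"
proof -
  have "outer u v *v v = (v \<bullet> v) *\<^sub>R u"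
    by (simp add: vec_eq_iff outer_def matrix_vector_mult_def inner_vec_def sum_distrib_left mult_ac)
  then have "(norm (outer u v))\<^sup>2 = (norm u * norm v)\<^sup>2"
    unfolding power_mult_distrib power2_norm_eq_inner by (simp add: inner_outer mult.commute)
  then show ?thesis by (simp add: power2_eq_iff_nonneg)
qed

lemma inner_outer_bound: "\<bar>J \<bullet> outer v v\<bar> \<le> norm J * (norm v)\<^sup>2"
  using Cauchy_Schwarz_ineq2[of J "outer v v"] by (simp add: norm_outer power2_eq_square)

lemma mat_1_inner_outer: "mat 1 \<bullet> outer v v = (norm v)\<^sup>2"
  by (simp add: inner_outer power2_norm_eq_inner)

text \<open>
  All integrands that are averaged with a Young measure are of this form, so that averages reduce to the
  four moments whose existence is part of the notion of solution.
\<close>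

definition moment_form where
  "moment_form \<gamma> S p \<alpha> \<beta> \<omega> l =
     S \<bullet> convection l + p \<bullet> momentum l + \<alpha> * height l + \<beta> * h_power \<gamma> l + \<omega>"

lemma moment_form_integral:
  assumes "prob_space \<nu>" "integrable \<nu> convection" "integrable \<nu> momentum"
    "integrable \<nu> height" "integrable \<nu> (h_power \<gamma>)"
  shows "integrable \<nu> (moment_form \<gamma> S p \<alpha> \<beta> \<omega>)"
    and "integral\<^sup>L \<nu> (moment_form \<gamma> S p \<alpha> \<beta> \<omega>) =
      S \<bullet> integral\<^sup>L \<nu> convection + p \<bullet> integral\<^sup>L \<nu> momentum
      + \<alpha> * integral\<^sup>L \<nu> height + \<beta> * integral\<^sup>L \<nu> (h_power \<gamma>) + \<omega>"
proof -
  interpret prob_space \<nu> by fact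
  note assms(2-)[simp]
  have e: "moment_form \<gamma> S p \<alpha> \<beta> \<omega> = (\<lambda>l. S \<bullet> convection l + p \<bullet> momentum l + \<alpha> * height l + \<beta> * h_power \<gamma> l + \<omega>)"
    by (simp add: moment_form_def fun_eq_iff)
  show "integrable \<nu> (moment_form \<gamma> S p \<alpha> \<beta> \<omega>)" unfolding e by simp
  show "integral\<^sup>L \<nu> (moment_form \<gamma> S p \<alpha> \<beta> \<omega>) =
      S \<bullet> integral\<^sup>L \<nu> convection + p \<bullet> integral\<^sup>L \<nu> momentum
      + \<alpha> * integral\<^sup>L \<nu> height + \<beta> * integral\<^sup>L \<nu> (h_power \<gamma>) + \<omega>"
    unfolding e by (simp add: prob_space)
qed

text \<open>
  The density of the relative energy between a phase point and the state \<open>(H, U)\<close>.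
\<close>

definition rel_energy :: "real \<Rightarrow> real \<Rightarrow> real \<Rightarrow> real^'n \<Rightarrow> real \<times> (real^'n) \<Rightarrow> real" where
  "rel_energy \<kappa> \<gamma> H U = (\<lambda>(l1, l'). 1/2 * (norm (l' - sqrt l1 *\<^sub>R U))\<^sup>2 + \<kappa> / (\<gamma> - 1) * rel_power \<gamma> H l1)"

text \<open>
  What remains, after all cancellations, of the rate of change of the relative energy. It is of second
  order in the distance between the phase point and \<open>(H, sqrt H *\<^sub>R U)\<close>, exactly like the relative energy.
\<close>

definition rel_flux :: "real \<Rightarrow> real \<Rightarrow> real \<Rightarrow> real^'n \<Rightarrow> real^'n^'n \<Rightarrow> real \<Rightarrow> real \<times> (real^'n) \<Rightarrow> real" where
  "rel_flux \<kappa> \<gamma> H U J \<delta> = (\<lambda>(l1, l'). - (J \<bullet> outer (l' - sqrt l1 *\<^sub>R U) (l' - sqrt l1 *\<^sub>R U)) - \<kappa> * \<delta> * rel_power \<gamma> H l1)"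

lemma inner_outer_diff:
  assumes "0 \<le> l"
  shows "J \<bullet> outer (w - sqrt l *\<^sub>R U) (w - sqrt l *\<^sub>R U) =
    J \<bullet> outer w w - (J *v U + U v* J) \<bullet> (sqrt l *\<^sub>R w) + l * (U \<bullet> (J *v U))"
proof -
  define s where "s = sqrt l"
  have s: "l = s * s" using assms by (simp add: s_def)
  have t: "U \<bullet> (J *v w) = (U v* J) \<bullet> w" by (simp add: dot_lmul_matrix)
  show ?thesis
    unfolding s_def[symmetric] unfolding s
    by (simp add: inner_outer matrix_vector_mult_diff_distrib matrix_vector_mult_scaleR
        inner_diff_left inner_diff_right inner_add_left t[symmetric] inner_commute[of w "J *v U"]) (simp add: algebra_simps)
qed

lemma rel_energy_moment_form:
  assumes "0 \<le> fst l" "1 < \<gamma>"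
  shows "rel_energy \<kappa> \<gamma> H U l = moment_form \<gamma> ((1/2) *\<^sub>R mat 1) (- U)
     (1/2 * (norm U)\<^sup>2 - \<kappa> * \<gamma> / (\<gamma> - 1) * H powr (\<gamma> - 1)) (\<kappa> / (\<gamma> - 1)) (\<kappa> * H powr \<gamma>) l"
proof -
  obtain l1 w where l: "l = (l1, w)" by (cases l)
  have "(norm (w - sqrt l1 *\<^sub>R U))\<^sup>2 = (norm w)\<^sup>2 - 2 * (U \<bullet> (sqrt l1 *\<^sub>R w)) + l1 * (norm U)\<^sup>2"
    using inner_outer_diff[of l1 "mat 1" w U] assms
    unfolding mat_1_inner_outer matrix_vector_mul_lid vector_matrix_mul_rid inner_add_left
    by (simp add: l power2_norm_eq_inner)
  note sq = this
  define c where "c = \<kappa> / (\<gamma> - 1)"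
  have c: "\<kappa> = c * (\<gamma> - 1)" "c * (\<gamma> - 1) * \<gamma> / (\<gamma> - 1) = c * \<gamma>" "c * (\<gamma> - 1) / (\<gamma> - 1) = c"
    using assms by (auto simp: c_def)
  show ?thesis
    unfolding c(1)
    unfolding c(2,3)
    by (simp add: l sq rel_energy_def moment_form_def mat_1_inner_outer convection_def momentum_def height_def
        h_power_def rel_power_def) (insert assms, simp add: algebra_simps diff_divide_distrib add_divide_distrib)
qed

lemma rel_flux_moment_form:
  assumes "0 \<le> fst l"
  shows "rel_flux \<kappa> \<gamma> H U J \<delta> l = moment_form \<gamma> (- J) (J *v U + U v* J)
     (\<kappa> * \<delta> * \<gamma> * H powr (\<gamma> - 1) - U \<bullet> (J *v U)) (- \<kappa> * \<delta>) (- \<kappa> * \<delta> * (\<gamma> - 1) * H powr \<gamma>) l"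
proof -
  obtain l1 w where l: "l = (l1, w)" by (cases l)
  show ?thesis using assms inner_outer_diff[of l1 J w U]
    by (simp add: l rel_flux_def moment_form_def convection_def momentum_def height_def
        h_power_def rel_power_def) (simp add: algebra_simps)
qed

lemma rel_energy_nonneg:
  assumes "0 \<le> fst l" "1 < \<gamma>" "0 < H" "0 < \<kappa>"
  shows "0 \<le> rel_energy \<kappa> \<gamma> H U l"
  using assms rel_power_nonneg[of \<gamma> H "fst l"] by (auto simp: rel_energy_def split_beta)

lemma rel_energy_eq_0:
  assumes "0 \<le> fst l" "1 < \<gamma>" "0 < H" "0 < \<kappa>" "rel_energy \<kappa> \<gamma> H U l = 0"
  shows "l = (H, sqrt H *\<^sub>R U)"
proof -
  have r: "0 \<le> rel_power \<gamma> H (fst l)" using assms rel_power_nonneg[of \<gamma> H "fst l"] by auto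
  then have "0 \<le> \<kappa> / (\<gamma> - 1) * rel_power \<gamma> H (fst l)" using assms by auto
  moreover have "0 \<le> (norm (snd l - sqrt (fst l) *\<^sub>R U))\<^sup>2" by simp
  ultimately have "(norm (snd l - sqrt (fst l) *\<^sub>R U))\<^sup>2 = 0" "\<kappa> / (\<gamma> - 1) * rel_power \<gamma> H (fst l) = 0"
    using assms(5) unfolding rel_energy_def split_beta by linarith+
  then have "snd l = sqrt (fst l) *\<^sub>R U" "rel_power \<gamma> H (fst l) = 0" using assms by auto
  moreover have "fst l = H" using rel_power_pos[of \<gamma> H "fst l"] assms calculation(2) by fastforce
  ultimately show ?thesis by (simp add: prod_eq_iff)
qed

lemma rel_flux_le_rel_energy:
  assumes "0 \<le> fst l" "1 < \<gamma>" "0 < H" "0 < \<kappa>" "norm J \<le> \<beta>" "\<bar>\<delta>\<bar> \<le> \<beta>"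
  shows "rel_flux \<kappa> \<gamma> H U J \<delta> l \<le> (\<beta> * (\<gamma> + 1)) * rel_energy \<kappa> \<gamma> H U l"
proof -
  obtain l1 w where l: "l = (l1, w)" by (cases l)
  define v where "v = w - sqrt l1 *\<^sub>R U"
  define r where "r = rel_power \<gamma> H l1"
  have r: "0 \<le> r" unfolding r_def using assms by (intro rel_power_nonneg) (auto simp: l)
  have \<beta>: "0 \<le> \<beta>" using assms(6) by linarith
  have "- (J \<bullet> outer v v) \<le> \<beta> * (norm v)\<^sup>2"
    using inner_outer_bound[of J v] assms(5) mult_right_mono[OF assms(5), of "(norm v)\<^sup>2"] by auto
  also have "\<dots> \<le> (\<beta> * (\<gamma> + 1)) * (1/2 * (norm v)\<^sup>2)"
  proof -
    have "\<beta> * (norm v)\<^sup>2 * 2 \<le> \<beta> * (norm v)\<^sup>2 * (\<gamma> + 1)" using \<beta> assms by (intro mult_left_mono) auto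
    then show ?thesis by (simp add: algebra_simps)
  qed
  finally have 1: "- (J \<bullet> outer v v) \<le> (\<beta> * (\<gamma> + 1)) * (1/2 * (norm v)\<^sup>2)" .
  have "- \<delta> * (\<kappa> * r) \<le> \<beta> * (\<kappa> * r)" using assms r by (intro mult_right_mono) auto
  also have "\<dots> = \<beta> * (\<gamma> - 1) * (\<kappa> / (\<gamma> - 1) * r)" using assms by (simp add: field_simps)
  also have "\<dots> \<le> \<beta> * (\<gamma> + 1) * (\<kappa> / (\<gamma> - 1) * r)"
    using assms r \<beta> by (intro mult_right_mono mult_left_mono) auto
  finally have 2: "- \<kappa> * \<delta> * r \<le> (\<beta> * (\<gamma> + 1)) * (\<kappa> / (\<gamma> - 1) * r)" by (simp add: algebra_simps)
  show ?thesis using 1 2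
    by (simp add: l rel_flux_def rel_energy_def v_def[symmetric] r_def[symmetric] distrib_left)
qed

lemma prob_space_Dirac:
  assumes M: "prob_space M" "sets M = sets N" and a: "{a} \<in> sets N" and ae: "AE x in M. x = a"
  shows "M = return N a"
proof (rule measure_eqI)
  show "sets M = sets (return N a)" using M by simp
  fix A assume A: "A \<in> sets M"
  interpret prob_space M by fact
  have "emeasure M A = indicator A a"
  proof (cases "a \<in> A")
    case True
    have "AE x in M. x \<in> A" using ae by eventually_elim (use True in auto)
    then show ?thesis using True A by (simp add: emeasure_eq_1_AE)
  next
    case False
    have "AE x in M. x \<notin> A" using ae by eventually_elim (use False in auto)
    then show ?thesis using False AE_iff_measurable[OF A, of "\<lambda>x. x \<notin> A"] sets.sets_into_space[OF A] by auto
  qed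
  then show "emeasure M A = emeasure (return N a) A" using A M by simp
qed

text \<open>
  The algebraic core. The left-hand side collects the integrands of the momentum balance tested with
  \<open>U\<close>, of the mass balance tested with the energy variable, and of the pressure identity; the right-hand side
  is the average of \<open>rel_flux\<close>. Subtracting \<open>U\<close> times the mass equation from the momentum equation gives
  \<open>g = Ut + J *v U + (\<kappa> * \<gamma> * H powr (\<gamma> - 2)) *\<^sub>R Hx\<close>, and the mass equation eliminates \<open>Ht\<close>.
\<close>

lemma pointwise_identity:
  fixes U Ut Hx g P :: "real^'n" and J C :: "real^'n^'n"
  assumes H: "0 < H"
    and mass: "Ht + Hx \<bullet> U + H * \<delta> = 0"
    and mom: "Ht *\<^sub>R U + H *\<^sub>R Ut + ((Hx \<bullet> U) *\<^sub>R U + H *\<^sub>R (J *v U) + (H * \<delta>) *\<^sub>R U)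
      + (\<kappa> * \<gamma> * H powr (\<gamma> - 1)) *\<^sub>R Hx = H *\<^sub>R g"
  shows "(P - h *\<^sub>R U) \<bullet> g - Ut \<bullet> P - J \<bullet> C - \<kappa> * (\<delta> * b)
      + (U \<bullet> Ut - \<kappa> * \<gamma> * H powr (\<gamma> - 2) * Ht) * h + (U v* J - (\<kappa> * \<gamma> * H powr (\<gamma> - 2)) *\<^sub>R Hx) \<bullet> P
      + \<kappa> * \<gamma> * H powr (\<gamma> - 1) * Ht + (\<kappa> * \<gamma> * H powr (\<gamma> - 1) * (Hx \<bullet> U) + \<kappa> * H powr \<gamma> * \<delta>)
    = (- J) \<bullet> C + (J *v U + U v* J) \<bullet> P
      + (\<kappa> * \<delta> * \<gamma> * H powr (\<gamma> - 1) - U \<bullet> (J *v U)) * h + (- \<kappa> * \<delta>) * b + (- \<kappa> * \<delta> * (\<gamma> - 1) * H powr \<gamma>)"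
proof -
  define r where "r = H powr (\<gamma> - 2)"
  have r1: "H powr (\<gamma> - 1) = H * r" using powr_mult_base[of H "\<gamma> - 2"] H by (simp add: r_def)
  have r0: "H powr \<gamma> = H * (H * r)" using powr_mult_base[of H "\<gamma> - 1"] H by (simp add: r1)
  have "H *\<^sub>R g = (Ht + Hx \<bullet> U + H * \<delta>) *\<^sub>R U + H *\<^sub>R (Ut + J *v U + (\<kappa> * \<gamma> * r) *\<^sub>R Hx)"
    unfolding mom[symmetric] r1 by (simp add: algebra_simps)
  also have "\<dots> = H *\<^sub>R (Ut + J *v U + (\<kappa> * \<gamma> * r) *\<^sub>R Hx)" by (simp add: mass)
  finally have g: "g = Ut + J *v U + (\<kappa> * \<gamma> * r) *\<^sub>R Hx" using H by simp
  have Ht: "Ht = - (Hx \<bullet> U) - H * \<delta>" using mass by linarith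
  show ?thesis unfolding r1 r0 r_def[symmetric] g Ht
    by (simp add: inner_diff_left inner_add_right inner_add_left inner_diff_right inner_commute) (simp add: algebra_simps)
qed

text \<open>
  The negative of the derivative with respect to the density, at fixed momentum, of the energy
  \<open>norm (hu)\<^sup>2 / (2 * h) + \<kappa> / (\<gamma> - 1) * h powr \<gamma>\<close>. It is the test function that the relative energy requires in the
  mass balance, and it is only Lipschitz because \<open>H\<close> is.
\<close>

definition energy_variable ::
  "real \<Rightarrow> real \<Rightarrow> (real \<times> (real^'n) \<Rightarrow> real) \<Rightarrow> (real \<times> (real^'n) \<Rightarrow> real^'n) \<Rightarrow> real \<times> (real^'n) \<Rightarrow> real" where
  "energy_variable \<kappa> \<gamma> H U w = 1/2 * (norm (U w))\<^sup>2 - \<kappa> * \<gamma> / (\<gamma> - 1) * H w powr (\<gamma> - 1)"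

text \<open>
  A point at which \<open>H\<close> and \<open>U\<close> are differentiable; every composite field in the equations is differentiated
  here by the chain and product rules.
\<close>

locale derivative_point =
  fixes T \<kappa> \<gamma> :: real and H :: "real \<times> (real^'n) \<Rightarrow> real" and U :: "real \<times> (real^'n) \<Rightarrow> real^'n"
    and z DH DU
  assumes T: "0 < T" and z: "z \<in> slab T" and Hpos: "0 < H z" and \<gamma>: "1 < \<gamma>"
    and DH: "(H has_derivative DH) (at z within slab T)"
    and DU: "(U has_derivative DU) (at z within slab T)"
begin

lemma DUi: "((\<lambda>w. U w $ i) has_derivative (\<lambda>v. DU v $ i)) (at z within slab T)"
  using has_derivative_inner_right[OF DU, of "axis i 1"] by (simp add: inner_axis')

lemma Ut: "dt T U z = DU (1, 0)" by (rule dt_eq(1)[OF T z DU])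
lemma Ht: "dt T H z = DH (1, 0)" by (rule dt_eq(1)[OF T z DH])
lemma Hx: "grad_x H z \<bullet> v = DH (0, v)" by (rule grad_x_inner[OF z DH])
lemma Hj: "grad_x H z $ j = DH (0, axis j 1)" by (simp add: grad_x_def dx_eq(1)[OF z DH])
lemma Jij: "jac_x U z $ i $ j = DU (0, axis j 1) $ i" by (simp add: jac_x_def dx_eq(1)[OF z DUi])
lemma div: "div_x U z = (\<Sum>j\<in>UNIV. jac_x U z $ j $ j)" by (simp add: div_x_def jac_x_def)

lemma J: "jac_x U z *v v = DU (0, v)"
proof (rule vec_eq_iff[THEN iffD2], rule allI)
  fix i
  have "(jac_x U z *v v) $ i = grad_x (\<lambda>w. U w $ i) z \<bullet> v"
    by (simp add: matrix_vector_mult_def jac_x_def grad_x_def inner_vec_def)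
  also have "\<dots> = DU (0, v) $ i" by (rule grad_x_inner[OF z DUi])
  finally show "(jac_x U z *v v) $ i = DU (0, v) $ i" .
qed

lemma Dpowr: "((\<lambda>w. H w powr s) has_derivative (\<lambda>v. s * H z powr (s - 1) * DH v)) (at z within slab T)"
proof -
  have "((\<lambda>x. x powr s) has_real_derivative s * H z powr (s - 1)) (at (H z))"
    using Hpos by (auto intro!: derivative_eq_intros)
  from has_derivative_compose[OF DH this[unfolded has_field_derivative_def]] show ?thesis .
qed

lemma D\<psi>: "(energy_variable \<kappa> \<gamma> H U has_derivative (\<lambda>v. U z \<bullet> DU v - \<kappa> * \<gamma> * H z powr (\<gamma> - 2) * DH v)) (at z within slab T)"
proof -
  have "((\<lambda>w. 1/2 * (U w \<bullet> U w) - \<kappa> * \<gamma> / (\<gamma> - 1) * H w powr (\<gamma> - 1)) has_derivative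
      (\<lambda>v. 1/2 * (U z \<bullet> DU v + DU v \<bullet> U z) - \<kappa> * \<gamma> / (\<gamma> - 1) * ((\<gamma> - 1) * H z powr (\<gamma> - 1 - 1) * DH v))) (at z within slab T)"
    by (intro derivative_intros Dpowr DU)
  moreover have "energy_variable \<kappa> \<gamma> H U = (\<lambda>w. 1/2 * (U w \<bullet> U w) - \<kappa> * \<gamma> / (\<gamma> - 1) * H w powr (\<gamma> - 1))"
    by (auto simp: energy_variable_def power2_norm_eq_inner)
  ultimately show ?thesis using \<gamma> by (simp add: inner_commute mult.assoc)
qed

lemma \<psi>t: "dt T (energy_variable \<kappa> \<gamma> H U) z = U z \<bullet> dt T U z - \<kappa> * \<gamma> * H z powr (\<gamma> - 2) * dt T H z"
  using dt_eq(1)[OF T z D\<psi>] by (simp add: Ut Ht)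

lemma \<psi>x: "grad_x (energy_variable \<kappa> \<gamma> H U) z = U z v* jac_x U z - (\<kappa> * \<gamma> * H z powr (\<gamma> - 2)) *\<^sub>R grad_x H z"
proof (rule vec_eq_iff[THEN iffD2], rule allI)
  fix j
  have "grad_x (energy_variable \<kappa> \<gamma> H U) z $ j = U z \<bullet> DU (0, axis j 1) - \<kappa> * \<gamma> * H z powr (\<gamma> - 2) * DH (0, axis j 1)"
    by (simp add: grad_x_def dx_eq(1)[OF z D\<psi>])
  then show "grad_x (energy_variable \<kappa> \<gamma> H U) z $ j = (U z v* jac_x U z - (\<kappa> * \<gamma> * H z powr (\<gamma> - 2)) *\<^sub>R grad_x H z) $ j"
    by (simp add: Hj vector_matrix_mult_def Jij inner_vec_def mult.commute)
qed

lemma DF: "((\<lambda>w. \<kappa> * H w powr \<gamma>) has_derivative (\<lambda>v. \<kappa> * \<gamma> * H z powr (\<gamma> - 1) * DH v)) (at z within slab T)"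
  using has_derivative_mult_right[OF Dpowr[of \<gamma>], of \<kappa>] by (simp add: mult_ac)

lemma Ft: "dt T (\<lambda>w. \<kappa> * H w powr \<gamma>) z = \<kappa> * \<gamma> * H z powr (\<gamma> - 1) * dt T H z"
  using dt_eq(1)[OF T z DF] by (simp add: Ht)

lemma Fx: "grad_x (\<lambda>w. \<kappa> * H w powr \<gamma>) z = (\<kappa> * \<gamma> * H z powr (\<gamma> - 1)) *\<^sub>R grad_x H z"
  by (rule vec_eq_iff[THEN iffD2], rule allI) (simp add: Hj, simp add: grad_x_def dx_eq(1)[OF z DF])

lemma DFU: "((\<lambda>w. \<kappa> * H w powr \<gamma> * U w $ j) has_derivative
    (\<lambda>v. \<kappa> * H z powr \<gamma> * DU v $ j + \<kappa> * \<gamma> * H z powr (\<gamma> - 1) * DH v * U z $ j)) (at z within slab T)"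
  by (rule has_derivative_mult[OF DF DUi])

lemma divFU: "(\<Sum>j\<in>UNIV. dx j (\<lambda>w. \<kappa> * H w powr \<gamma> * U w $ j) z) =
    \<kappa> * \<gamma> * H z powr (\<gamma> - 1) * (grad_x H z \<bullet> U z) + \<kappa> * H z powr \<gamma> * div_x U z"
  unfolding dx_eq(1)[OF z DFU]
  by (simp add: sum.distrib div Jij inner_vec_def Hj sum_distrib_left mult_ac)

lemma mass_eq: "div_x (\<lambda>w. H w *\<^sub>R U w) z = grad_x H z \<bullet> U z + H z * div_x U z"
proof -
  have d: "((\<lambda>w. (H w *\<^sub>R U w) $ j) has_derivative (\<lambda>v. H z * DU v $ j + DH v * U z $ j)) (at z within slab T)" for j
    using has_derivative_mult[OF DH DUi] by simp
  show ?thesis unfolding div_x_def[of "\<lambda>w. H w *\<^sub>R U w"] dx_eq(1)[OF z d]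
    by (simp add: sum.distrib div Jij inner_vec_def Hj sum_distrib_left mult_ac)
qed

lemma mom_t: "dt T (\<lambda>w. H w *\<^sub>R U w) z = dt T H z *\<^sub>R U z + H z *\<^sub>R dt T U z"
  using dt_eq(1)[OF T z has_derivative_scaleR[OF DH DU]] by (simp add: Ut Ht)

lemma mom_Div: "Div_x (\<lambda>w. H w *\<^sub>R outer (U w) (U w)) z
    = (grad_x H z \<bullet> U z) *\<^sub>R U z + H z *\<^sub>R (jac_x U z *v U z) + (H z * div_x U z) *\<^sub>R U z"
proof (rule vec_eq_iff[THEN iffD2], rule allI)
  fix i
  have d: "((\<lambda>w. (H w *\<^sub>R outer (U w) (U w)) $ i $ j) has_derivative
     (\<lambda>v. H z * (U z $ i * DU v $ j + DU v $ i * U z $ j) + DH v * (U z $ i * U z $ j))) (at z within slab T)" for j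
    using has_derivative_mult[OF DH has_derivative_mult[OF DUi DUi]] by (simp add: outer_def)
  have "Div_x (\<lambda>w. H w *\<^sub>R outer (U w) (U w)) z $ i = (\<Sum>j\<in>UNIV. H z * (U z $ i * DU (0, axis j 1) $ j + DU (0, axis j 1) $ i * U z $ j) + DH (0, axis j 1) * (U z $ i * U z $ j))"
    unfolding Div_x_def div_x_def by (simp only: vec_lambda_beta dx_eq(1)[OF z d])
  then show "Div_x (\<lambda>w. H w *\<^sub>R outer (U w) (U w)) z $ i =
      ((grad_x H z \<bullet> U z) *\<^sub>R U z + H z *\<^sub>R (jac_x U z *v U z) + (H z * div_x U z) *\<^sub>R U z) $ i"
    by (simp add: sum.distrib div Jij inner_vec_def Hj sum_distrib_left sum_distrib_right matrix_vector_mult_def algebra_simps)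
qed

end

section \<open>Lipschitz test functions and the concentration measure\<close>

lemma lipschitz_torus_continuous: "lipschitz_torus T f \<Longrightarrow> continuous_on (slab T) f"
  unfolding lipschitz_torus_def by (auto intro: lipschitz_on_continuous_on)

lemma lipschitz_torus_bounded:
  assumes "lipschitz_torus T f"
  obtains B where "0 < B" "\<And>z. z \<in> slab T \<Longrightarrow> \<bar>f z\<bar> \<le> B"
  using periodic_bounded[OF _ lipschitz_torus_continuous[OF assms]] assms
  unfolding lipschitz_torus_def real_norm_def by metis

lemma lipschitz_torus_const: "lipschitz_torus T (\<lambda>_. k)"
  unfolding lipschitz_torus_def periodic_x_def using lipschitz_on_constant by blast

lemma lipschitz_torus_add:
  assumes "lipschitz_torus T f" "lipschitz_torus T g"
  shows "lipschitz_torus T (\<lambda>z. f z + g z)"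
proof -
  obtain L M where "L-lipschitz_on (slab T) f" "M-lipschitz_on (slab T) g"
    using assms unfolding lipschitz_torus_def by blast
  then have "(L + M)-lipschitz_on (slab T) (\<lambda>z. f z + g z)" by (rule lipschitz_on_add)
  then show ?thesis using assms unfolding lipschitz_torus_def periodic_x_def by auto
qed

lemma lipschitz_torus_mult:
  assumes f: "lipschitz_torus T f" and g: "lipschitz_torus T g"
  shows "lipschitz_torus T (\<lambda>z. f z * g z)"
proof -
  obtain A B where A: "0 < A" "\<And>z. z \<in> slab T \<Longrightarrow> \<bar>f z\<bar> \<le> A" and B: "0 < B" "\<And>z. z \<in> slab T \<Longrightarrow> \<bar>g z\<bar> \<le> B"
    using lipschitz_torus_bounded f g by metis
  obtain L M where L: "L-lipschitz_on (slab T) f" and M: "M-lipschitz_on (slab T) g"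
    using f g unfolding lipschitz_torus_def by blast
  have "(A * M + B * L)-lipschitz_on (slab T) (\<lambda>z. f z * g z)"
  proof (rule lipschitz_onI)
    fix z w :: "real \<times> (real^'a)" assume z: "z \<in> slab T" "w \<in> slab T"
    have "\<bar>f z * g z - f w * g w\<bar> = \<bar>f z * (g z - g w) + g w * (f z - f w)\<bar>" by (simp add: algebra_simps)
    also have "\<dots> \<le> \<bar>f z\<bar> * \<bar>g z - g w\<bar> + \<bar>g w\<bar> * \<bar>f z - f w\<bar>"
      by (metis abs_mult abs_triangle_ineq)
    also have "\<dots> \<le> A * (M * dist z w) + B * (L * dist z w)"
      using lipschitz_onD[OF L z] lipschitz_onD[OF M z] z A B
      by (intro add_mono mult_mono) (auto simp: dist_real_def)
    finally show "dist (f z * g z) (f w * g w) \<le> (A * M + B * L) * dist z w"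
      by (simp add: dist_real_def algebra_simps)
  qed (use A B lipschitz_on_nonneg[OF L] lipschitz_on_nonneg[OF M] in auto)
  then show ?thesis using f g unfolding lipschitz_torus_def periodic_x_def by auto
qed

lemma lipschitz_torus_sum:
  "finite I \<Longrightarrow> (\<And>i. i \<in> I \<Longrightarrow> lipschitz_torus T (f i)) \<Longrightarrow> lipschitz_torus T (\<lambda>z. \<Sum>i\<in>I. f i z)"
  by (induction I rule: finite_induct) (auto simp: lipschitz_torus_const intro: lipschitz_torus_add)

lemma lipschitz_on_powr:
  assumes "0 < c"
  obtains L where "L-lipschitz_on {c..M} (\<lambda>x::real. x powr s)"
proof -
  have "compact ((\<lambda>x. s * x powr (s - 1)) ` {c..M})"
    using assms by (intro compact_continuous_image continuous_intros) auto
  then have "bounded ((\<lambda>x. s * x powr (s - 1)) ` {c..M})" by (rule compact_imp_bounded)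
  then obtain L where L: "0 < L" "\<forall>y\<in>(\<lambda>x. s * x powr (s - 1)) ` {c..M}. norm y \<le> L"
    unfolding bounded_pos by blast
  then have L2: "\<bar>s * x powr (s - 1)\<bar> \<le> L" if "x \<in> {c..M}" for x
  proof -
    have "s * x powr (s - 1) \<in> (\<lambda>x. s * x powr (s - 1)) ` {c..M}" using that by (rule imageI)
    then show ?thesis using L(2) by (metis real_norm_def)
  qed
  have "L-lipschitz_on {c..M} (\<lambda>x. x powr s)"
  proof (rule bounded_derivative_imp_lipschitz)
    fix x assume x: "x \<in> {c..M}"
    have "((\<lambda>x. x powr s) has_real_derivative s * x powr (s - 1)) (at x within {c..M})"
      using x assms by (auto intro!: derivative_eq_intros)
    then show "((\<lambda>x. x powr s) has_derivative (*) (s * x powr (s - 1))) (at x within {c..M})"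
      by (simp add: has_field_derivative_def)
    show "onorm ((*) (s * x powr (s - 1))) \<le> L"
    proof (rule onorm_le)
      fix y show "norm (s * x powr (s - 1) * y) \<le> L * norm y"
        using mult_right_mono[OF L2[OF x], of "norm y"] by (simp add: abs_mult)
    qed
  qed (use L in auto)
  with that show ?thesis .
qed

lemma lipschitz_torus_powr:
  assumes H: "lipschitz_torus T H" and c: "0 < c" "\<And>z. z \<in> slab T \<Longrightarrow> c \<le> H z"
  shows "lipschitz_torus T (\<lambda>z. H z powr s)"
proof -
  obtain M where M: "\<And>z. z \<in> slab T \<Longrightarrow> \<bar>H z\<bar> \<le> M" using lipschitz_torus_bounded[OF H] by metis
  obtain L where L: "L-lipschitz_on {c..M} (\<lambda>x::real. x powr s)" using lipschitz_on_powr[OF c(1)] by blast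
  obtain L' where L': "L'-lipschitz_on (slab T) H" using H unfolding lipschitz_torus_def by blast
  have "(L * L')-lipschitz_on (slab T) (\<lambda>z. H z powr s)"
    by (rule lipschitz_on_compose2[OF L' lipschitz_on_subset[OF L]]) (use c M abs_le_D1 in fastforce)
  then show ?thesis using H unfolding lipschitz_torus_def periodic_x_def by auto
qed

lemma C1_torus_lipschitz_torus:
  "C1_torus T f \<Longrightarrow> 0 < T \<Longrightarrow> lipschitz_torus T f"
  using C1_torus_lipschitz unfolding lipschitz_torus_def C1_torus_def by metis

lemma lipschitz_torus_energy_variable:
  fixes U :: "real \<times> (real^'n) \<Rightarrow> real^'n"
  assumes "lipschitz_torus T H" "0 < c" "\<And>z. z \<in> slab T \<Longrightarrow> c \<le> H z" "C1_torus T U" "0 < T"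
  shows "lipschitz_torus T (energy_variable \<kappa> \<gamma> H U)"
proof -
  have U: "lipschitz_torus T (\<lambda>z. U z $ i)" for i
    using C1_torus_lipschitz_torus[OF C1_torus_component[OF assms(4)] assms(5)] .
  have "lipschitz_torus T (\<lambda>z. 1/2 * (\<Sum>i\<in>UNIV. U z $ i * U z $ i) + (- \<kappa> * \<gamma> / (\<gamma> - 1)) * H z powr (\<gamma> - 1))"
    by (intro lipschitz_torus_add lipschitz_torus_mult lipschitz_torus_sum lipschitz_torus_const U
        lipschitz_torus_powr[OF assms(1-3)]) auto
  then show ?thesis
    by (rule back_subst[of "lipschitz_torus T"])
       (simp add: energy_variable_def fun_eq_iff power2_norm_eq_inner inner_vec_def)
qed

text \<open>
  Time slices are hyperplanes. This removes the end points of the time interval, at which mollified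
  derivatives need not converge.
\<close>

lemma AE_fst_neq:
  fixes S :: "(real \<times> 'a::euclidean_space) set"
  assumes "S \<in> sets lebesgue"
  shows "AE z in lebesgue_on S. fst z \<noteq> a"
proof -
  have "negligible {z :: real \<times> 'a. (1, 0) \<bullet> z = a}" by (rule negligible_hyperplane) (simp add: zero_prod_def)
  then have "{z :: real \<times> 'a. (1, 0) \<bullet> z = a} \<in> null_sets lebesgue" by (simp add: negligible_iff_null_sets)
  then have "AE z in lebesgue. z \<notin> {z :: real \<times> 'a. (1, 0) \<bullet> z = a}" by (rule AE_not_in)
  then have "AE z in lebesgue. fst (z :: real \<times> 'a) \<noteq> a" by (simp add: inner_prod_def)
  then show ?thesis using assms by (auto simp: AE_restrict_space_iff)
qed

text \<open>
  The mass balance contains no concentration measure, only functions integrated against Lebesgue measure.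
  Almost everywhere convergence and a uniform bound of the mollified derivatives therefore suffice for
  dominated convergence.
\<close>

lemma mass_balance_lipschitz:
  fixes h0 :: "real^'n \<Rightarrow> real" and h :: "real \<times> (real^'n) \<Rightarrow> real" and P :: "real \<times> (real^'n) \<Rightarrow> real^'n"
  assumes T: "0 < T" and \<tau>: "0 \<le> \<tau>" "\<tau> < T"
    and h: "integrable (lebesgue_on (cyl \<tau>)) h" and P: "integrable (lebesgue_on (cyl \<tau>)) P"
    and h\<tau>: "integrable (lebesgue_on cell) (\<lambda>x. h (\<tau>, x))" and h0: "integrable (lebesgue_on cell) h0"
    and bal: "\<And>\<psi>. C1_torus T \<psi> \<Longrightarrow>
      (\<integral>z. dt T \<psi> z * h z + grad_x \<psi> z \<bullet> P z \<partial>lebesgue_on (cyl \<tau>)) +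
      (\<integral>x. \<psi> (0, x) * h0 x - \<psi> (\<tau>, x) * h (\<tau>, x) \<partial>lebesgue_on cell) = 0"
    and \<psi>: "lipschitz_torus T \<psi>"
    and ae: "AE z in lebesgue_on (cyl T). \<psi> differentiable (at z within slab T)"
  shows "integrable (lebesgue_on (cyl \<tau>)) (\<lambda>z. dt T \<psi> z * h z + grad_x \<psi> z \<bullet> P z)"
    and "(\<integral>z. dt T \<psi> z * h z + grad_x \<psi> z \<bullet> P z \<partial>lebesgue_on (cyl \<tau>)) +
      (\<integral>x. \<psi> (0, x) * h0 x - \<psi> (\<tau>, x) * h (\<tau>, x) \<partial>lebesgue_on cell) = 0"
proof -
  obtain L where L: "L-lipschitz_on (slab T) \<psi>" and per: "periodic_x T \<psi>"
    using \<psi> unfolding lipschitz_torus_def by blast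
  have L0: "0 \<le> L" using L by (rule lipschitz_on_nonneg)
  obtain \<Psi> where \<Psi>: "\<forall>k::nat. C1_torus T (\<Psi> k)"
    "\<forall>k. \<forall>z\<in>slab T. \<bar>\<Psi> k z - \<psi> z\<bar> \<le> L * (1 / real (Suc k)) \<and>
       \<bar>dt T (\<Psi> k) z\<bar> \<le> L \<and> (\<forall>j. \<bar>dx j (\<Psi> k) z\<bar> \<le> L)"
    "\<forall>z\<in>slab T. 0 < fst z \<longrightarrow> fst z < T \<longrightarrow> \<psi> differentiable (at z within slab T) \<longrightarrow>
       (\<lambda>k. dt T (\<Psi> k) z) \<longlonglongrightarrow> dt T \<psi> z \<and> (\<forall>j. (\<lambda>k. dx j (\<Psi> k) z) \<longlonglongrightarrow> dx j \<psi> z)"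
    using lipschitz_torus_approximation[OF T L per] by (elim exE conjE)
  have C1: "\<And>k. C1_torus T (\<Psi> k)"
    and close: "\<And>k z. z \<in> slab T \<Longrightarrow> \<bar>\<Psi> k z - \<psi> z\<bar> \<le> L * (1 / real (Suc k))"
    and bt: "\<And>k z. z \<in> slab T \<Longrightarrow> \<bar>dt T (\<Psi> k) z\<bar> \<le> L"
    and bx: "\<And>k z j. z \<in> slab T \<Longrightarrow> \<bar>dx j (\<Psi> k) z\<bar> \<le> L"
    and lt: "\<And>z. z \<in> slab T \<Longrightarrow> 0 < fst z \<Longrightarrow> fst z < T \<Longrightarrow> \<psi> differentiable (at z within slab T) \<Longrightarrow>
       (\<lambda>k. dt T (\<Psi> k) z) \<longlonglongrightarrow> dt T \<psi> z"
    and lx: "\<And>z j. z \<in> slab T \<Longrightarrow> 0 < fst z \<Longrightarrow> fst z < T \<Longrightarrow> \<psi> differentiable (at z within slab T) \<Longrightarrow>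
       (\<lambda>k. dx j (\<Psi> k) z) \<longlonglongrightarrow> dx j \<psi> z"
    using \<Psi> by blast+
  define f where "f k z = dt T (\<Psi> k) z * h z + grad_x (\<Psi> k) z \<bullet> P z" for k z
  define w where "w z = L * \<bar>h z\<bar> + (\<Sum>j\<in>UNIV. L * \<bar>P z $ j\<bar>)" for z
  have Pj: "integrable (lebesgue_on (cyl \<tau>)) (\<lambda>z. P z $ j)" for j
    using integrable_inner_right[of "axis j 1", OF P] by (simp add: inner_axis')
  have wi: "integrable (lebesgue_on (cyl \<tau>)) w"
    unfolding w_def using h Pj by (intro Bochner_Integration.integrable_add integrable_mult_right
        Bochner_Integration.integrable_sum integrable_abs) auto
  have fe: "f k z = dt T (\<Psi> k) z * h z + (\<Sum>j\<in>UNIV. dx j (\<Psi> k) z * P z $ j)" for k z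
    by (simp add: f_def grad_x_def inner_vec_def)
  have fm: "f k \<in> borel_measurable (lebesgue_on (cyl \<tau>))" for k
  proof -
    have [measurable]: "dt T (\<Psi> k) \<in> borel_measurable (lebesgue_on (cyl \<tau>))"
      "dx j (\<Psi> k) \<in> borel_measurable (lebesgue_on (cyl \<tau>))" for j
      using \<tau> by (auto intro!: continuous_slab_measurable[of T] C1_torus_dt_continuous C1_torus_dx_continuous C1 T)
    have [measurable]: "h \<in> borel_measurable (lebesgue_on (cyl \<tau>))"
      "(\<lambda>z. P z $ j) \<in> borel_measurable (lebesgue_on (cyl \<tau>))" for j
      using h Pj[of j] by auto
    show ?thesis unfolding fe[abs_def] by measurable
  qed
  have fb: "AE z in lebesgue_on (cyl \<tau>). norm (f k z) \<le> w z" for k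
  proof (rule AE_I2)
    fix z :: "real \<times> (real^'n)" assume "z \<in> space (lebesgue_on (cyl \<tau>))"
    then have z: "z \<in> slab T" using \<tau> by (auto simp: cyl_def)
    have "\<bar>f k z\<bar> \<le> \<bar>dt T (\<Psi> k) z * h z\<bar> + (\<Sum>j\<in>UNIV. \<bar>dx j (\<Psi> k) z * P z $ j\<bar>)"
      unfolding fe by (rule order_trans[OF abs_triangle_ineq]) (intro add_left_mono sum_abs)
    also have "\<dots> \<le> w z"
      unfolding w_def abs_mult using bt[OF z] bx[OF z]
      by (intro add_mono sum_mono mult_right_mono) auto
    finally show "norm (f k z) \<le> w z" by simp
  qed
  have flim: "AE z in lebesgue_on (cyl \<tau>). (\<lambda>k. f k z) \<longlonglongrightarrow> dt T \<psi> z * h z + grad_x \<psi> z \<bullet> P z"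
  proof -
    have "AE z in lebesgue_on (cyl \<tau>). \<psi> differentiable (at z within slab T)"
      using ae cyl_mono[of \<tau> T] \<tau> by (intro AE_lebesgue_on_subset[OF ae]) auto
    moreover have "AE z :: real \<times> (real^'n) in lebesgue_on (cyl \<tau>). fst z \<noteq> 0" by (rule AE_fst_neq) simp
    ultimately show ?thesis using AE_space
    proof eventually_elim
      case (elim z)
      then have z: "z \<in> slab T" "0 < fst z" "fst z < T" "\<psi> differentiable (at z within slab T)"
        using \<tau> by (auto simp: cyl_def)
      show ?case unfolding fe by (simp add: grad_x_def inner_vec_def) (intro tendsto_intros lt lx z)
    qed
  qed
  have gm: "(\<lambda>z. dt T \<psi> z * h z + grad_x \<psi> z \<bullet> P z) \<in> borel_measurable (lebesgue_on (cyl \<tau>))"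
    by (rule AE_limit_measurable_lebesgue_on[OF cyl_borel fm flim])
  show "integrable (lebesgue_on (cyl \<tau>)) (\<lambda>z. dt T \<psi> z * h z + grad_x \<psi> z \<bullet> P z)"
    by (rule integrable_dominated_convergence[OF gm fm wi flim fb])
  have 1: "(\<lambda>k. \<integral>z. f k z \<partial>lebesgue_on (cyl \<tau>)) \<longlonglongrightarrow>
      (\<integral>z. dt T \<psi> z * h z + grad_x \<psi> z \<bullet> P z \<partial>lebesgue_on (cyl \<tau>))"
    by (rule integral_dominated_convergence[OF gm fm wi flim fb])
  have sec: "(\<lambda>x. F (t, x)) \<in> borel_measurable (lebesgue_on cell)"
    if "continuous_on (slab T) F" "t \<in> {0..T}" for F :: "real \<times> (real^'n) \<Rightarrow> real" and t
    using continuous_cell_measurable[OF continuous_slab_section[OF that]] .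
  have cont: "continuous_on (slab T) (\<Psi> k)" "continuous_on (slab T) \<psi>" for k
    using C1_torus_continuous[OF C1] lipschitz_on_continuous_on[OF L] by auto
  have t: "0 \<in> {0..T}" "\<tau> \<in> {0..T}" using \<tau> by auto
  have \<Psi>lim: "(\<lambda>k. \<Psi> k z) \<longlonglongrightarrow> \<psi> z" if z: "z \<in> slab T" for z
  proof -
    have "(\<lambda>k. L * (1 / real (Suc k))) \<longlonglongrightarrow> L * 0"
      using LIMSEQ_inverse_real_of_nat by (intro tendsto_mult_left) (simp add: inverse_eq_divide)
    then have lim0: "(\<lambda>k. L * (1 / real (Suc k))) \<longlonglongrightarrow> 0" by simp
    have "(\<lambda>k. \<Psi> k z - \<psi> z) \<longlonglongrightarrow> 0"
    proof (rule Lim_null_comparison[OF _ lim0])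
      show "\<forall>\<^sub>F k in sequentially. norm (\<Psi> k z - \<psi> z) \<le> L * (1 / real (Suc k))"
        unfolding real_norm_def by (intro always_eventually allI close z)
    qed
    then show ?thesis by (simp add: LIM_zero_iff)
  qed
  obtain B where B: "\<And>z. z \<in> slab T \<Longrightarrow> \<bar>\<psi> z\<bar> \<le> B" using lipschitz_torus_bounded[OF \<psi>] by metis
  have \<Psi>B: "\<bar>\<Psi> k z\<bar> \<le> B + L" if z: "z \<in> slab T" for k z
  proof -
    have "L * (1 / real (Suc k)) \<le> L * 1" using L0 by (intro mult_left_mono) auto
    then show ?thesis using close[OF z, of k] B[OF z] by linarith
  qed
  have 2: "(\<lambda>k. \<integral>x. \<Psi> k (0, x) * h0 x - \<Psi> k (\<tau>, x) * h (\<tau>, x) \<partial>lebesgue_on cell) \<longlonglongrightarrow>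
     (\<integral>x. \<psi> (0, x) * h0 x - \<psi> (\<tau>, x) * h (\<tau>, x) \<partial>lebesgue_on cell)"
  proof (rule integral_dominated_convergence[where w = "\<lambda>x. (B + L) * \<bar>h0 x\<bar> + (B + L) * \<bar>h (\<tau>, x)\<bar>"])
    show "(\<lambda>x. \<psi> (0, x) * h0 x - \<psi> (\<tau>, x) * h (\<tau>, x)) \<in> borel_measurable (lebesgue_on cell)"
      "(\<lambda>x. \<Psi> k (0, x) * h0 x - \<Psi> k (\<tau>, x) * h (\<tau>, x)) \<in> borel_measurable (lebesgue_on cell)" for k
      using h0 h\<tau> sec[OF cont(2) t(1)] sec[OF cont(2) t(2)] sec[OF cont(1) t(1)] sec[OF cont(1) t(2)] by auto
    show "integrable (lebesgue_on cell) (\<lambda>x. (B + L) * \<bar>h0 x\<bar> + (B + L) * \<bar>h (\<tau>, x)\<bar>)" using h0 h\<tau> by auto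
    show "AE x in lebesgue_on cell. (\<lambda>k. \<Psi> k (0, x) * h0 x - \<Psi> k (\<tau>, x) * h (\<tau>, x)) \<longlonglongrightarrow>
        \<psi> (0, x) * h0 x - \<psi> (\<tau>, x) * h (\<tau>, x)"
      using t by (intro AE_I2 tendsto_intros \<Psi>lim) auto
    show "AE x in lebesgue_on cell. norm (\<Psi> k (0, x) * h0 x - \<Psi> k (\<tau>, x) * h (\<tau>, x)) \<le> (B + L) * \<bar>h0 x\<bar> + (B + L) * \<bar>h (\<tau>, x)\<bar>" for k
    proof (rule AE_I2)
      fix x :: "real^'n"
      have "\<bar>\<Psi> k (0, x) * h0 x\<bar> \<le> (B + L) * \<bar>h0 x\<bar>" "\<bar>\<Psi> k (\<tau>, x) * h (\<tau>, x)\<bar> \<le> (B + L) * \<bar>h (\<tau>, x)\<bar>"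
        unfolding abs_mult using t by (auto intro!: mult_right_mono \<Psi>B)
      then show "norm (\<Psi> k (0, x) * h0 x - \<Psi> k (\<tau>, x) * h (\<tau>, x)) \<le> (B + L) * \<bar>h0 x\<bar> + (B + L) * \<bar>h (\<tau>, x)\<bar>"
        unfolding real_norm_def by linarith
    qed
  qed
  have "(\<lambda>k. (\<integral>z. f k z \<partial>lebesgue_on (cyl \<tau>)) +
      (\<integral>x. \<Psi> k (0, x) * h0 x - \<Psi> k (\<tau>, x) * h (\<tau>, x) \<partial>lebesgue_on cell)) = (\<lambda>k. 0)"
    using bal[OF C1] by (simp add: f_def fun_eq_iff)
  then show "(\<integral>z. dt T \<psi> z * h z + grad_x \<psi> z \<bullet> P z \<partial>lebesgue_on (cyl \<tau>)) +
      (\<integral>x. \<psi> (0, x) * h0 x - \<psi> (\<tau>, x) * h (\<tau>, x) \<partial>lebesgue_on cell) = 0"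
    using LIMSEQ_unique[OF tendsto_add[OF 1 2]] by simp
qed

lemma Linf_w_prob:
  assumes "\<nu> \<in> Linf_w M X" "z \<in> space M"
  shows "prob_space (\<nu> z)" "sets (\<nu> z) = sets (restrict_space borel X)" "space (\<nu> z) = X"
  using assms sets_eq_imp_space_eq[of "\<nu> z" "restrict_space borel X"]
  by (auto simp: Linf_w_def space_prob_algebra space_restrict_space)

lemma sphere_moment_bound:
  fixes J :: "real^'n^'n"
  assumes \<nu>: "prob_space \<nu>" "space \<nu> = sphere_plus \<gamma>"
  shows "\<bar>J \<bullet> integral\<^sup>L \<nu> convection\<bar> \<le> norm J" and "\<bar>\<delta> * integral\<^sup>L \<nu> (h_power \<gamma> :: real \<times> (real^'n) \<Rightarrow> real)\<bar> \<le> \<bar>\<delta>\<bar>"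
proof -
  interpret prob_space \<nu> by fact
  show "\<bar>J \<bullet> integral\<^sup>L \<nu> convection\<bar> \<le> norm J"
  proof (cases "integrable \<nu> (convection :: real \<times> (real^'n) \<Rightarrow> real^'n^'n)")
    case True
    have "norm (integral\<^sup>L \<nu> (convection :: real \<times> (real^'n) \<Rightarrow> real^'n^'n)) \<le> (\<integral>l. norm (convection l :: real^'n^'n) \<partial>\<nu>)"
      by (rule integral_norm_bound)
    also have "\<dots> \<le> (\<integral>l. 1 \<partial>\<nu>)"
      using True sphere_plus_bounds(3)[of _ _ \<gamma>] \<nu>(2)
      by (intro integral_mono) (auto simp: convection_def norm_outer power2_eq_square)
    finally have "norm (integral\<^sup>L \<nu> (convection :: real \<times> (real^'n) \<Rightarrow> real^'n^'n)) \<le> 1" by (simp add: prob_space)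
    then show ?thesis
      using Cauchy_Schwarz_ineq2[of J "integral\<^sup>L \<nu> convection"]
        mult_left_mono[of "norm (integral\<^sup>L \<nu> convection)" 1 "norm J"] by simp
  qed (simp add: not_integrable_integral_eq)
  have "\<bar>integral\<^sup>L \<nu> (h_power \<gamma> :: real \<times> (real^'n) \<Rightarrow> real)\<bar> \<le> 1 * measure \<nu> (space \<nu>)"
    using sphere_plus_bounds(2)[of _ _ \<gamma>] \<nu>(2)
    by (intro abs_integral_le_bound finite_measure_axioms) (auto simp: h_power_def)
  then show "\<bar>\<delta> * integral\<^sup>L \<nu> (h_power \<gamma> :: real \<times> (real^'n) \<Rightarrow> real)\<bar> \<le> \<bar>\<delta>\<bar>"
    unfolding abs_mult prob_space by (simp add: mult_left_le)
qed

text \<open>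
  The energy is bounded below by a positive constant on the sphere of directions; hence the total mass of the
  concentration measure is controlled by its energy.
\<close>

lemma sphere_energy_bound:
  fixes \<nu> :: "(real \<times> (real^'n)) measure"
  assumes \<nu>: "prob_space \<nu>" "space \<nu> = sphere_plus \<gamma>" and "1 < \<gamma>" "0 < \<kappa>"
  shows "ennreal (min (1/2) (\<kappa> / (\<gamma> - 1))) \<le> (\<integral>\<^sup>+l. energy_density \<kappa> \<gamma> l \<partial>\<nu>)"
proof -
  interpret prob_space \<nu> by fact
  let ?c = "min (1/2) (\<kappa> / (\<gamma> - 1))"
  have "ennreal ?c = (\<integral>\<^sup>+l. ennreal ?c \<partial>\<nu>)" by (simp add: emeasure_space_1)
  also have "\<dots> \<le> (\<integral>\<^sup>+l. energy_density \<kappa> \<gamma> l \<partial>\<nu>)"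
  proof (rule nn_integral_mono)
    fix l assume "l \<in> space \<nu>"
    then obtain b1 b' where l: "l = (b1, b')" "(b1, b') \<in> sphere_plus \<gamma>" using \<nu>(2) by (cases l) auto
    have c0: "0 \<le> ?c" using assms by simp
    have "?c * 1 \<le> ?c * ((norm b')\<^sup>2 + b1 powr \<gamma>)" using sphere_plus_bounds(4)[OF l(2)] c0 by (intro mult_left_mono)
    also have "\<dots> \<le> 1/2 * (norm b')\<^sup>2 + \<kappa> / (\<gamma> - 1) * b1 powr \<gamma>"
      unfolding distrib_left by (intro add_mono mult_right_mono min.cobounded1 min.cobounded2) auto
    finally show "ennreal ?c \<le> energy_density \<kappa> \<gamma> l" by (simp add: l energy_density_def ennreal_leI)
  qed
  finally show ?thesis .
qed

section \<open>The relative energy inequality\<close>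

lemma integrable_lebesgue_on_subset:
  fixes f :: "'a::euclidean_space \<Rightarrow> 'b::{banach, second_countable_topology}"
  assumes "integrable (lebesgue_on S) f" "A \<subseteq> S" "A \<in> sets lebesgue" "S \<in> sets lebesgue"
  shows "integrable (lebesgue_on A) f"
  using set_integrable_subset[of lebesgue S f A] assms
  by (simp add: integrable_restrict_space set_integrable_def)

lemma phase_closed: "closed (phase :: (real \<times> (real^'n)) set)"
  unfolding phase_def by (intro closed_Times) auto

text \<open>
  Only the total mass of the concentration measure at each time enters the estimates, so the
  disintegration is used for the sets \<open>{0..\<tau>} \<times> cell\<close> alone.
\<close>

lemma disintegration_total_mass:
  fixes m :: "(real \<times> (real^'n)) measure"
  assumes dis: "disintegration T m mt" and m: "m \<in> Mplus (cyl T)"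
  shows "integrable (lebesgue_on {0..T}) (\<lambda>t. measure (mt t) cell)"
    and "0 \<le> \<tau> \<Longrightarrow> \<tau> \<le> T \<Longrightarrow> measure m (cyl \<tau>) = (\<integral>t. measure (mt t) cell \<partial>lebesgue_on {0..\<tau>})"
proof -
  have cell: "cell \<in> sets (restrict_space borel (cell :: (real^'n) set))" by (simp add: sets_restrict_space_iff)
  have S: "{0..\<tau>} \<in> sets (restrict_space borel {0..T})" if "\<tau> \<le> T" for \<tau>
    using that by (simp add: sets_restrict_space_iff)
  have em: "(\<lambda>t. emeasure (mt t) cell) \<in> borel_measurable (lebesgue_on {0..T})"
    and eq: "\<And>\<tau>. \<tau> \<le> T \<Longrightarrow> emeasure m (cyl \<tau>) = (\<integral>\<^sup>+t. emeasure (mt t) cell \<partial>lebesgue_on {0..\<tau>})"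
    using dis cell S unfolding disintegration_def cyl_def by auto
  have em': "(\<lambda>t. emeasure (mt t) cell) \<in> borel_measurable (lebesgue_on {0..\<tau>})" if "\<tau> \<le> T" for \<tau>
    using measurable_restrict_mono[OF em, of "{0..\<tau>}"] that by auto
  have fin: "emeasure m A \<noteq> \<infinity>" for A using m by (simp add: Mplus_def finite_measure.emeasure_finite)
  have ae: "AE t in lebesgue_on {0..T}. emeasure (mt t) cell = ennreal (measure (mt t) cell)"
    using dis unfolding disintegration_def
    by (elim conjE eventually_mono) (simp add: Mplus_def finite_measure.emeasure_eq_measure)
  have main: "has_bochner_integral (lebesgue_on {0..\<tau>}) (\<lambda>t. measure (mt t) cell) (measure m (cyl \<tau>))"
    if t: "\<tau> \<le> T" for \<tau>
  proof (rule has_bochner_integral_nn_integral)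
    show "(\<lambda>t. measure (mt t) cell) \<in> borel_measurable (lebesgue_on {0..\<tau>})"
      unfolding measure_def using em'[OF t] by measurable
    have "AE t in lebesgue_on {0..\<tau>}. emeasure (mt t) cell = ennreal (measure (mt t) cell)"
      using t by (intro AE_lebesgue_on_subset[OF ae]) auto
    then have "(\<integral>\<^sup>+t. ennreal (measure (mt t) cell) \<partial>lebesgue_on {0..\<tau>}) = (\<integral>\<^sup>+t. emeasure (mt t) cell \<partial>lebesgue_on {0..\<tau>})"
      by (intro nn_integral_cong_AE) auto
    then show "(\<integral>\<^sup>+t. ennreal (measure (mt t) cell) \<partial>lebesgue_on {0..\<tau>}) = ennreal (measure m (cyl \<tau>))"
      unfolding emeasure_eq_ennreal_measure[OF fin[of "cyl \<tau>", unfolded infinity_ennreal_def], symmetric] eq[OF t] .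
  qed auto
  show "integrable (lebesgue_on {0..T}) (\<lambda>t. measure (mt t) cell)"
    using main[OF order_refl] by (rule integrable.intros)
  show "measure m (cyl \<tau>) = (\<integral>t. measure (mt t) cell \<partial>lebesgue_on {0..\<tau>})" if "0 \<le> \<tau>" "\<tau> \<le> T"
    using main[OF that(2)] by (simp add: has_bochner_integral_iff)
qed

text \<open>
  A common setting for both systems. The measure-valued momentum balance has source \<open>K\<close>, the energy
  inequality has source \<open>D\<close>, and the classical solution has acceleration \<open>g\<close>. The last assumption says that the
  sources contribute to the relative energy at most as much as they would for a common linear source
  \<open>h *\<^sub>R g\<close>; it is an equality for the Euler system and a consequence of monotone friction for
  Savage-Hutter.
\<close>

locale weak_strong =
  fixes T c \<kappa> \<gamma> :: real
    and H :: "real \<times> (real^'n) \<Rightarrow> real" and U :: "real \<times> (real^'n) \<Rightarrow> real^'n"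
    and \<nu> :: "real \<times> (real^'n) \<Rightarrow> (real \<times> (real^'n)) measure"
    and m :: "(real \<times> (real^'n)) measure"
    and \<nu>inf :: "real \<times> (real^'n) \<Rightarrow> (real \<times> (real^'n)) measure"
    and mt :: "real \<Rightarrow> (real^'n) measure"
    and K :: "real \<times> (real^'n) \<Rightarrow> real^'n" and D :: "real \<times> (real^'n) \<Rightarrow> real"
    and g :: "real \<times> (real^'n) \<Rightarrow> real^'n"
  assumes T: "0 < T" and c: "0 < c" and \<gamma>: "1 < \<gamma>" and \<kappa>: "0 < \<kappa>"
    and H: "lipschitz_torus T H" and Hc: "\<And>z. z \<in> slab T \<Longrightarrow> c \<le> H z" and U: "C1_torus T U"
    and strong: "strong_balance T \<kappa> \<gamma> (\<lambda>z. H z *\<^sub>R g z) H U"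
    and \<nu>: "\<And>z. z \<in> cyl T \<Longrightarrow> prob_space (\<nu> z) \<and> sets (\<nu> z) = sets (restrict_space borel phase)"
    and m: "m \<in> Mplus (cyl T)" and \<nu>inf: "\<nu>inf \<in> Linf_w (completion m) (sphere_plus \<gamma>)"
    and mass: "mv_mass_balance T (\<lambda>x. H (0, x)) \<nu>"
    and mom: "mv_momentum_balance T \<kappa> \<gamma> (\<lambda>x. H (0, x)) (\<lambda>x. U (0, x)) \<nu> m \<nu>inf K"
    and dis: "disintegration T m mt"
    and energy: "AE t in lebesgue_on {0..T}. integrable (lebesgue_on (cyl t)) D \<and>
      enn2ereal (energy_mvs \<kappa> \<gamma> \<nu> mt \<nu>inf t) \<le>
        enn2ereal (energy_0 \<kappa> \<gamma> (\<lambda>x. H (0, x)) (\<lambda>x. U (0, x))) + ereal (\<integral>z. D z \<partial>lebesgue_on (cyl t))"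
    and compat: "AE z in lebesgue_on (cyl T). D z - U z \<bullet> K z \<le> (hu_bar \<nu> z - h_bar \<nu> z *\<^sub>R U z) \<bullet> g z"
begin

abbreviation "P \<equiv> hu_bar \<nu>"
abbreviation "h \<equiv> h_bar \<nu>"
abbreviation "C z \<equiv> integral\<^sup>L (\<nu> z) convection"
abbreviation "B z \<equiv> integral\<^sup>L (\<nu> z) (h_power \<gamma>)"
abbreviation "J \<equiv> jac_x U"
abbreviation "\<delta> \<equiv> div_x U"
abbreviation "\<psi> \<equiv> energy_variable \<kappa> \<gamma> H U"
abbreviation "F w \<equiv> \<kappa> * H w powr \<gamma>"

text \<open>
  The average of the relative energy density. It is expressed by moments because these are measurable in \<open>z\<close> by
  assumption.
\<close>

definition "X z = ((1/2) *\<^sub>R mat 1) \<bullet> C z + (- U z) \<bullet> P z + \<psi> z * h z + (\<kappa> / (\<gamma> - 1)) * B z + F z"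

text \<open>
  The average of \<open>rel_flux\<close>, in terms of moments.
\<close>

definition "Q z = (- J z) \<bullet> C z + (J z *v U z + U z v* J z) \<bullet> P z
   + (\<kappa> * \<delta> z * \<gamma> * H z powr (\<gamma> - 1) - U z \<bullet> (J z *v U z)) * h z + (- \<kappa> * \<delta> z) * B z + (- \<kappa> * \<delta> z * (\<gamma> - 1) * H z powr \<gamma>)"

definition "moments_exist z \<longleftrightarrow> integrable (\<nu> z) (convection :: real \<times> (real^'n) \<Rightarrow> _) \<and>
  integrable (\<nu> z) (momentum :: real \<times> (real^'n) \<Rightarrow> _) \<and>
  integrable (\<nu> z) (height :: real \<times> (real^'n) \<Rightarrow> _) \<and> integrable (\<nu> z) (h_power \<gamma> :: real \<times> (real^'n) \<Rightarrow> _)"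

lemma Hpos: "z \<in> slab T \<Longrightarrow> 0 < H z" using Hc[of z] c by linarith

lemma Hcont: "continuous_on (slab T) H" by (rule lipschitz_torus_continuous[OF H])
lemma Ucont: "continuous_on (slab T) U" by (rule C1_torus_continuous[OF U])
lemma Utcont: "continuous_on (slab T) (dt T U)" by (rule C1_torus_dt_continuous[OF U T])
lemma Jcont: "continuous_on (slab T) J"
  unfolding jac_x_def by (intro continuous_on_vec_lambda C1_torus_dx_continuous C1_torus_component U)
lemma \<delta>cont: "continuous_on (slab T) \<delta>"
  unfolding div_x_def by (intro continuous_on_sum C1_torus_dx_continuous C1_torus_component U)
lemma powr_cont: "continuous_on (slab T) (\<lambda>z. H z powr s)"
  using Hpos by (intro continuous_on_powr Hcont continuous_on_const) (metis less_irrefl)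
lemma Fcont: "continuous_on (slab T) (\<lambda>z. F z)"
  by (intro continuous_on_mult_left powr_cont)
lemma \<psi>lip: "lipschitz_torus T \<psi>"
  by (rule lipschitz_torus_energy_variable[OF H c Hc U T])
lemma \<psi>cont: "continuous_on (slab T) \<psi>" by (rule lipschitz_torus_continuous[OF \<psi>lip])
lemma JUcont: "continuous_on (slab T) (\<lambda>z. J z *v U z)"
  unfolding matrix_vector_mult_def
  by (intro continuous_on_vec_lambda continuous_on_sum continuous_on_mult continuous_on_component Jcont Ucont)
lemma UJcont: "continuous_on (slab T) (\<lambda>z. U z v* J z)"
  unfolding vector_matrix_mult_def
  by (intro continuous_on_vec_lambda continuous_on_sum continuous_on_mult continuous_on_component Jcont Ucont)

lemma derivative_point_AE:
  "AE z in lebesgue_on (cyl T). \<exists>DH DU. derivative_point T \<gamma> H U z DH DU \<and>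
     dt T H z + grad_x H z \<bullet> U z + H z * \<delta> z = 0 \<and>
     dt T H z *\<^sub>R U z + H z *\<^sub>R dt T U z + ((grad_x H z \<bullet> U z) *\<^sub>R U z + H z *\<^sub>R (J z *v U z) + (H z * \<delta> z) *\<^sub>R U z)
      + (\<kappa> * \<gamma> * H z powr (\<gamma> - 1)) *\<^sub>R grad_x H z = H z *\<^sub>R g z"
  using AE_lebesgue_on_mem[OF strong[unfolded strong_balance_def]]
proof eventually_elim
  case (elim z)
  then have z: "z \<in> slab T" using cyl_subset_slab[OF order_refl] by blast
  obtain DH where DH: "(H has_derivative DH) (at z within slab T)" using elim unfolding differentiable_def by blast
  obtain DU where DU: "(U has_derivative DU) (at z within slab T)" using C1_torusE[OF U] z by metis
  interpret derivative_point T \<kappa> \<gamma> H U z DH DU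
    by standard (use T z Hpos[OF z] \<gamma> DH DU in auto)
  show ?case
    using elim derivative_point_axioms
    by (intro exI[of _ DH] exI[of _ DU]) (simp add: mass_eq mom_t mom_Div Fx)
qed

lemma lipschitz_FU: "lipschitz_torus T (\<lambda>w. F w * U w $ j)"
  by (intro lipschitz_torus_mult lipschitz_torus_const lipschitz_torus_powr[OF H c Hc]
      C1_torus_lipschitz_torus[OF C1_torus_component[OF U] T])

lemma lipschitz_F: "lipschitz_torus T (\<lambda>w. F w)"
  by (intro lipschitz_torus_mult lipschitz_torus_const lipschitz_torus_powr[OF H c Hc])

lemma differentiable_AE:
  "AE z in lebesgue_on (cyl T). \<psi> differentiable (at z within slab T)"
  "AE z in lebesgue_on (cyl T). (\<lambda>w. F w) differentiable (at z within slab T)"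
  "AE z in lebesgue_on (cyl T). (\<lambda>w. F w * U w $ j) differentiable (at z within slab T)"
proof -
  have dp: "AE z in lebesgue_on (cyl T). \<exists>DH DU. derivative_point T \<gamma> H U z DH DU"
    using derivative_point_AE by eventually_elim blast
  show "AE z in lebesgue_on (cyl T). \<psi> differentiable (at z within slab T)"
    using dp by eventually_elim (auto simp: differentiable_def intro: exI dest!: derivative_point.D\<psi>)
  show "AE z in lebesgue_on (cyl T). (\<lambda>w. F w) differentiable (at z within slab T)"
    using dp by eventually_elim (auto simp: differentiable_def intro: exI dest!: derivative_point.DF)
  show "AE z in lebesgue_on (cyl T). (\<lambda>w. F w * U w $ j) differentiable (at z within slab T)"
    using dp by eventually_elim (auto simp: differentiable_def intro: exI dest!: derivative_point.DFU)
qed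

text \<open>
  The balance of the pressure of the classical solution over \<open>{0..\<tau>} \<times> cell\<close>: the term \<open>H powr \<gamma>\<close> in the
  relative energy is a function of the classical solution alone.
\<close>

lemma F_balance:
  assumes "0 \<le> \<tau>" "\<tau> < T"
  shows "integrable (lebesgue_on (cyl \<tau>)) (\<lambda>z. dt T F z + (\<Sum>j\<in>UNIV. dx j (\<lambda>w. F w * U w $ j) z))"
    and "(\<integral>z. dt T F z + (\<Sum>j\<in>UNIV. dx j (\<lambda>w. F w * U w $ j) z) \<partial>lebesgue_on (cyl \<tau>)) =
      (\<integral>x. F (\<tau>, x) \<partial>lebesgue_on cell) - (\<integral>x. F (0, x) \<partial>lebesgue_on cell)"
proof -
  obtain L where L: "L-lipschitz_on (slab T) (\<lambda>w. F w)" using lipschitz_F unfolding lipschitz_torus_def by blast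
  note t = integral_dt[OF L assms differentiable_AE(2)]
  have x: "integrable (lebesgue_on (cyl \<tau>)) (dx j (\<lambda>w. F w * U w $ j))"
    "(\<integral>z. dx j (\<lambda>w. F w * U w $ j) z \<partial>lebesgue_on (cyl \<tau>)) = 0" for j
  proof -
    obtain L where L: "L-lipschitz_on (slab T) (\<lambda>w. F w * U w $ j)" and p: "periodic_x T (\<lambda>w. F w * U w $ j)"
      using lipschitz_FU[of j] unfolding lipschitz_torus_def by blast
    show "integrable (lebesgue_on (cyl \<tau>)) (dx j (\<lambda>w. F w * U w $ j))"
      "(\<integral>z. dx j (\<lambda>w. F w * U w $ j) z \<partial>lebesgue_on (cyl \<tau>)) = 0"
      using integral_dx_eq_0[OF L p _ differentiable_AE(3)] assms by auto
  qed
  show "integrable (lebesgue_on (cyl \<tau>)) (\<lambda>z. dt T F z + (\<Sum>j\<in>UNIV. dx j (\<lambda>w. F w * U w $ j) z))"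
    using t x by auto
  show "(\<integral>z. dt T F z + (\<Sum>j\<in>UNIV. dx j (\<lambda>w. F w * U w $ j) z) \<partial>lebesgue_on (cyl \<tau>)) =
      (\<integral>x. F (\<tau>, x) \<partial>lebesgue_on cell) - (\<integral>x. F (0, x) \<partial>lebesgue_on cell)"
    using t x by simp
qed

lemma \<nu>_phase:
  assumes "z \<in> cyl T"
  shows "prob_space (\<nu> z)" "sets (\<nu> z) = sets (restrict_space borel phase)" "space (\<nu> z) = phase"
  using \<nu>[OF assms] sets_eq_imp_space_eq[of "\<nu> z" "restrict_space borel phase"]
  by (auto simp: space_restrict_space)

lemma phase_fst: "z \<in> cyl T \<Longrightarrow> l \<in> space (\<nu> z) \<Longrightarrow> 0 \<le> fst l"
  using \<nu>_phase(3)[of z] by (auto simp: phase_def)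

lemma X_eq:
  assumes z: "z \<in> cyl T" and mo: "moments_exist z"
  shows "integrable (\<nu> z) (rel_energy \<kappa> \<gamma> (H z) (U z))" "X z = (\<integral>l. rel_energy \<kappa> \<gamma> (H z) (U z) l \<partial>\<nu> z)"
proof -
  let ?M = "moment_form \<gamma> ((1/2) *\<^sub>R mat 1) (- U z) (\<psi> z) (\<kappa> / (\<gamma> - 1)) (F z)"
  note mf = moment_form_integral[of "\<nu> z" \<gamma> "(1/2) *\<^sub>R mat 1" "- U z" "\<psi> z" "\<kappa> / (\<gamma> - 1)" "F z"]
  have e: "rel_energy \<kappa> \<gamma> (H z) (U z) l = ?M l" if "l \<in> space (\<nu> z)" for l
    using rel_energy_moment_form[OF phase_fst[OF z that] \<gamma>, of \<kappa> "H z" "U z"] by (simp add: energy_variable_def)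
  show "integrable (\<nu> z) (rel_energy \<kappa> \<gamma> (H z) (U z))"
    using mf(1) \<nu>_phase[OF z] mo e by (subst Bochner_Integration.integrable_cong[OF refl, of _ _ ?M]) (auto simp: moments_exist_def)
  have "(\<integral>l. rel_energy \<kappa> \<gamma> (H z) (U z) l \<partial>\<nu> z) = (\<integral>l. ?M l \<partial>\<nu> z)"
    using e by (intro Bochner_Integration.integral_cong) auto
  then show "X z = (\<integral>l. rel_energy \<kappa> \<gamma> (H z) (U z) l \<partial>\<nu> z)"
    using mf(2) \<nu>_phase[OF z] mo by (simp add: moments_exist_def X_def h_bar_def hu_bar_def)
qed

lemma X_nonneg:
  assumes z: "z \<in> cyl T" and mo: "moments_exist z"
  shows "0 \<le> X z"
  unfolding X_eq(2)[OF assms]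
  using rel_energy_nonneg[OF phase_fst[OF z] \<gamma> Hpos \<kappa>] z cyl_subset_slab[OF order_refl, of T]
  by (intro integral_nonneg_AE AE_I2) auto

text \<open>
  The relative energy density is nonnegative and vanishes at a single phase point, so a probability
  measure with average 0 is concentrated there.
\<close>

lemma X_eq_0:
  assumes z: "z \<in> cyl T" and mo: "moments_exist z" and X: "X z = 0"
  shows "\<nu> z = return (restrict_space borel phase) (H z, sqrt (H z) *\<^sub>R U z)"
proof (rule prob_space_Dirac)
  show "prob_space (\<nu> z)" "sets (\<nu> z) = sets (restrict_space borel phase)" using \<nu>_phase[OF z] by auto
  have Hz: "0 < H z" using z cyl_subset_slab[OF order_refl, of T] by (intro Hpos) auto
  then have "(H z, sqrt (H z) *\<^sub>R U z) \<in> phase" by (simp add: phase_def)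
  then show "{(H z, sqrt (H z) *\<^sub>R U z)} \<in> sets (restrict_space borel phase)"
    using phase_closed by (subst sets_restrict_space_iff) (auto intro: borel_closed)
  have nn: "AE l in \<nu> z. 0 \<le> rel_energy \<kappa> \<gamma> (H z) (U z) l"
    using rel_energy_nonneg[OF phase_fst[OF z] \<gamma> Hz \<kappa>] by (intro AE_I2) auto
  have "AE l in \<nu> z. rel_energy \<kappa> \<gamma> (H z) (U z) l = 0"
    using integral_nonneg_eq_0_iff_AE[OF X_eq(1)[OF z mo] nn] X X_eq(2)[OF z mo] by simp
  then show "AE l in \<nu> z. l = (H z, sqrt (H z) *\<^sub>R U z)"
    using AE_space by eventually_elim (use rel_energy_eq_0[OF phase_fst[OF z] \<gamma> Hz \<kappa>] in blast)
qed

lemma Q_le_X: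
  assumes z: "z \<in> cyl T" and mo: "moments_exist z" and \<beta>: "norm (J z) \<le> \<beta>" "\<bar>\<delta> z\<bar> \<le> \<beta>"
  shows "Q z \<le> (\<beta> * (\<gamma> + 1)) * X z"
proof -
  let ?M = "moment_form \<gamma> (- J z) (J z *v U z + U z v* J z)
     (\<kappa> * \<delta> z * \<gamma> * H z powr (\<gamma> - 1) - U z \<bullet> (J z *v U z)) (- \<kappa> * \<delta> z) (- \<kappa> * \<delta> z * (\<gamma> - 1) * H z powr \<gamma>)"
  note mf = moment_form_integral[of "\<nu> z" \<gamma> "- J z" "J z *v U z + U z v* J z"
     "\<kappa> * \<delta> z * \<gamma> * H z powr (\<gamma> - 1) - U z \<bullet> (J z *v U z)" "- \<kappa> * \<delta> z" "- \<kappa> * \<delta> z * (\<gamma> - 1) * H z powr \<gamma>"]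
  have Hz: "0 < H z" using z cyl_subset_slab[OF order_refl, of T] by (intro Hpos) auto
  have "Q z = (\<integral>l. ?M l \<partial>\<nu> z)"
    using mf(2) \<nu>_phase[OF z] mo by (simp add: moments_exist_def Q_def h_bar_def hu_bar_def)
  also have "\<dots> \<le> (\<integral>l. (\<beta> * (\<gamma> + 1)) * rel_energy \<kappa> \<gamma> (H z) (U z) l \<partial>\<nu> z)"
  proof (rule integral_mono)
    show "integrable (\<nu> z) ?M" using mf(1) \<nu>_phase[OF z] mo by (auto simp: moments_exist_def)
    show "integrable (\<nu> z) (\<lambda>l. (\<beta> * (\<gamma> + 1)) * rel_energy \<kappa> \<gamma> (H z) (U z) l)"
      using X_eq(1)[OF z mo] by (rule integrable_mult_right)
    show "?M l \<le> (\<beta> * (\<gamma> + 1)) * rel_energy \<kappa> \<gamma> (H z) (U z) l" if "l \<in> space (\<nu> z)" for l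
      using rel_flux_le_rel_energy[OF phase_fst[OF z that] \<gamma> Hz \<kappa> \<beta>, of "U z"]
        rel_flux_moment_form[OF phase_fst[OF z that], of \<kappa> \<gamma> "H z" "U z" "J z" "\<delta> z"] by simp
  qed
  also have "\<dots> = (\<beta> * (\<gamma> + 1)) * X z" by (simp add: X_eq(2)[OF z mo])
  finally show ?thesis .
qed

lemma m_cyl:
  assumes "\<tau> \<le> T"
  shows "finite_measure (restrict_space (completion m) (cyl \<tau>))"
    and "measure (restrict_space (completion m) (cyl \<tau>)) (space (restrict_space (completion m) (cyl \<tau>))) = measure m (cyl \<tau>)"
    and "space (restrict_space (completion m) (cyl \<tau>)) = cyl \<tau>"
proof -
  interpret finite_measure m using m by (simp add: Mplus_def)
  have sm: "sets m = sets (restrict_space borel (cyl T))" using m by (simp add: Mplus_def)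
  have s: "cyl \<tau> \<in> sets m" unfolding sm using cyl_mono[OF assms] by (simp add: sets_restrict_space_iff)
  show sp: "space (restrict_space (completion m) (cyl \<tau>)) = cyl \<tau>"
    using sets.sets_into_space[OF s] by (auto simp: space_restrict_space)
  have e: "emeasure (restrict_space (completion m) (cyl \<tau>)) (cyl \<tau>) = emeasure m (cyl \<tau>)"
    using s by (subst emeasure_restrict_space) auto
  show "finite_measure (restrict_space (completion m) (cyl \<tau>))"
    by (rule finite_measureI) (simp add: sp e)
  show "measure (restrict_space (completion m) (cyl \<tau>)) (space (restrict_space (completion m) (cyl \<tau>))) = measure m (cyl \<tau>)"
    unfolding sp by (simp add: measure_def e)
qed

text \<open>
  Directions in the sphere have bounded moments, so the concentration part of both integrals is
  bounded by its total mass.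
\<close>

lemma concentration_bound:
  assumes \<tau>: "\<tau> \<le> T" and \<beta>: "\<And>z. z \<in> cyl T \<Longrightarrow> norm (J z) \<le> \<beta>" "\<And>z. z \<in> cyl T \<Longrightarrow> \<bar>\<delta> z\<bar> \<le> \<beta>" "0 \<le> \<beta>"
  shows "\<bar>bar_integral (cyl \<tau>) \<nu> m \<nu>inf convection J - (\<integral>z. J z \<bullet> C z \<partial>lebesgue_on (cyl \<tau>))\<bar> \<le> \<beta> * measure m (cyl \<tau>)"
    and "\<bar>bar_integral (cyl \<tau>) \<nu> m \<nu>inf (h_power \<gamma>) \<delta> - (\<integral>z. \<delta> z * B z \<partial>lebesgue_on (cyl \<tau>))\<bar> \<le> \<beta> * measure m (cyl \<tau>)"
proof -
  have sp: "space (completion m) = cyl T"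
    using m sets_eq_imp_space_eq[of m "restrict_space borel (cyl T)"] by (auto simp: Mplus_def space_restrict_space)
  have pr: "prob_space (\<nu>inf z)" "space (\<nu>inf z) = sphere_plus \<gamma>" if "z \<in> cyl \<tau>" for z
  proof -
    have "z \<in> space (completion m)" using cyl_mono[OF \<tau>] that sp by auto
    then show "prob_space (\<nu>inf z)" "space (\<nu>inf z) = sphere_plus \<gamma>" using Linf_w_prob[OF \<nu>inf] by blast+
  qed
  let ?M = "restrict_space (completion m) (cyl \<tau>)"
  have "\<bar>\<integral>z. J z \<bullet> integral\<^sup>L (\<nu>inf z) convection \<partial>?M\<bar> \<le> \<beta> * measure ?M (space ?M)"
  proof (rule abs_integral_le_bound[OF m_cyl(1)[OF \<tau>] \<beta>(3)])
    fix z assume "z \<in> space ?M"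
    then have z: "z \<in> cyl \<tau>" "z \<in> cyl T" using m_cyl(3)[OF \<tau>] cyl_mono[OF \<tau>] by auto
    show "\<bar>J z \<bullet> integral\<^sup>L (\<nu>inf z) convection\<bar> \<le> \<beta>"
      using sphere_moment_bound(1)[OF pr[OF z(1)], of "J z"] \<beta>(1)[OF z(2)] by linarith
  qed
  then show "\<bar>bar_integral (cyl \<tau>) \<nu> m \<nu>inf convection J - (\<integral>z. J z \<bullet> C z \<partial>lebesgue_on (cyl \<tau>))\<bar> \<le> \<beta> * measure m (cyl \<tau>)"
    unfolding m_cyl(2)[OF \<tau>] by (simp add: bar_integral_def)
  have "\<bar>\<integral>z. \<delta> z * integral\<^sup>L (\<nu>inf z) (h_power \<gamma>) \<partial>?M\<bar> \<le> \<beta> * measure ?M (space ?M)"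
  proof (rule abs_integral_le_bound[OF m_cyl(1)[OF \<tau>] \<beta>(3)])
    fix z assume "z \<in> space ?M"
    then have z: "z \<in> cyl \<tau>" "z \<in> cyl T" using m_cyl(3)[OF \<tau>] cyl_mono[OF \<tau>] by auto
    show "\<bar>\<delta> z * integral\<^sup>L (\<nu>inf z) (h_power \<gamma>)\<bar> \<le> \<beta>"
      using sphere_moment_bound(2)[OF pr[OF z(1)], of "\<delta> z"] \<beta>(2)[OF z(2)] by linarith
  qed
  then show "\<bar>bar_integral (cyl \<tau>) \<nu> m \<nu>inf (h_power \<gamma>) \<delta> - (\<integral>z. \<delta> z * B z \<partial>lebesgue_on (cyl \<tau>))\<bar> \<le> \<beta> * measure m (cyl \<tau>)"
    unfolding m_cyl(2)[OF \<tau>] by (simp add: bar_integral_def)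
qed

text \<open>
  The non-concentrated part of the energy density.
\<close>

definition "e z = ((1/2) *\<^sub>R mat 1) \<bullet> C z + (\<kappa> / (\<gamma> - 1)) * B z"

definition "E0 = (\<integral>x. 1/2 * H (0, x) * (norm (U (0, x)))\<^sup>2 + \<kappa> / (\<gamma> - 1) * H (0, x) powr \<gamma> \<partial>lebesgue_on cell)"

text \<open>
  Passage from the extended real energy inequality to real numbers: the initial energy is finite, so all
  terms on the left are.
\<close>

lemma energy_real:
  assumes \<tau>: "0 \<le> \<tau>" "\<tau> \<le> T"
    and en: "enn2ereal (energy_mvs \<kappa> \<gamma> \<nu> mt \<nu>inf \<tau>) \<le>
        enn2ereal (energy_0 \<kappa> \<gamma> (\<lambda>x. H (0, x)) (\<lambda>x. U (0, x))) + ereal d"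
    and ei: "integrable (lebesgue_on cell) (\<lambda>x. e (\<tau>, x))"
    and mo: "AE x in lebesgue_on cell. moments_exist (\<tau>, x)"
    and mt: "mt \<tau> \<in> Mplus cell"
  shows "(\<integral>x. e (\<tau>, x) \<partial>lebesgue_on cell) + min (1/2) (\<kappa> / (\<gamma> - 1)) * measure (mt \<tau>) cell \<le> E0 + d"
proof -
  let ?c0 = "min (1/2) (\<kappa> / (\<gamma> - 1))"
  have c0: "0 \<le> ?c0" using \<gamma> \<kappa> by simp
  have eae: "AE x in lebesgue_on cell. 0 \<le> e (\<tau>, x) \<and> (\<integral>\<^sup>+l. energy_density \<kappa> \<gamma> l \<partial>\<nu> (\<tau>, x)) = ennreal (e (\<tau>, x))"
    using AE_lebesgue_on_mem[OF mo]
  proof eventually_elim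
    case (elim x)
    let ?z = "(\<tau>, x)" let ?M = "moment_form \<gamma> ((1/2) *\<^sub>R mat 1) (0 :: real^'n) 0 (\<kappa> / (\<gamma> - 1)) 0"
    have z: "?z \<in> cyl T" using elim \<tau> by (auto simp: cyl_def)
    note mf = moment_form_integral[of "\<nu> ?z" \<gamma> "(1/2) *\<^sub>R mat 1" "0 :: real^'n" 0 "\<kappa> / (\<gamma> - 1)" 0]
    have ed: "energy_density \<kappa> \<gamma> l = ennreal (?M l)" "0 \<le> ?M l" for l :: "real \<times> (real^'n)"
      using \<gamma> \<kappa> by (auto simp: energy_density_def moment_form_def convection_def mat_1_inner_outer h_power_def split_beta)
    have i: "integrable (\<nu> ?z) ?M" using mf(1) \<nu>_phase[OF z] elim by (auto simp: moments_exist_def)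
    have v: "(\<integral>l. ?M l \<partial>\<nu> ?z) = e ?z"
      using mf(2) \<nu>_phase[OF z] elim by (simp add: moments_exist_def e_def)
    have "(\<integral>\<^sup>+l. energy_density \<kappa> \<gamma> l \<partial>\<nu> ?z) = ennreal (e ?z)"
      unfolding ed(1) using nn_integral_eq_integral[OF i] ed(2) v by simp
    moreover have "0 \<le> e ?z" unfolding v[symmetric] using ed(2) by (intro integral_nonneg_AE AE_I2) auto
    ultimately show ?case by simp
  qed
  then have e0: "AE x in lebesgue_on cell. 0 \<le> e (\<tau>, x)" by eventually_elim simp
  have 1: "(\<integral>\<^sup>+x. (\<integral>\<^sup>+l. energy_density \<kappa> \<gamma> l \<partial>\<nu> (\<tau>, x)) \<partial>lebesgue_on cell) = ennreal (\<integral>x. e (\<tau>, x) \<partial>lebesgue_on cell)"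
    using nn_integral_eq_integral[OF ei e0] eae
    by (subst nn_integral_cong_AE[where v = "\<lambda>x. ennreal (e (\<tau>, x))"]) auto
  have 2: "ennreal (?c0 * measure (mt \<tau>) cell) \<le> (\<integral>\<^sup>+x. (\<integral>\<^sup>+l. energy_density \<kappa> \<gamma> l \<partial>\<nu>inf (\<tau>, x)) \<partial>completion (mt \<tau>))"
  proof -
    interpret mt: finite_measure "mt \<tau>" using mt by (simp add: Mplus_def)
    have sp: "space (mt \<tau>) = cell" using mt sets_eq_imp_space_eq[of "mt \<tau>" "restrict_space borel cell"]
      by (auto simp: Mplus_def space_restrict_space)
    have spm: "space (completion m) = cyl T"
      using m sets_eq_imp_space_eq[of m "restrict_space borel (cyl T)"] by (auto simp: Mplus_def space_restrict_space)
    have cs: "cell \<in> sets (mt \<tau>)" using sets.top[of "mt \<tau>"] sp by simp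
    have "ennreal (?c0 * measure (mt \<tau>) cell) = ennreal ?c0 * emeasure (mt \<tau>) cell"
      using c0 by (simp add: mt.emeasure_eq_measure ennreal_mult)
    also have "\<dots> = (\<integral>\<^sup>+x. ennreal ?c0 \<partial>completion (mt \<tau>))" using cs by (simp add: sp)
    also have "\<dots> \<le> (\<integral>\<^sup>+x. (\<integral>\<^sup>+l. energy_density \<kappa> \<gamma> l \<partial>\<nu>inf (\<tau>, x)) \<partial>completion (mt \<tau>))"
    proof (rule nn_integral_mono)
      fix x assume "x \<in> space (completion (mt \<tau>))"
      then have "(\<tau>, x) \<in> cyl T" using \<tau> by (simp add: sp cyl_def)
      then show "ennreal ?c0 \<le> (\<integral>\<^sup>+l. energy_density \<kappa> \<gamma> l \<partial>\<nu>inf (\<tau>, x))"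
        using Linf_w_prob[OF \<nu>inf, of "(\<tau>, x)"] spm \<gamma> \<kappa> by (intro sphere_energy_bound) auto
    qed
    finally show ?thesis .
  qed
  have E0: "energy_0 \<kappa> \<gamma> (\<lambda>x. H (0, x)) (\<lambda>x. U (0, x)) = ennreal E0" "0 \<le> E0"
  proof -
    have nn: "0 \<le> 1/2 * H (0, x) * (norm (U (0, x)))\<^sup>2 + \<kappa> / (\<gamma> - 1) * H (0, x) powr \<gamma>" for x
      using Hpos[of "(0, x)"] T \<gamma> \<kappa> by (intro add_nonneg_nonneg mult_nonneg_nonneg) auto
    have i: "integrable (lebesgue_on cell) (\<lambda>x. 1/2 * H (0, x) * (norm (U (0, x)))\<^sup>2 + \<kappa> / (\<gamma> - 1) * H (0, x) powr \<gamma>)"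
      by (rule continuous_slab_integrable_cell[where T = T and F = "\<lambda>z. 1/2 * H z * (norm (U z))\<^sup>2 + \<kappa> / (\<gamma> - 1) * H z powr \<gamma>"])
        (intro continuous_on_add continuous_on_mult continuous_on_mult_left continuous_on_power continuous_on_norm
          continuous_on_const Hcont Ucont powr_cont, use T in simp)
    show "energy_0 \<kappa> \<gamma> (\<lambda>x. H (0, x)) (\<lambda>x. U (0, x)) = ennreal E0"
      unfolding energy_0_def E0_def using nn by (intro nn_integral_eq_integral i) auto
    show "0 \<le> E0" unfolding E0_def using nn by (intro integral_nonneg_AE AE_I2)
  qed
  have pos: "0 \<le> (\<integral>x. e (\<tau>, x) \<partial>lebesgue_on cell)" "0 \<le> ?c0 * measure (mt \<tau>) cell"
    using e0 c0 by (auto intro: integral_nonneg_AE)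
  have "ennreal ((\<integral>x. e (\<tau>, x) \<partial>lebesgue_on cell) + ?c0 * measure (mt \<tau>) cell) \<le> energy_mvs \<kappa> \<gamma> \<nu> mt \<nu>inf \<tau>"
    unfolding energy_mvs_def 1 ennreal_plus[OF pos] using 2 by (intro add_left_mono)
  then have "enn2ereal (ennreal ((\<integral>x. e (\<tau>, x) \<partial>lebesgue_on cell) + ?c0 * measure (mt \<tau>) cell)) \<le> enn2ereal (energy_mvs \<kappa> \<gamma> \<nu> mt \<nu>inf \<tau>)"
    by (simp add: less_eq_ennreal.rep_eq)
  also note en
  finally have "enn2ereal (ennreal ((\<integral>x. e (\<tau>, x) \<partial>lebesgue_on cell) + ?c0 * measure (mt \<tau>) cell)) \<le> enn2ereal (ennreal E0) + ereal d"
    unfolding E0(1) .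
  then show ?thesis unfolding enn2ereal_ennreal[OF add_nonneg_nonneg[OF pos]] enn2ereal_ennreal[OF E0(2)] by simp
qed

text \<open>
  The relative energy inequality at a fixed time. The parameter \<open>k\<close> stands for the energy of the concentration
  part at time \<open>\<tau>\<close>. Expanding the square and the Bregman distance in \<open>X\<close> leaves the energy, the momentum tested
  with \<open>U\<close>, the height tested with the energy variable, and a function of the classical solution; each of
  them is controlled by one balance law.
\<close>

lemma relative_energy_inequality:
  assumes \<tau>: "0 \<le> \<tau>" "\<tau> < T"
    and \<beta>: "\<And>z. z \<in> cyl T \<Longrightarrow> norm (J z) \<le> \<beta>" "\<And>z. z \<in> cyl T \<Longrightarrow> \<bar>\<delta> z\<bar> \<le> \<beta>" "0 \<le> \<beta>"
    and ih: "integrable (lebesgue_on (cyl \<tau>)) h" and iP: "integrable (lebesgue_on (cyl \<tau>)) P"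
    and iC: "integrable (lebesgue_on (cyl \<tau>)) C" and iB: "integrable (lebesgue_on (cyl \<tau>)) B"
    and iK: "integrable (lebesgue_on (cyl \<tau>)) K" and iD: "integrable (lebesgue_on (cyl \<tau>)) D"
    and sh: "integrable (lebesgue_on cell) (\<lambda>x. h (\<tau>, x))" and sP: "integrable (lebesgue_on cell) (\<lambda>x. P (\<tau>, x))"
    and se: "integrable (lebesgue_on cell) (\<lambda>x. e (\<tau>, x))"
    and mass\<tau>: "\<And>\<psi>. C1_torus T \<psi> \<Longrightarrow>
      (\<integral>z. dt T \<psi> z * h z + grad_x \<psi> z \<bullet> P z \<partial>lebesgue_on (cyl \<tau>)) +
      (\<integral>x. \<psi> (0, x) * H (0, x) - \<psi> (\<tau>, x) * h (\<tau>, x) \<partial>lebesgue_on cell) = 0"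
    and mom\<tau>: "(\<integral>z. dt T U z \<bullet> P z \<partial>lebesgue_on (cyl \<tau>)) + bar_integral (cyl \<tau>) \<nu> m \<nu>inf convection J +
        \<kappa> * bar_integral (cyl \<tau>) \<nu> m \<nu>inf (h_power \<gamma>) \<delta> + (\<integral>z. U z \<bullet> K z \<partial>lebesgue_on (cyl \<tau>)) +
        (\<integral>x. U (0, x) \<bullet> (H (0, x) *\<^sub>R U (0, x)) - U (\<tau>, x) \<bullet> P (\<tau>, x) \<partial>lebesgue_on cell) = 0"
    and en: "(\<integral>x. e (\<tau>, x) \<partial>lebesgue_on cell) + k \<le> E0 + (\<integral>z. D z \<partial>lebesgue_on (cyl \<tau>))"
  shows "(\<integral>x. X (\<tau>, x) \<partial>lebesgue_on cell) + k
    \<le> (\<integral>z. Q z \<partial>lebesgue_on (cyl \<tau>)) + (\<beta> + \<kappa> * \<beta>) * measure m (cyl \<tau>)"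
proof -
  have \<tau>': "\<tau> \<le> T" "0 \<in> {0..T}" "\<tau> \<in> {0..T}" using \<tau> by auto
  note inn = integrable_inner_continuous_cyl[OF _ _ \<tau>'(1)]
  note mul = integrable_inner_continuous_cyl[where 'b = real, OF _ _ \<tau>'(1), unfolded inner_real_def]
  note inn\<tau> = integrable_inner_continuous_cell[OF _ _ \<tau>'(3)]
  have s0: "integrable (lebesgue_on cell) (\<lambda>x. f (0, x))" if "continuous_on (slab T) f" for f :: "real \<times> (real^'n) \<Rightarrow> real"
    by (rule continuous_slab_integrable_cell[OF that \<tau>'(2)])
  have H0: "integrable (lebesgue_on cell) (\<lambda>x. H (0, x))" by (rule s0[OF Hcont])
  note M = mass_balance_lipschitz[OF T \<tau> ih iP sh H0 mass\<tau> \<psi>lip differentiable_AE(1)]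
  note FF = F_balance[OF \<tau>]
  define c1 where "c1 = bar_integral (cyl \<tau>) \<nu> m \<nu>inf convection J - (\<integral>z. J z \<bullet> C z \<partial>lebesgue_on (cyl \<tau>))"
  define c2 where "c2 = bar_integral (cyl \<tau>) \<nu> m \<nu>inf (h_power \<gamma>) \<delta> - (\<integral>z. \<delta> z * B z \<partial>lebesgue_on (cyl \<tau>))"
  have c12: "\<bar>c1\<bar> \<le> \<beta> * measure m (cyl \<tau>)" "\<bar>c2\<bar> \<le> \<beta> * measure m (cyl \<tau>)"
    unfolding c1_def c2_def using concentration_bound[OF \<tau>'(1) \<beta>] by blast+
  have i1: "integrable (lebesgue_on (cyl \<tau>)) (\<lambda>z. dt T U z \<bullet> P z)" by (rule inn[OF iP Utcont])
  have i2: "integrable (lebesgue_on (cyl \<tau>)) (\<lambda>z. J z \<bullet> C z)" by (rule inn[OF iC Jcont])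
  have i3: "integrable (lebesgue_on (cyl \<tau>)) (\<lambda>z. \<delta> z * B z)" by (rule mul[OF iB \<delta>cont])
  have i4: "integrable (lebesgue_on (cyl \<tau>)) (\<lambda>z. U z \<bullet> K z)" by (rule inn[OF iK Ucont])
  have iQ: "integrable (lebesgue_on (cyl \<tau>)) Q"
    unfolding Q_def
    by (intro Bochner_Integration.integrable_add inn mul ih iP iC iB continuous_slab_integrable_cyl[OF _ \<tau>'(1)]
        continuous_on_minus continuous_on_add continuous_on_diff continuous_on_mult continuous_on_const continuous_on_inner
        Jcont JUcont UJcont Ucont \<delta>cont powr_cont)
  \<comment> \<open>\<open>Z\<close> collects what all balance laws contribute in the interior; the source inequality turns it into \<open>Q\<close>\<close>
  define Y1 where "Y1 z = dt T \<psi> z * h z + grad_x \<psi> z \<bullet> P z" for z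
  define Y2 where "Y2 z = dt T F z + (\<Sum>j\<in>UNIV. dx j (\<lambda>w. F w * U w $ j) z)" for z
  have iY: "integrable (lebesgue_on (cyl \<tau>)) Y1" "integrable (lebesgue_on (cyl \<tau>)) Y2"
    unfolding Y1_def Y2_def using M(1) FF(1) by blast+
  define Z where "Z z = D z - U z \<bullet> K z - dt T U z \<bullet> P z - J z \<bullet> C z - \<kappa> * (\<delta> z * B z) + Y1 z + Y2 z" for z
  have iZ: "integrable (lebesgue_on (cyl \<tau>)) Z"
    unfolding Z_def using i1 i2 i3 i4 iD iY by auto
  have Zint: "(\<integral>z. Z z \<partial>lebesgue_on (cyl \<tau>)) = (\<integral>z. D z \<partial>lebesgue_on (cyl \<tau>)) - (\<integral>z. U z \<bullet> K z \<partial>lebesgue_on (cyl \<tau>))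
      - (\<integral>z. dt T U z \<bullet> P z \<partial>lebesgue_on (cyl \<tau>)) - (\<integral>z. J z \<bullet> C z \<partial>lebesgue_on (cyl \<tau>))
      - \<kappa> * (\<integral>z. \<delta> z * B z \<partial>lebesgue_on (cyl \<tau>)) + (\<integral>z. Y1 z \<partial>lebesgue_on (cyl \<tau>)) + (\<integral>z. Y2 z \<partial>lebesgue_on (cyl \<tau>))"
    unfolding Z_def using i1 i2 i3 i4 iD iY by simp
  have ZQ: "(\<integral>z. Z z \<partial>lebesgue_on (cyl \<tau>)) \<le> (\<integral>z. Q z \<partial>lebesgue_on (cyl \<tau>))"
  proof (rule integral_mono_AE[OF iZ iQ])
    have sub: "AE z in lebesgue_on (cyl \<tau>). R z" if "AE z in lebesgue_on (cyl T). R z" for R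
      using that cyl_mono[OF \<tau>'(1)] by (rule AE_lebesgue_on_subset) auto
    show "AE z in lebesgue_on (cyl \<tau>). Z z \<le> Q z"
      using sub[OF derivative_point_AE] sub[OF compat]
    proof eventually_elim
      case (elim z)
      then obtain DH DU where dp: "derivative_point T \<gamma> H U z DH DU"
        and eqs: "dt T H z + grad_x H z \<bullet> U z + H z * \<delta> z = 0"
        "dt T H z *\<^sub>R U z + H z *\<^sub>R dt T U z + ((grad_x H z \<bullet> U z) *\<^sub>R U z + H z *\<^sub>R (J z *v U z) + (H z * \<delta> z) *\<^sub>R U z)
          + (\<kappa> * \<gamma> * H z powr (\<gamma> - 1)) *\<^sub>R grad_x H z = H z *\<^sub>R g z"
        by blast
      interpret derivative_point T \<kappa> \<gamma> H U z DH DU by (rule dp)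
      have "Z z \<le> (P z - h z *\<^sub>R U z) \<bullet> g z - dt T U z \<bullet> P z - J z \<bullet> C z - \<kappa> * (\<delta> z * B z)
        + (U z \<bullet> dt T U z - \<kappa> * \<gamma> * H z powr (\<gamma> - 2) * dt T H z) * h z
        + (U z v* J z - (\<kappa> * \<gamma> * H z powr (\<gamma> - 2)) *\<^sub>R grad_x H z) \<bullet> P z
        + \<kappa> * \<gamma> * H z powr (\<gamma> - 1) * dt T H z + (\<kappa> * \<gamma> * H z powr (\<gamma> - 1) * (grad_x H z \<bullet> U z) + \<kappa> * H z powr \<gamma> * \<delta> z)"
        using elim(2) unfolding Z_def Y1_def Y2_def \<psi>t \<psi>x Ft divFU by linarith
      also have "\<dots> = Q z" unfolding pointwise_identity[OF Hpos eqs] Q_def ..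
      finally show "Z z \<le> Q z" .
    qed
  qed
  have sX: "(\<integral>x. X (\<tau>, x) \<partial>lebesgue_on cell) = (\<integral>x. e (\<tau>, x) \<partial>lebesgue_on cell) - (\<integral>x. U (\<tau>, x) \<bullet> P (\<tau>, x) \<partial>lebesgue_on cell)
      + (\<integral>x. \<psi> (\<tau>, x) * h (\<tau>, x) \<partial>lebesgue_on cell) + (\<integral>x. F (\<tau>, x) \<partial>lebesgue_on cell)"
  proof -
    have "X z = e z - U z \<bullet> P z + \<psi> z * h z + F z" for z by (simp add: X_def e_def)
    then show ?thesis
      using se inn\<tau>[OF sP Ucont] inn\<tau>[OF sh \<psi>cont] continuous_slab_integrable_cell[OF Fcont \<tau>'(3)] by simp
  qed
  have P0: "(\<integral>x. U (0, x) \<bullet> (H (0, x) *\<^sub>R U (0, x)) - U (\<tau>, x) \<bullet> P (\<tau>, x) \<partial>lebesgue_on cell)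
      = (\<integral>x. U (0, x) \<bullet> (H (0, x) *\<^sub>R U (0, x)) \<partial>lebesgue_on cell) - (\<integral>x. U (\<tau>, x) \<bullet> P (\<tau>, x) \<partial>lebesgue_on cell)"
    by (intro Bochner_Integration.integral_diff inn\<tau>[OF sP Ucont]
        s0[of "\<lambda>z. U z \<bullet> (H z *\<^sub>R U z)"] continuous_intros Ucont Hcont)
  have M0: "(\<integral>x. \<psi> (0, x) * H (0, x) - \<psi> (\<tau>, x) * h (\<tau>, x) \<partial>lebesgue_on cell)
      = (\<integral>x. \<psi> (0, x) * H (0, x) \<partial>lebesgue_on cell) - (\<integral>x. \<psi> (\<tau>, x) * h (\<tau>, x) \<partial>lebesgue_on cell)"
    using inn\<tau>[OF sh \<psi>cont] s0[of "\<lambda>z. \<psi> z * H z"] \<psi>cont Hcont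
    by (intro Bochner_Integration.integral_diff) (auto intro: continuous_on_mult)
  \<comment> \<open>the relative energy of the initial state with respect to itself\<close>
  have I0: "E0 - (\<integral>x. U (0, x) \<bullet> (H (0, x) *\<^sub>R U (0, x)) \<partial>lebesgue_on cell)
      + (\<integral>x. \<psi> (0, x) * H (0, x) \<partial>lebesgue_on cell) + (\<integral>x. F (0, x) \<partial>lebesgue_on cell) = 0"
  proof -
    have cs: "continuous_on (slab T) (\<lambda>z. 1/2 * H z * (norm (U z))\<^sup>2 + \<kappa> / (\<gamma> - 1) * H z powr \<gamma>)"
      "continuous_on (slab T) (\<lambda>z. U z \<bullet> (H z *\<^sub>R U z))" "continuous_on (slab T) (\<lambda>z. \<psi> z * H z)"
      by (intro continuous_on_add continuous_on_mult continuous_on_mult_left continuous_on_power continuous_on_norm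
          continuous_on_inner continuous_on_scaleR Hcont Ucont powr_cont \<psi>cont)+
    have "E0 - (\<integral>x. U (0, x) \<bullet> (H (0, x) *\<^sub>R U (0, x)) \<partial>lebesgue_on cell)
      + (\<integral>x. \<psi> (0, x) * H (0, x) \<partial>lebesgue_on cell) + (\<integral>x. F (0, x) \<partial>lebesgue_on cell)
      = (\<integral>x. (1/2 * H (0, x) * (norm (U (0, x)))\<^sup>2 + \<kappa> / (\<gamma> - 1) * H (0, x) powr \<gamma>) - U (0, x) \<bullet> (H (0, x) *\<^sub>R U (0, x))
          + \<psi> (0, x) * H (0, x) + F (0, x) \<partial>lebesgue_on cell)"
      unfolding E0_def using s0[OF cs(1)] s0[OF cs(2)] s0[OF cs(3)] s0[OF Fcont] by simp
    also have "\<dots> = (\<integral>x. 0 \<partial>lebesgue_on (cell :: (real^'n) set))"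
    proof (rule Bochner_Integration.integral_cong[OF refl])
      fix x
      have p: "H (0, x) powr \<gamma> = H (0, x) powr (\<gamma> - 1) * H (0, x)"
        using Hpos[of "(0, x)"] T powr_mult_base[of "H (0, x)" "\<gamma> - 1"] by (simp add: mult.commute)
      have k: "\<kappa> / (\<gamma> - 1) - \<kappa> * \<gamma> / (\<gamma> - 1) + \<kappa> = 0"
        using \<gamma> unfolding diff_divide_distrib[symmetric] by (simp add: divide_eq_eq algebra_simps add_eq_0_iff)
      have "(1/2 * H (0, x) * (norm (U (0, x)))\<^sup>2 + \<kappa> / (\<gamma> - 1) * H (0, x) powr \<gamma>) - U (0, x) \<bullet> (H (0, x) *\<^sub>R U (0, x))
          + \<psi> (0, x) * H (0, x) + F (0, x) = (\<kappa> / (\<gamma> - 1) - \<kappa> * \<gamma> / (\<gamma> - 1) + \<kappa>) * (H (0, x) powr (\<gamma> - 1) * H (0, x))"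
        unfolding energy_variable_def p power2_norm_eq_inner inner_scaleR_right by algebra
      then show "(1/2 * H (0, x) * (norm (U (0, x)))\<^sup>2 + \<kappa> / (\<gamma> - 1) * H (0, x) powr \<gamma>) - U (0, x) \<bullet> (H (0, x) *\<^sub>R U (0, x))
          + \<psi> (0, x) * H (0, x) + F (0, x) = 0" unfolding k by simp
    qed
    finally show ?thesis by simp
  qed
  have "- c1 - \<kappa> * c2 \<le> (\<beta> + \<kappa> * \<beta>) * measure m (cyl \<tau>)"
  proof -
    have "\<kappa> * (- c2) \<le> \<kappa> * (\<beta> * measure m (cyl \<tau>))" using c12(2) \<kappa> by (intro mult_left_mono) auto
    then show ?thesis using c12(1) by (simp add: distrib_right mult.assoc)
  qed
  moreover have "(\<integral>x. X (\<tau>, x) \<partial>lebesgue_on cell) + k \<le> (\<integral>z. Z z \<partial>lebesgue_on (cyl \<tau>)) - c1 - \<kappa> * c2"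
  proof -
    have "bar_integral (cyl \<tau>) \<nu> m \<nu>inf convection J = (\<integral>z. J z \<bullet> C z \<partial>lebesgue_on (cyl \<tau>)) + c1"
      "\<kappa> * bar_integral (cyl \<tau>) \<nu> m \<nu>inf (h_power \<gamma>) \<delta> = \<kappa> * (\<integral>z. \<delta> z * B z \<partial>lebesgue_on (cyl \<tau>)) + \<kappa> * c2"
      by (simp_all add: c1_def c2_def algebra_simps)
    then show ?thesis using mom\<tau> M(2)[folded Y1_def] FF(2)[folded Y2_def] en I0 unfolding sX Zint P0 M0 by linarith
  qed
  ultimately show ?thesis using ZQ by linarith
qed

end

section \<open>Weak-strong uniqueness\<close>

lemma AE_lebesgue_on_Icc_dense:
  fixes T s :: real
  assumes ae: "AE t in lebesgue_on {0..T}. R t" and s: "0 \<le> s" "s < T"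
  obtains t where "s < t" "t < T" "R t"
proof -
  have "AE t in lborel. t \<in> {0..T} \<longrightarrow> R t" using ae AE_lebesgue_on_iff[of "{0..T}" R] by simp
  then have "\<not> (\<forall>t. s < t \<longrightarrow> t < T \<longrightarrow> \<not> R t)"
  proof (rule contrapos_pn)
    assume a: "\<forall>t. s < t \<longrightarrow> t < T \<longrightarrow> \<not> R t"
    show "\<not> (AE t in lborel. t \<in> {0..T} \<longrightarrow> R t)"
    proof
      assume "AE t in lborel. t \<in> {0..T} \<longrightarrow> R t"
      then have "AE t in lborel. t \<notin> {s<..<T}" by eventually_elim (use a s in auto)
      then have "emeasure lborel {s<..<T} = 0" by (subst (asm) AE_iff_measurable[of "{s<..<T}"]) auto
      then show False using s by simp
    qed
  qed
  then show thesis using that by blast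
qed

text \<open>
  The integral identities are available up to almost every time, so statements are obtained first up to times
  arbitrarily close to \<open>T\<close>; countably many of these times exhaust the whole interval.
\<close>

lemma AE_lebesgue_on_exhaust:
  fixes A :: "real \<Rightarrow> 'a::euclidean_space set"
  assumes meas: "\<And>t. A t \<in> sets lebesgue"
    and ex: "\<And>s. 0 \<le> s \<Longrightarrow> s < T \<Longrightarrow> \<exists>t. s < t \<and> t < T \<and> (AE z in lebesgue_on (A t). R z)"
    and cover: "AE z in lborel. z \<in> A T \<longrightarrow> (\<exists>s. 0 \<le> s \<and> s < T \<and> (\<forall>t. s < t \<longrightarrow> z \<in> A t))" and T: "0 < T"
  shows "AE z in lebesgue_on (A T). R z"
proof -
  define s where "s k = max 0 (T - 1 / real (Suc k))" for k
  have s: "0 \<le> s k" "s k < T" for k using T by (auto simp: s_def)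
  have "\<forall>k. \<exists>t. s k < t \<and> t < T \<and> (AE z in lebesgue_on (A t). R z)" using ex[OF s] by blast
  then obtain t where t: "\<And>k. s k < t k" "\<And>k. t k < T" "\<And>k. AE z in lebesgue_on (A (t k)). R z" by metis
  have "AE z in lborel. \<forall>k. z \<in> A (t k) \<longrightarrow> R z"
    using t(3) unfolding AE_lebesgue_on_iff[OF meas] by (subst AE_all_countable) auto
  then show ?thesis unfolding AE_lebesgue_on_iff[OF meas] using cover
  proof eventually_elim
    case (elim z)
    show ?case
    proof
      assume "z \<in> A T"
      then obtain s' where s': "0 \<le> s'" "s' < T" "\<And>t. s' < t \<Longrightarrow> z \<in> A t" using elim(2) by blast
      obtain k where "1 / real (Suc k) < T - s'" using nat_approx_posE[of "T - s'"] s'(2) by auto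
      then have "s' < t k" using t(1)[of k] by (auto simp: s_def)
      then show "R z" using s'(3) elim(1) by blast
    qed
  qed
qed

lemma AE_cyl_exhaust:
  "AE z :: real \<times> (real^'n) in lborel. z \<in> cyl T \<longrightarrow> (\<exists>s. 0 \<le> s \<and> s < T \<and> (\<forall>t. s < t \<longrightarrow> z \<in> cyl t))"
proof -
  have "AE z :: real \<times> (real^'n) in lebesgue_on UNIV. fst z \<noteq> T" by (rule AE_fst_neq) auto
  then have "AE z :: real \<times> (real^'n) in lborel. fst z \<noteq> T"
    using AE_lebesgue_on_iff[of "UNIV :: (real \<times> (real^'n)) set" "\<lambda>z. fst z \<noteq> T"] by simp
  then show ?thesis
  proof eventually_elim
    case (elim z)
    then show ?case by (intro impI exI[of _ "fst z"]) (auto simp: cyl_def)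
  qed
qed

context weak_strong
begin

text \<open>
  Times up to which all averaged quantities are integrable.
\<close>

definition "horizon b \<longleftrightarrow> integrable (lebesgue_on (cyl b)) h \<and> integrable (lebesgue_on (cyl b)) P \<and>
  integrable (lebesgue_on (cyl b)) C \<and> integrable (lebesgue_on (cyl b)) B \<and> integrable (lebesgue_on (cyl b)) K \<and>
  (AE z in lebesgue_on (cyl b). moments_exist z)"

lemma horizon_AE: "AE b in lebesgue_on {0..T}. horizon b"
  using mass[unfolded mv_mass_balance_def] mom[unfolded mv_momentum_balance_def]
proof eventually_elim
  case (elim b)
  then have h: "has_moment (lebesgue_on (cyl b)) \<nu> (\<lambda>_. height)" "has_moment (lebesgue_on (cyl b)) \<nu> (\<lambda>_. momentum)"
    "has_moment (lebesgue_on (cyl b)) \<nu> (\<lambda>_. convection)" "has_moment (lebesgue_on (cyl b)) \<nu> (\<lambda>_. h_power \<gamma>)"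
    "integrable (lebesgue_on (cyl b)) K"
    by (auto simp: bar_exists_def)
  have "AE z in lebesgue_on (cyl b). moments_exist z"
    using h(1)[unfolded has_moment_def, THEN conjunct1] h(2)[unfolded has_moment_def, THEN conjunct1]
      h(3)[unfolded has_moment_def, THEN conjunct1] h(4)[unfolded has_moment_def, THEN conjunct1]
    unfolding moments_exist_def by eventually_elim blast
  then show ?case using h unfolding horizon_def has_moment_def h_bar_def[abs_def] hu_bar_def[abs_def] by blast
qed

text \<open>
  Let \<open>R t\<close> be the relative energy at time \<open>t\<close>, where the concentration part is replaced by its lower bound, a
  positive constant times the total mass. The flux term is bounded by the relative energy and the
  concentration term by the total mass, so \<open>R\<close> satisfies the hypotheses of Gronwall's lemma.
\<close>

lemma coincides_before_horizon:
  assumes b: "0 < b" "b < T" and hor: "horizon b"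
  shows "AE z in lebesgue_on (cyl b). \<nu> z = return (restrict_space borel phase) (H z, sqrt (H z) *\<^sub>R U z)"
    and "AE t in lebesgue_on {0..b}. measure (mt t) cell = 0"
proof -
  have bT: "b \<le> T" "0 \<le> b" using b by auto
  let ?c0 = "min (1/2) (\<kappa> / (\<gamma> - 1))"
  have c0: "0 < ?c0" using \<gamma> \<kappa> by simp
  obtain \<beta>1 where \<beta>1: "0 < \<beta>1" "\<And>z. z \<in> cyl T \<Longrightarrow> norm (J z) \<le> \<beta>1" using continuous_slab_bounded_cyl[OF Jcont] by blast
  obtain \<beta>2 where \<beta>2: "0 < \<beta>2" "\<And>z. z \<in> cyl T \<Longrightarrow> norm (\<delta> z) \<le> \<beta>2" using continuous_slab_bounded_cyl[OF \<delta>cont] by blast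
  define \<beta> where "\<beta> = max \<beta>1 \<beta>2"
  have \<beta>: "\<And>z. z \<in> cyl T \<Longrightarrow> norm (J z) \<le> \<beta>" "\<And>z. z \<in> cyl T \<Longrightarrow> \<bar>\<delta> z\<bar> \<le> \<beta>" "0 \<le> \<beta>"
    using \<beta>1 \<beta>2 by (force simp: \<beta>_def)+
  note hor' = hor[unfolded horizon_def]
  have mo: "AE z in lebesgue_on (cyl b). z \<in> cyl b \<and> moments_exist z" using hor' by (intro AE_lebesgue_on_mem) blast
  have sub: "integrable (lebesgue_on (cyl \<tau>)) f" if "integrable (lebesgue_on (cyl b)) f" "\<tau> \<le> b"
    for f :: "real \<times> (real^'n) \<Rightarrow> 'x::{banach, second_countable_topology}" and \<tau>
    using that(1) cyl_mono[OF that(2)] by (rule integrable_lebesgue_on_subset) auto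
  note inn = integrable_inner_continuous_cyl[OF _ _ bT(1)]
  note mul = integrable_inner_continuous_cyl[where 'b = real, OF _ _ bT(1), unfolded inner_real_def]
  have iC: "integrable (lebesgue_on (cyl b)) C" and iB: "integrable (lebesgue_on (cyl b)) B"
    and ih: "integrable (lebesgue_on (cyl b)) h" and iP: "integrable (lebesgue_on (cyl b)) P"
    using hor' by auto
  have ie: "integrable (lebesgue_on (cyl b)) e"
    unfolding e_def by (intro Bochner_Integration.integrable_add inn mul iC iB continuous_on_const)
  have iX: "integrable (lebesgue_on (cyl b)) X"
    unfolding X_def
    by (intro Bochner_Integration.integrable_add inn mul iC iB iP ih continuous_slab_integrable_cyl[OF Fcont bT(1)]
        continuous_on_const continuous_on_minus Ucont \<psi>cont)
  have iX': "integrable (lebesgue_on ({0..b} \<times> cell)) X" and ie': "integrable (lebesgue_on ({0..b} \<times> cell)) e"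
    using iX ie by (auto simp: cyl_def)
  have X0: "AE z in lebesgue_on (cyl b). 0 \<le> X z"
    using mo by eventually_elim (use cyl_mono[OF bT(1)] X_nonneg in blast)
  define R where "R t = (\<integral>x. X (t, x) \<partial>lebesgue_on cell) + ?c0 * measure (mt t) cell" for t
  have iXt: "integrable (lebesgue_on {0..b}) (\<lambda>t. \<integral>x. X (t, x) \<partial>lebesgue_on cell)"
    by (rule Fubini_lebesgue_on(2)[OF _ cell_borel iX']) auto
  have imt: "integrable (lebesgue_on {0..b}) (\<lambda>t. measure (mt t) cell)"
    by (rule integrable_lebesgue_on_subset[OF disintegration_total_mass(1)[OF dis m]]) (use bT in auto)
  have iR: "integrable (lebesgue_on {0..b}) R" unfolding R_def using iXt imt by auto
  have X0s: "AE t in lebesgue_on {0..b}. 0 \<le> (\<integral>x. X (t, x) \<partial>lebesgue_on cell)"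
  proof -
    have "AE t in lebesgue_on {0..b}. AE x in lebesgue_on cell. 0 \<le> X (t, x)"
      using X0 unfolding cyl_def by (intro AE_lebesgue_on_Times) auto
    then show ?thesis by eventually_elim (rule integral_nonneg_AE)
  qed
  have R0: "AE t in lebesgue_on {0..b}. 0 \<le> R t"
    using X0s by eventually_elim (use c0 in \<open>auto simp: R_def\<close>)
  \<comment> \<open>division by \<open>?c0\<close> because the total mass enters \<open>R\<close> with the weight \<open>?c0\<close>\<close>
  define \<Lambda> where "\<Lambda> = \<beta> * (\<gamma> + 1) + (\<beta> + \<kappa> * \<beta>) / ?c0"
  have pos: "0 \<le> \<beta> * (\<gamma> + 1)" "0 \<le> \<beta> + \<kappa> * \<beta>" "0 \<le> (\<beta> + \<kappa> * \<beta>) / ?c0" using \<beta>(3) \<gamma> \<kappa> c0 by auto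
  have \<Lambda>: "0 \<le> \<Lambda>" using pos by (simp add: \<Lambda>_def)
  have main: "AE \<tau> in lebesgue_on {0..b}. R \<tau> \<le> \<Lambda> * (\<integral>s. R s \<partial>lebesgue_on {0..\<tau>})"
  proof -
    have res: "AE t in lebesgue_on {0..b}. Y t" if "AE t in lebesgue_on {0..T}. Y t" for Y
      using that by (rule AE_lebesgue_on_subset) (use bT in auto)
    have mtM: "AE t in lebesgue_on {0..T}. mt t \<in> Mplus cell" using dis by (simp add: disintegration_def)
    have mos: "AE t in lebesgue_on {0..b}. AE x in lebesgue_on cell. moments_exist (t, x)"
      using hor' unfolding cyl_def by (intro AE_lebesgue_on_Times) auto
    have es: "AE t in lebesgue_on {0..b}. integrable (lebesgue_on cell) (\<lambda>x. e (t, x))"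
      by (rule Fubini_lebesgue_on(1)[OF _ cell_borel ie']) auto
    from res[OF mass[unfolded mv_mass_balance_def]] res[OF mom[unfolded mv_momentum_balance_def]]
      res[OF energy] res[OF mtM] mos es AE_space
    show ?thesis
    proof eventually_elim
      case (elim \<tau>)
      have \<tau>: "0 \<le> \<tau>" "\<tau> \<le> b" "\<tau> < T" using elim(7) b by auto
      have en: "(\<integral>x. e (\<tau>, x) \<partial>lebesgue_on cell) + ?c0 * measure (mt \<tau>) cell \<le> E0 + (\<integral>z. D z \<partial>lebesgue_on (cyl \<tau>))"
        using energy_real[OF \<tau>(1) less_imp_le[OF \<tau>(3)] _ elim(6,5,4)] elim(3) by blast
      have st: "R \<tau> \<le> (\<integral>z. Q z \<partial>lebesgue_on (cyl \<tau>)) + (\<beta> + \<kappa> * \<beta>) * measure m (cyl \<tau>)"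
        unfolding R_def
      proof (rule relative_energy_inequality[OF \<tau>(1,3) \<beta> sub[OF ih \<tau>(2)] sub[OF iP \<tau>(2)] sub[OF iC \<tau>(2)] sub[OF iB \<tau>(2)]])
        show "integrable (lebesgue_on (cyl \<tau>)) K" "integrable (lebesgue_on (cyl \<tau>)) D" using elim(2,3) by auto
        show "integrable (lebesgue_on cell) (\<lambda>x. h (\<tau>, x))" "integrable (lebesgue_on cell) (\<lambda>x. P (\<tau>, x))"
          using elim(1,2) by (auto simp: has_moment_def h_bar_def hu_bar_def)
        show "integrable (lebesgue_on cell) (\<lambda>x. e (\<tau>, x))" by (rule elim(6))
      qed (use elim(1,2) U en in \<open>blast+\<close>)
      have mo\<tau>: "AE z in lebesgue_on (cyl \<tau>). z \<in> cyl b \<and> moments_exist z"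
        using mo cyl_mono[OF \<tau>(2)] by (rule AE_lebesgue_on_subset) auto
      have iX\<tau>: "integrable (lebesgue_on (cyl \<tau>)) X" by (rule sub[OF iX \<tau>(2)])
      have "(\<integral>z. Q z \<partial>lebesgue_on (cyl \<tau>)) \<le> \<beta> * (\<gamma> + 1) * (\<integral>z. X z \<partial>lebesgue_on (cyl \<tau>))"
      proof (cases "integrable (lebesgue_on (cyl \<tau>)) Q")
        case True
        have "(\<integral>z. Q z \<partial>lebesgue_on (cyl \<tau>)) \<le> (\<integral>z. \<beta> * (\<gamma> + 1) * X z \<partial>lebesgue_on (cyl \<tau>))"
        proof (rule integral_mono_AE[OF True])
          show "AE z in lebesgue_on (cyl \<tau>). Q z \<le> \<beta> * (\<gamma> + 1) * X z"
            using mo\<tau> by eventually_elim (use cyl_mono[OF bT(1)] \<beta> in \<open>blast intro: Q_le_X\<close>)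
        qed (use iX\<tau> in auto)
        then show ?thesis by simp
      next
        case False
        have "AE z in lebesgue_on (cyl \<tau>). 0 \<le> X z"
          using mo\<tau> by eventually_elim (use cyl_mono[OF bT(1)] X_nonneg in blast)
        then show ?thesis using pos(1) by (simp add: not_integrable_integral_eq[OF False] integral_nonneg_AE)
      qed
      also have "(\<integral>z. X z \<partial>lebesgue_on (cyl \<tau>)) = (\<integral>t. \<integral>x. X (t, x) \<partial>lebesgue_on cell \<partial>lebesgue_on {0..\<tau>})"
        using Fubini_lebesgue_on(3)[of "{0..\<tau>}" cell X] iX\<tau> by (simp add: cyl_def)
      finally have q: "(\<integral>z. Q z \<partial>lebesgue_on (cyl \<tau>)) \<le> \<beta> * (\<gamma> + 1) * (\<integral>t. \<integral>x. X (t, x) \<partial>lebesgue_on cell \<partial>lebesgue_on {0..\<tau>})" .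
      define x where "x = (\<integral>t. \<integral>x. X (t, x) \<partial>lebesgue_on cell \<partial>lebesgue_on {0..\<tau>})"
      define y where "y = (\<integral>t. measure (mt t) cell \<partial>lebesgue_on {0..\<tau>})"
      have my: "measure m (cyl \<tau>) = y"
        unfolding y_def using disintegration_total_mass(2)[OF dis m \<tau>(1)] \<tau> by auto
      have i\<tau>: "integrable (lebesgue_on {0..\<tau>}) (\<lambda>t. \<integral>x. X (t, x) \<partial>lebesgue_on cell)"
        "integrable (lebesgue_on {0..\<tau>}) (\<lambda>t. measure (mt t) cell)"
        using \<tau> by (auto intro!: integrable_lebesgue_on_subset[OF iXt] integrable_lebesgue_on_subset[OF imt])
      have Rxy: "(\<integral>s. R s \<partial>lebesgue_on {0..\<tau>}) = x + ?c0 * y"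
        unfolding R_def x_def y_def using i\<tau> by simp
      have x0: "0 \<le> x" unfolding x_def
        using \<tau> by (intro integral_nonneg_AE AE_lebesgue_on_subset[OF X0s]) auto
      have y0: "0 \<le> y" unfolding y_def by (intro integral_nonneg_AE AE_I2) auto
      have "R \<tau> \<le> \<beta> * (\<gamma> + 1) * x + (\<beta> + \<kappa> * \<beta>) * y" using st q unfolding my x_def[symmetric] by linarith
      also have "(\<beta> + \<kappa> * \<beta>) * y = (\<beta> + \<kappa> * \<beta>) / ?c0 * (?c0 * y)" using c0 by simp
      also have "\<beta> * (\<gamma> + 1) * x + (\<beta> + \<kappa> * \<beta>) / ?c0 * (?c0 * y) \<le> \<Lambda> * x + \<Lambda> * (?c0 * y)"
        using pos x0 y0 c0 unfolding \<Lambda>_def by (intro add_mono mult_right_mono) auto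
      also have "\<dots> = \<Lambda> * (\<integral>s. R s \<partial>lebesgue_on {0..\<tau>})" unfolding Rxy by (simp add: distrib_left)
      finally show ?case .
    qed
  qed
  have "AE t in lebesgue_on {0..b}. R t = 0" by (rule gronwall_L1[OF iR \<Lambda> R0 main])
  then have z: "AE t in lebesgue_on {0..b}. (\<integral>x. X (t, x) \<partial>lebesgue_on cell) = 0 \<and> measure (mt t) cell = 0"
    using X0s
  proof eventually_elim
    case (elim t)
    have "0 \<le> ?c0 * measure (mt t) cell" using c0 by simp
    then have "(\<integral>x. X (t, x) \<partial>lebesgue_on cell) = 0" "?c0 * measure (mt t) cell = 0"
      using elim unfolding R_def by linarith+
    then show ?case using c0 by simp
  qed
  then show "AE t in lebesgue_on {0..b}. measure (mt t) cell = 0" by eventually_elim simp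
  have "(\<integral>z. X z \<partial>lebesgue_on (cyl b)) = (\<integral>t. \<integral>x. X (t, x) \<partial>lebesgue_on cell \<partial>lebesgue_on {0..b})"
    using Fubini_lebesgue_on(3)[OF _ cell_borel iX'] by (simp add: cyl_def)
  also have "\<dots> = 0"
  proof (rule integral_eq_zero_AE)
    show "AE t in lebesgue_on {0..b}. (\<integral>x. X (t, x) \<partial>lebesgue_on cell) = 0" using z by eventually_elim simp
  qed
  finally have "AE z in lebesgue_on (cyl b). X z = 0"
    using integral_nonneg_eq_0_iff_AE[OF iX X0] by simp
  then show "AE z in lebesgue_on (cyl b). \<nu> z = return (restrict_space borel phase) (H z, sqrt (H z) *\<^sub>R U z)"
    using mo by eventually_elim (use cyl_mono[OF bT(1)] X_eq_0 in blast)
qed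

theorem coincidence: "coincides T \<nu> m H U"
proof -
  have ex: "\<exists>b. s < b \<and> b < T \<and> horizon b" if "0 \<le> s" "s < T" for s
    using AE_lebesgue_on_Icc_dense[OF horizon_AE that] by blast
  have ae1: "AE z in lebesgue_on (cyl T). \<nu> z = return (restrict_space borel phase) (H z, sqrt (H z) *\<^sub>R U z)"
  proof (rule AE_lebesgue_on_exhaust[OF _ _ _ T])
    show "\<exists>t. s < t \<and> t < T \<and> (AE z in lebesgue_on (cyl t). \<nu> z = return (restrict_space borel phase) (H z, sqrt (H z) *\<^sub>R U z))"
      if "0 \<le> s" "s < T" for s
      using ex[OF that] coincides_before_horizon(1) that by (meson order_le_less_trans)
    show "AE z :: real \<times> (real^'n) in lborel. z \<in> cyl T \<longrightarrow> (\<exists>s. 0 \<le> s \<and> s < T \<and> (\<forall>t. s < t \<longrightarrow> z \<in> cyl t))"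
      by (rule AE_cyl_exhaust)
  qed auto
  have ae2: "AE t in lebesgue_on {0..T}. measure (mt t) cell = 0"
  proof (rule AE_lebesgue_on_exhaust[where A = "\<lambda>t. {0..t}", OF _ _ _ T])
    show "\<exists>t. s < t \<and> t < T \<and> (AE t in lebesgue_on {0..t}. measure (mt t) cell = 0)"
      if "0 \<le> s" "s < T" for s
      using ex[OF that] coincides_before_horizon(2) that by (meson order_le_less_trans)
    have "AE t :: real in lborel. t \<noteq> T" by (rule AE_lborel_singleton)
    then show "AE z in lborel. z \<in> {0..T} \<longrightarrow> (\<exists>s. 0 \<le> s \<and> s < T \<and> (\<forall>t. s < t \<longrightarrow> z \<in> {0..t}))"
    proof eventually_elim
      case (elim z)
      then show ?case by (intro impI exI[of _ z]) auto
    qed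
  qed auto
  have "measure m (cyl T) = (\<integral>t. measure (mt t) cell \<partial>lebesgue_on {0..T})"
    using disintegration_total_mass(2)[OF dis m] T by auto
  also have "\<dots> = 0" using ae2 by (rule integral_eq_zero_AE)
  finally have m0: "measure m (cyl T) = 0" .
  interpret finite_measure m using m by (simp add: Mplus_def)
  have sm: "sets m = sets (restrict_space borel (cyl T))" using m by (simp add: Mplus_def)
  then have sp: "space m = cyl T" using sets_eq_imp_space_eq[OF sm] by (simp add: space_restrict_space)
  have "m = null_measure (restrict_space borel (cyl T))"
  proof (rule measure_eqI)
    fix A assume "A \<in> sets m"
    have "emeasure m A \<le> emeasure m (space m)" by (rule emeasure_space)
    also have "\<dots> = 0" using m0 by (simp add: emeasure_eq_measure sp)
    finally show "emeasure m A = emeasure (null_measure (restrict_space borel (cyl T))) A" by simp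
  qed (use sm in simp)
  with ae1 show ?thesis by (simp add: coincides_def)
qed

end

section \<open>The Euler and Savage-Hutter systems\<close>

text \<open>
  Both sources are linear in the momentum and the height here, so the comparison of sources holds with
  equality.
\<close>

theorem euler_coincidence:
  fixes T c \<kappa> \<gamma> :: real and G :: "real \<times> (real^'n) \<Rightarrow> real^'n"
  assumes "0 < T" "0 < c" "1 < \<gamma>" "0 < \<kappa>"
    and H: "lipschitz_torus T H" "\<And>z. z \<in> slab T \<Longrightarrow> c \<le> H z" and U: "C1_torus T U"
    and sol: "euler_solution T \<kappa> \<gamma> G H U"
    and mv: "euler_mv_solution T \<kappa> \<gamma> G (\<lambda>x. H (0, x)) (\<lambda>x. U (0, x)) \<nu> m \<nu>inf"
    and adm: "euler_admissible T \<kappa> \<gamma> G (\<lambda>x. H (0, x)) (\<lambda>x. U (0, x)) \<nu> m \<nu>inf"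
  shows "coincides T \<nu> m H U"
proof -
  obtain mt where mt: "disintegration T m mt"
    "AE t in lebesgue_on {0..T}. integrable (lebesgue_on (cyl t)) (\<lambda>z. hu_bar \<nu> z \<bullet> G z) \<and>
      enn2ereal (energy_mvs \<kappa> \<gamma> \<nu> mt \<nu>inf t) \<le>
        enn2ereal (energy_0 \<kappa> \<gamma> (\<lambda>x. H (0, x)) (\<lambda>x. U (0, x))) + ereal (\<integral>z. hu_bar \<nu> z \<bullet> G z \<partial>lebesgue_on (cyl t))"
    using adm unfolding euler_admissible_def by blast
  note mv' = mv[unfolded euler_mv_solution_def gen_young_measure_def]
  have \<nu>: "\<nu> \<in> Linf_w (lebesgue_on (cyl T)) phase" using mv' by blast
  interpret weak_strong T c \<kappa> \<gamma> H U \<nu> m \<nu>inf mt "\<lambda>z. h_bar \<nu> z *\<^sub>R G z" "\<lambda>z. hu_bar \<nu> z \<bullet> G z" G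
  proof
    show "strong_balance T \<kappa> \<gamma> (\<lambda>z. H z *\<^sub>R G z) H U" using sol by (simp add: euler_solution_def)
    show "prob_space (\<nu> z) \<and> sets (\<nu> z) = sets (restrict_space borel phase)" if "z \<in> cyl T" for z
      using Linf_w_prob[OF \<nu>, of z] that by simp
    show "AE z in lebesgue_on (cyl T). hu_bar \<nu> z \<bullet> G z - U z \<bullet> (h_bar \<nu> z *\<^sub>R G z) \<le> (hu_bar \<nu> z - h_bar \<nu> z *\<^sub>R U z) \<bullet> G z"
      by (simp add: inner_diff_left)
  qed (use assms mv' mt in blast)+
  show ?thesis by (rule coincidence)
qed

text \<open>
  The proximal map of \<open>\<lambda>v. d * norm v\<close>; up to the shift by \<open>f\<close> it is the resolvent of the friction.
\<close>

definition soft_threshold :: "real \<Rightarrow> 'a::real_normed_vector \<Rightarrow> 'a" where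
  "soft_threshold d x = (if norm x \<le> d then 0 else (1 - d / norm x) *\<^sub>R x)"

text \<open>
  If \<open>v \<noteq> 0\<close> then \<open>x\<close> is \<open>v\<close> lengthened by \<open>d\<close>, and otherwise \<open>x\<close> lies in the ball of radius \<open>d\<close>; the two
  alternatives are told apart by \<open>norm x\<close>, which makes the resolvent single-valued.
\<close>

lemma resolvent_B_abs:
  assumes d: "0 < d"
  shows "(\<exists>b\<in>B_abs v. x = v + d *\<^sub>R b) \<longleftrightarrow> v = soft_threshold d x"
proof
  assume "\<exists>b\<in>B_abs v. x = v + d *\<^sub>R b"
  then obtain b where b: "b \<in> B_abs v" "x = v + d *\<^sub>R b" by blast
  show "v = soft_threshold d x"
  proof (cases "v = 0")
    case True
    then have "norm b \<le> 1" using b(1) by (simp add: B_abs_def)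
    then have "norm x \<le> d" using b(2) True d by (simp add: mult_left_le)
    then show ?thesis using True by (simp add: soft_threshold_def)
  next
    case False
    then have "x = (1 + d / norm v) *\<^sub>R v"
      using b by (simp add: B_abs_def scaleR_add_left divide_inverse)
    moreover from this have n: "norm x = norm v + d"
      using False d by (simp add: abs_of_pos add_pos_pos distrib_right)
    ultimately have "(1 - d / norm x) *\<^sub>R x = ((1 - d / (norm v + d)) * (1 + d / norm v)) *\<^sub>R v" by simp
    also have "(1 - d / (norm v + d)) * (1 + d / norm v) = 1"
    proof -
      have nv: "0 < norm v" using False by simp
      then have nvd: "norm v + d \<noteq> 0" using d by linarith
      have "1 - d / (norm v + d) = norm v / (norm v + d)" using nvd by (simp add: field_simps)
      moreover have "1 + d / norm v = (norm v + d) / norm v" using nv by (simp add: field_simps)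
      ultimately show ?thesis using nv nvd by simp
    qed
    finally show ?thesis using n d False by (simp add: soft_threshold_def)
  qed
next
  assume v: "v = soft_threshold d x"
  show "\<exists>b\<in>B_abs v. x = v + d *\<^sub>R b"
  proof (cases "norm x \<le> d")
    case True
    then show ?thesis using v d
      by (intro bexI[of _ "x /\<^sub>R d"]) (auto simp: soft_threshold_def B_abs_def field_simps)
  next
    case False
    then have nx: "d < norm x" "x \<noteq> 0" using d by auto
    then have p: "0 < 1 - d / norm x" by simp
    have vx: "v = (1 - d / norm x) *\<^sub>R x" using v False by (simp add: soft_threshold_def)
    have "v \<noteq> 0" using vx p nx by simp
    moreover have "v /\<^sub>R norm v = x /\<^sub>R norm x" 
    proof -
      have "(r *\<^sub>R x) /\<^sub>R norm (r *\<^sub>R x) = x /\<^sub>R norm x" if "0 < r" for r using that by simp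
      from this[OF p] show ?thesis unfolding vx .
    qed
    ultimately have B: "x /\<^sub>R norm x \<in> B_abs v" by (simp add: B_abs_def)
    have "x = v + d *\<^sub>R (x /\<^sub>R norm x)" unfolding vx by (simp add: scaleR_diff_left divide_inverse)
    with B show ?thesis by blast
  qed
qed

lemma J_res_eq:
  assumes "0 < d"
  shows "J_res d f z w = soft_threshold d (w + f z)"
proof -
  have "(\<exists>g\<in>f_tilde d f z v. w = v - g) \<longleftrightarrow> v = soft_threshold d (w + f z)" for v
  proof -
    have "(\<exists>g\<in>f_tilde d f z v. w = v - g) \<longleftrightarrow> (\<exists>b\<in>B_abs v. w = v - (- d *\<^sub>R b + f z))"
      unfolding f_tilde_def by auto
    also have "\<dots> \<longleftrightarrow> (\<exists>b\<in>B_abs v. w + f z = v + d *\<^sub>R b)"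
      by (auto simp: algebra_simps)
    also have "\<dots> \<longleftrightarrow> v = soft_threshold d (w + f z)" by (rule resolvent_B_abs[OF assms])
    finally show ?thesis .
  qed
  then show ?thesis unfolding J_res_def by simp
qed

lemma B_abs_norm: "b \<in> B_abs v \<Longrightarrow> norm b \<le> 1"
  by (auto simp: B_abs_def split: if_splits)

lemma B_abs_inner: "b \<in> B_abs v \<Longrightarrow> v \<bullet> b = norm v"
  by (auto simp: B_abs_def power2_norm_eq_inner[symmetric] power2_eq_square split: if_splits)

lemma J_res_selection:
  assumes "0 < d"
  obtains b where "norm b \<le> 1" "J_res d f z w - w = - d *\<^sub>R b + f z"
proof -
  obtain b where "b \<in> B_abs (J_res d f z w)" "w + f z = J_res d f z w + d *\<^sub>R b"
    using resolvent_B_abs[OF assms, of "J_res d f z w" "w + f z"] J_res_eq[OF assms] by blast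
  then show thesis using that[of b] B_abs_norm by (auto simp: algebra_simps)
qed

lemma push_J_measurable:
  assumes "0 < d" "sets M = sets (restrict_space borel phase)"
  shows "(\<lambda>(l1, w). (l1, J_res d f z w)) \<in> measurable M (restrict_space borel (phase :: (real \<times> (real^'n)) set))"
proof -
  have "(\<lambda>l. (fst l, soft_threshold d (snd l + f z))) \<in> borel_measurable (borel :: (real \<times> (real^'n)) measure)"
    unfolding soft_threshold_def by (intro borel_measurable_Pair) (simp_all add: borel_prod[symmetric])
  then have "(\<lambda>l. (fst l, soft_threshold d (snd l + f z))) \<in> measurable (restrict_space borel phase) (restrict_space borel (phase :: (real \<times> (real^'n)) set))"
    by (intro measurable_restrict_space3) (auto simp: phase_def)
  then show ?thesis unfolding measurable_cong_sets[OF assms(2) refl]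
    by (simp add: split_beta J_res_eq[OF assms(1)])
qed

text \<open>
  With \<open>s = sqrt l\<close> the left-hand side equals \<open>- d * s * ((norm p - p \<bullet> c) + s * (U \<bullet> c - U \<bullet> b))\<close>. Both
  brackets are nonnegative because \<open>b\<close> and \<open>c\<close> have norm at most 1 and \<open>U \<bullet> c = norm U\<close>: the friction of the
  classical solution is the most dissipative one in the direction of \<open>U\<close>.
\<close>

lemma friction_monotone:
  fixes p U f b c :: "real^'n"
  assumes d: "0 < d" and l: "0 \<le> l" and b: "norm b \<le> 1" and c: "c \<in> B_abs U"
  shows "- (sqrt l * (d * norm p - f \<bullet> p)) - U \<bullet> (l *\<^sub>R (- d *\<^sub>R b + f))
    - (sqrt l *\<^sub>R p - l *\<^sub>R U) \<bullet> (- d *\<^sub>R c + f) \<le> 0"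
proof -
  define s where "s = sqrt l"
  have s: "0 \<le> s" "l = s * s" using l by (auto simp: s_def)
  have 1: "p \<bullet> c \<le> norm p" using norm_cauchy_schwarz[of p c] B_abs_norm[OF c] mult_left_le[of "norm c" "norm p"] by simp
  have 2: "U \<bullet> b \<le> U \<bullet> c" unfolding B_abs_inner[OF c] using norm_cauchy_schwarz[of U b] b mult_left_le[of "norm b" "norm U"] by simp
  have "- (s * (d * norm p - f \<bullet> p)) - U \<bullet> ((s * s) *\<^sub>R (- d *\<^sub>R b + f)) - (s *\<^sub>R p - (s * s) *\<^sub>R U) \<bullet> (- d *\<^sub>R c + f)
    = - (d * s * ((norm p - p \<bullet> c) + s * (U \<bullet> c - U \<bullet> b)))"
    by (simp add: inner_add_right inner_diff_left inner_commute[of f p]) (simp add: algebra_simps)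
  also have "\<dots> \<le> 0" using d s 1 2 by simp
  finally show ?thesis unfolding s_def[symmetric] s(2)[symmetric] .
qed

text \<open>
  The average of \<open>friction_monotone\<close>. Moments of the push-forward are rewritten as integrals against \<open>\<mu> z\<close>, since
  the selection from the friction is a function of the variable \<open>w\<close> before the resolvent is applied.
\<close>

lemma push_J_compat:
  fixes f :: "real \<times> (real^'n) \<Rightarrow> real^'n"
  assumes d: "0 < d" and \<mu>: "prob_space (\<mu> z)" "sets (\<mu> z) = sets (restrict_space borel phase)"
    and c: "c \<in> B_abs U"
    and ih: "integrable (push_J d f \<mu> z) height" and iP: "integrable (push_J d f \<mu> z) momentum"
    and iD: "integrable (push_J d f \<mu> z) (dissipation d f z)" and iK: "integrable (\<mu> z) (friction d f z)"
  shows "- integral\<^sup>L (push_J d f \<mu> z) (dissipation d f z) - U \<bullet> integral\<^sup>L (\<mu> z) (friction d f z)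
    \<le> (hu_bar (push_J d f \<mu>) z - h_bar (push_J d f \<mu>) z *\<^sub>R U) \<bullet> (- d *\<^sub>R c + f z)"
proof -
  define \<phi> where "\<phi> = (\<lambda>(l1, w). (l1 :: real, J_res d f z w))"
  have \<phi>: "\<phi> \<in> measurable (\<mu> z) (restrict_space borel phase)"
    unfolding \<phi>_def by (rule push_J_measurable[OF d \<mu>(2)])
  have pd: "push_J d f \<mu> z = distr (\<mu> z) (restrict_space borel phase) \<phi>" by (simp add: push_J_def \<phi>_def)
  have mh: "height \<in> borel_measurable (restrict_space borel (phase :: (real \<times> (real^'n)) set))"
    "momentum \<in> borel_measurable (restrict_space borel (phase :: (real \<times> (real^'n)) set))"
    "dissipation d f z \<in> borel_measurable (restrict_space borel (phase :: (real \<times> (real^'n)) set))"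
    by (auto intro!: measurable_restrict_space1 simp: height_def momentum_def dissipation_def split_beta borel_prod[symmetric])
  have ih': "integrable (\<mu> z) (\<lambda>l. height (\<phi> l))" and iP': "integrable (\<mu> z) (\<lambda>l. momentum (\<phi> l))"
    and iD': "integrable (\<mu> z) (\<lambda>l. dissipation d f z (\<phi> l))"
    using ih iP iD integrable_distr_eq[OF \<phi> mh(1)] integrable_distr_eq[OF \<phi> mh(2)] integrable_distr_eq[OF \<phi> mh(3)]
    unfolding pd by auto
  have eqs: "h_bar (push_J d f \<mu>) z = (\<integral>l. height (\<phi> l) \<partial>\<mu> z)" "hu_bar (push_J d f \<mu>) z = (\<integral>l. momentum (\<phi> l) \<partial>\<mu> z)"
    "integral\<^sup>L (push_J d f \<mu> z) (dissipation d f z) = (\<integral>l. dissipation d f z (\<phi> l) \<partial>\<mu> z)"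
    unfolding h_bar_def hu_bar_def pd by (rule integral_distr[OF \<phi> mh(1)] integral_distr[OF \<phi> mh(2)] integral_distr[OF \<phi> mh(3)])+
  let ?q = "\<lambda>l. - dissipation d f z (\<phi> l) - U \<bullet> friction d f z l - (momentum (\<phi> l) - height (\<phi> l) *\<^sub>R U) \<bullet> (- d *\<^sub>R c + f z)"
  have sp: "space (\<mu> z) = phase" using sets_eq_imp_space_eq[OF \<mu>(2)] by (simp add: space_restrict_space)
  have "(\<integral>l. ?q l \<partial>\<mu> z) \<le> (\<integral>l. 0 \<partial>\<mu> z)"
  proof (rule integral_mono)
    show "integrable (\<mu> z) ?q" using ih' iP' iD' iK by auto
    fix l assume "l \<in> space (\<mu> z)"
    then obtain l1 w where l: "l = (l1, w)" "0 \<le> l1" by (auto simp: sp phase_def)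
    obtain b where b: "norm b \<le> 1" "J_res d f z w - w = - d *\<^sub>R b + f z" using J_res_selection[OF d] by blast
    show "?q l \<le> 0"
      using friction_monotone[OF d l(2) b(1) c, of "J_res d f z w" "f z"]
      by (simp add: l \<phi>_def dissipation_def friction_def momentum_def height_def b(2))
  qed simp
  moreover have "(\<integral>l. ?q l \<partial>\<mu> z) = - (\<integral>l. dissipation d f z (\<phi> l) \<partial>\<mu> z) - U \<bullet> integral\<^sup>L (\<mu> z) (friction d f z)
      - ((\<integral>l. momentum (\<phi> l) \<partial>\<mu> z) - (\<integral>l. height (\<phi> l) \<partial>\<mu> z) *\<^sub>R U) \<bullet> (- d *\<^sub>R c + f z)"
    using ih' iP' iD' iK by simp
  ultimately show ?thesis unfolding eqs by simp
qed

theorem savage_hutter_coincidence: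
  fixes T c a d :: real and f :: "real \<times> (real^'n) \<Rightarrow> real^'n"
  assumes T: "0 < T" and "0 < c" "0 < a" and d: "0 < d"
    and H: "lipschitz_torus T H" "\<And>z. z \<in> slab T \<Longrightarrow> c \<le> H z" and U: "C1_torus T U"
    and sol: "savage_hutter_solution T a d f H U"
    and mv: "savage_hutter_mv_solution T a d f (\<lambda>x. H (0, x)) (\<lambda>x. U (0, x)) \<mu> m \<nu>inf"
    and adm: "savage_hutter_admissible T a d f (\<lambda>x. H (0, x)) (\<lambda>x. U (0, x)) \<mu> m \<nu>inf"
  shows "coincides T (push_J d f \<mu>) m H U"
proof -
  let ?\<nu> = "push_J d f \<mu>"
  obtain mt where mt: "disintegration T m mt"
    "AE t in lebesgue_on {0..T}. has_moment (lebesgue_on (cyl t)) ?\<nu> (dissipation d f) \<and>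
           enn2ereal (energy_mvs a 2 ?\<nu> mt \<nu>inf t) \<le>
             enn2ereal (energy_0 a 2 (\<lambda>x. H (0, x)) (\<lambda>x. U (0, x))) -
             ereal (\<integral>z. integral\<^sup>L (?\<nu> z) (dissipation d f z) \<partial>lebesgue_on (cyl t))"
    using adm unfolding savage_hutter_admissible_def by blast
  obtain b where b: "AE z in lebesgue_on (cyl T). b z \<in> B_abs (U z)"
    "strong_balance T a 2 (\<lambda>z. H z *\<^sub>R (- d *\<^sub>R b z + f z)) H U"
    using sol unfolding savage_hutter_solution_def by blast
  note mv' = mv[unfolded savage_hutter_mv_solution_def gen_young_measure_def]
  have \<mu>: "prob_space (\<mu> z)" "sets (\<mu> z) = sets (restrict_space borel phase)" if "z \<in> cyl T" for z
    using Linf_w_prob[of \<mu> "lebesgue_on (cyl T)" phase z] mv' that by auto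
  have ae: "AE z in lebesgue_on (cyl T). integrable (?\<nu> z) height \<and> integrable (?\<nu> z) momentum \<and> integrable (?\<nu> z) (dissipation d f z)"
  proof (rule AE_lebesgue_on_exhaust[OF _ _ _ T])
    have good: "AE t in lebesgue_on {0..T}. AE z in lebesgue_on (cyl t).
      integrable (?\<nu> z) height \<and> integrable (?\<nu> z) momentum \<and> integrable (?\<nu> z) (dissipation d f z)"
      using mt(2) mv'[THEN conjunct2, THEN conjunct2, THEN conjunct1, unfolded mv_mass_balance_def]
    proof eventually_elim
      case (elim t)
      then have "AE z in lebesgue_on (cyl t). integrable (?\<nu> z) height"
        "AE z in lebesgue_on (cyl t). integrable (?\<nu> z) momentum"
        "AE z in lebesgue_on (cyl t). integrable (?\<nu> z) (dissipation d f z)"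
        by (auto simp: has_moment_def)
      then show ?case by eventually_elim blast
    qed
    show "\<exists>t. s < t \<and> t < T \<and> (AE z in lebesgue_on (cyl t).
      integrable (?\<nu> z) height \<and> integrable (?\<nu> z) momentum \<and> integrable (?\<nu> z) (dissipation d f z))"
      if "0 \<le> s" "s < T" for s
      using AE_lebesgue_on_Icc_dense[OF good that] by blast
    show "AE z :: real \<times> (real^'n) in lborel. z \<in> cyl T \<longrightarrow> (\<exists>s. 0 \<le> s \<and> s < T \<and> (\<forall>t. s < t \<longrightarrow> z \<in> cyl t))"
      by (rule AE_cyl_exhaust)
  qed auto
  interpret weak_strong T c a 2 H U ?\<nu> m \<nu>inf mt "\<lambda>z. integral\<^sup>L (\<mu> z) (friction d f z)"
    "\<lambda>z. - integral\<^sup>L (?\<nu> z) (dissipation d f z)" "\<lambda>z. - d *\<^sub>R b z + f z"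
  proof
    show "prob_space (?\<nu> z) \<and> sets (?\<nu> z) = sets (restrict_space borel phase)" if "z \<in> cyl T" for z
      unfolding push_J_def
      using prob_space.prob_space_distr[OF \<mu>(1)[OF that] push_J_measurable[OF d \<mu>(2)[OF that]]] by simp
    show "AE t in lebesgue_on {0..T}. integrable (lebesgue_on (cyl t)) (\<lambda>z. - integral\<^sup>L (?\<nu> z) (dissipation d f z)) \<and>
      enn2ereal (energy_mvs a 2 ?\<nu> mt \<nu>inf t) \<le>
        enn2ereal (energy_0 a 2 (\<lambda>x. H (0, x)) (\<lambda>x. U (0, x))) + ereal (\<integral>z. - integral\<^sup>L (?\<nu> z) (dissipation d f z) \<partial>lebesgue_on (cyl t))"
      using mt(2) by eventually_elim (simp add: has_moment_def minus_ereal_def)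
    have fr: "AE z in lebesgue_on (cyl T). integrable (\<mu> z) (friction d f z)" using mv' by blast
    show "AE z in lebesgue_on (cyl T). - integral\<^sup>L (?\<nu> z) (dissipation d f z) - U z \<bullet> integral\<^sup>L (\<mu> z) (friction d f z)
      \<le> (hu_bar ?\<nu> z - h_bar ?\<nu> z *\<^sub>R U z) \<bullet> (- d *\<^sub>R b z + f z)"
      using AE_lebesgue_on_mem[OF ae] b(1) fr
    proof eventually_elim
      case (elim z)
      then show ?case using \<mu>[of z] by (intro push_J_compat[OF d]) auto
    qed
  qed (use assms mv' mt b in \<open>simp\<close>)+
  show ?thesis by (rule coincidence)
qed

theorem theorem1p1:
  fixes T c :: real
  assumes "T > 0" and "c > 0"
  shows
    "(\<forall>(\<gamma>::real) (\<kappa>::real) (G :: real \<times> (real^'n) \<Rightarrow> real^'n) H U \<nu> m \<nu>inf.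
        \<gamma> > 1 \<longrightarrow> \<kappa> > 0 \<longrightarrow> Linf_L2 T G \<longrightarrow>
        lipschitz_torus T H \<longrightarrow> (\<forall>z\<in>{0..T} \<times> UNIV. H z \<ge> c) \<longrightarrow> C1_torus T U \<longrightarrow>
        euler_solution T \<kappa> \<gamma> G H U \<longrightarrow>
        euler_mv_solution T \<kappa> \<gamma> G (\<lambda>x. H (0, x)) (\<lambda>x. U (0, x)) \<nu> m \<nu>inf \<longrightarrow>
        euler_admissible T \<kappa> \<gamma> G (\<lambda>x. H (0, x)) (\<lambda>x. U (0, x)) \<nu> m \<nu>inf \<longrightarrow>
        coincides T \<nu> m H U)
     \<and>
     (\<forall>(a::real) (d::real) (f :: real \<times> (real^'k) \<Rightarrow> real^'k) H U \<mu> m \<nu>inf.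
        CARD('k) \<in> {1, 2} \<longrightarrow> a > 0 \<longrightarrow> d > 0 \<longrightarrow> Linf_L2 T f \<longrightarrow>
        lipschitz_torus T H \<longrightarrow> (\<forall>z\<in>{0..T} \<times> UNIV. H z \<ge> c) \<longrightarrow> C1_torus T U \<longrightarrow>
        savage_hutter_solution T a d f H U \<longrightarrow>
        savage_hutter_mv_solution T a d f (\<lambda>x. H (0, x)) (\<lambda>x. U (0, x)) \<mu> m \<nu>inf \<longrightarrow>
        savage_hutter_admissible T a d f (\<lambda>x. H (0, x)) (\<lambda>x. U (0, x)) \<mu> m \<nu>inf \<longrightarrow>
        coincides T (push_J d f \<mu>) m H U)"
proof (intro conjI allI impI)
  fix \<gamma> \<kappa> :: real and G :: "real \<times> (real^'n) \<Rightarrow> real^'n" and H U \<nu> m \<nu>inf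
  assume "\<gamma> > 1" "\<kappa> > 0" "lipschitz_torus T H" "\<forall>z\<in>{0..T} \<times> UNIV. H z \<ge> c" "C1_torus T U"
    "euler_solution T \<kappa> \<gamma> G H U"
    "euler_mv_solution T \<kappa> \<gamma> G (\<lambda>x. H (0, x)) (\<lambda>x. U (0, x)) \<nu> m \<nu>inf"
    "euler_admissible T \<kappa> \<gamma> G (\<lambda>x. H (0, x)) (\<lambda>x. U (0, x)) \<nu> m \<nu>inf"
  then show "coincides T \<nu> m H U" using assms by (intro euler_coincidence[where c = c]) auto
next
  fix a d :: real and f :: "real \<times> (real^'k) \<Rightarrow> real^'k" and H U \<mu> m \<nu>inf
  assume "a > 0" "d > 0" "lipschitz_torus T H" "\<forall>z\<in>{0..T} \<times> UNIV. H z \<ge> c" "C1_torus T U"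
    "savage_hutter_solution T a d f H U"
    "savage_hutter_mv_solution T a d f (\<lambda>x. H (0, x)) (\<lambda>x. U (0, x)) \<mu> m \<nu>inf"
    "savage_hutter_admissible T a d f (\<lambda>x. H (0, x)) (\<lambda>x. U (0, x)) \<mu> m \<nu>inf"
  then show "coincides T (push_J d f \<mu>) m H U" using assms by (intro savage_hutter_coincidence[where c = c]) auto
qed

end
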